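(* Let $G$ be a non-unimodular, almost unimodular locally compact second countable group whose unimodular part $\ker\Delta_G$ is simply connected. Let $\Gamma$ be a countable dense subgroup of $G$ such that the left translation action $\Gamma\curvearrowright G$ is strongly ergodic. Let $H$ be an almost unimodular locally compact second countable group whose unimodular part $\ker\Delta_H$ is simply connected, and let $\Lambda$ be a countable, not necessarily dense, subgroup of $H$, acting on $H$ by left translation. Then $\Gamma\curvearrowright G$ is stably orbit equivalent to $\Lambda\curvearrowright H$ if and only if there exists a topological isomorphism $\delta : \ker\Delta_G\to\ker\Delta_H$ satisfying $\delta(\Gamma\cap\ker\Delta_G)=\Lambda\cap\ker\Delta_H$.
   Context: A locally compact group $G$ with modular function $\Delta_G : G\to\mathbb{R}_+=(0,\infty)$ is called almost unimodular if $\ker\Delta_G$ is open in $G$; $\ker\Delta_G$ is called its unimodular part. Simply connected groups are in particular connected. Every locally compact second countable group $K$ is equipped with a probability measure $\mu_K$ equivalent to its left Haar measure. A non-singular countable Borel equivalence relation $\mathcal{R}$ on a standard probability space $(X,\mu)$ has full group $[\mathcal{R}]$, the group of (non-singular) Borel automorphisms $g$ of $X$ with $(gx,x)\in\mathcal{R}$ for almost every $x$. An almost invariant sequence for $\mathcal{R}$ is a sequence of measurable sets $A_n\subset X$ with $\mu(A_n \,\Delta\, gA_n)\to 0$ for all $g\in[\mathcal{R}]$; it is trivial if $\mu(A_n)(1-\mu(A_n))\to 0$. $\mathcal{R}$ is strongly ergodic if it has no non-trivial almost invariant sequence. A non-singular action of a countable group is strongly ergodic if its orbit equivalence relation is. Two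 non-singular actions $\Gamma\curvearrowright(X,\mu)$ and $\Lambda\curvearrowright(Y,\lambda)$ of countable groups are stably orbit equivalent if there are non-null measurable sets $E\subset X$, $F\subset Y$ and a non-singular Borel isomorphism of measure spaces $\theta : E\to F$ such that $\theta(\Gamma x\cap E)=\Lambda\theta(x)\cap F$ for almost every $x\in E$. *)

theory Defs
  imports "HOL-Probability.Probability"
begin

(* Locally compact groups, via the library class of not necessarily commutative topological
   groups. That class is written additively: x + y is the group product, - x the inverse
   and 0 the neutral element. *)

class lcsc_group = topological_group_add + t2_space + second_countable_topology +
  assumes locally_compact: "\<exists>U K. open U \<and> compact K \<and> x \<in> U \<and> U \<subseteq> K"

definition is_subgroup :: "'g::group_add set \<Rightarrow> bool" where
  "is_subgroup S \<longleftrightarrow> 0 \<in> S \<and> (\<forall>x\<in>S. \<forall>y\<in>S. x + y \<in> S) \<and> (\<forall>x\<in>S. - x \<in> S)"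

(* Regularity is not listed: on a second countable locally compact Hausdorff space every
   Borel measure that is finite on compact sets is regular. *)
definition left_haar_measure :: "'g::lcsc_group measure \<Rightarrow> bool" where
  "left_haar_measure M \<longleftrightarrow>
     sets M = sets borel \<and>
     emeasure M UNIV \<noteq> 0 \<and>
     (\<forall>K. compact K \<longrightarrow> emeasure M K < \<infinity>) \<and>
     (\<forall>g. \<forall>A\<in>sets borel. emeasure M ((\<lambda>x. g + x) ` A) = emeasure M A)"

(* Convention M(A g) = Delta(g) M(A). The other common convention gives the function
   g \<mapsto> 1 / Delta(g), which has the same kernel. *)
definition modular_function :: "'g::lcsc_group \<Rightarrow> real" where
  "modular_function g = (THE c. c > 0 \<and>
     (\<forall>M. left_haar_measure M \<longrightarrow>
        (\<forall>A\<in>sets borel. emeasure M ((\<lambda>x. x + g) ` A) = ennreal c * emeasure M A)))"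

definition unimodular_part :: "'g::lcsc_group set" where
  "unimodular_part = {g. modular_function g = 1}"

definition unimodular :: "'g::lcsc_group itself \<Rightarrow> bool" where
  "unimodular _ \<longleftrightarrow> (\<forall>g::'g. modular_function g = 1)"

definition almost_unimodular :: "'g::lcsc_group itself \<Rightarrow> bool" where
  "almost_unimodular _ \<longleftrightarrow> open (unimodular_part :: 'g set)"

(* The probability measures with which a locally compact second countable group is equipped. *)
definition haar_class_probability :: "'g::lcsc_group measure \<Rightarrow> bool" where
  "haar_class_probability \<mu> \<longleftrightarrow>
     prob_space \<mu> \<and> sets \<mu> = sets borel \<and>
     (\<exists>M. left_haar_measure M \<and> absolutely_continuous M \<mu> \<and> absolutely_continuous \<mu> M)"

definition nonsingular_isomorphism :: "'a measure \<Rightarrow> 'b measure \<Rightarrow> ('a \<Rightarrow> 'b) \<Rightarrow> bool" where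
  "nonsingular_isomorphism M N f \<longleftrightarrow>
     bij_betw f (space M) (space N) \<and>
     f \<in> measurable M N \<and> inv_into (space M) f \<in> measurable N M \<and>
     (\<forall>A\<in>sets N. f -` A \<inter> space M \<in> null_sets M \<longleftrightarrow> A \<in> null_sets N)"

definition full_group :: "'a measure \<Rightarrow> ('a \<times> 'a) set \<Rightarrow> ('a \<Rightarrow> 'a) set" where
  "full_group M R = {g. nonsingular_isomorphism M M g \<and> (AE x in M. (g x, x) \<in> R)}"

definition almost_invariant_sequence ::
    "'a measure \<Rightarrow> ('a \<times> 'a) set \<Rightarrow> (nat \<Rightarrow> 'a set) \<Rightarrow> bool" where
  "almost_invariant_sequence M R A \<longleftrightarrow>
     (\<forall>n. A n \<in> sets M) \<and>
     (\<forall>g\<in>full_group M R. (\<lambda>n. measure M ((A n - g ` A n) \<union> (g ` A n - A n))) \<longlonglongrightarrow> 0)"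

definition strongly_ergodic :: "'a measure \<Rightarrow> ('a \<times> 'a) set \<Rightarrow> bool" where
  "strongly_ergodic M R \<longleftrightarrow>
     (\<forall>A. almost_invariant_sequence M R A \<longrightarrow>
        (\<lambda>n. measure M (A n) * (1 - measure M (A n))) \<longlonglongrightarrow> 0)"

definition action_orbit :: "'g set \<Rightarrow> ('g \<Rightarrow> 'a \<Rightarrow> 'a) \<Rightarrow> 'a \<Rightarrow> 'a set" where
  "action_orbit \<Gamma> act x = (\<lambda>g. act g x) ` \<Gamma>"

definition orbit_relation :: "'g set \<Rightarrow> ('g \<Rightarrow> 'a \<Rightarrow> 'a) \<Rightarrow> 'a measure \<Rightarrow> ('a \<times> 'a) set" where
  "orbit_relation \<Gamma> act M = {(y, x). x \<in> space M \<and> y \<in> action_orbit \<Gamma> act x}"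

definition strongly_ergodic_action :: "'g set \<Rightarrow> ('g \<Rightarrow> 'a \<Rightarrow> 'a) \<Rightarrow> 'a measure \<Rightarrow> bool" where
  "strongly_ergodic_action \<Gamma> act M \<longleftrightarrow> strongly_ergodic M (orbit_relation \<Gamma> act M)"

definition stably_orbit_equivalent ::
    "'g set \<Rightarrow> ('g \<Rightarrow> 'a \<Rightarrow> 'a) \<Rightarrow> 'a measure \<Rightarrow>
     'h set \<Rightarrow> ('h \<Rightarrow> 'b \<Rightarrow> 'b) \<Rightarrow> 'b measure \<Rightarrow> bool" where
  "stably_orbit_equivalent \<Gamma> a M \<Lambda> b N \<longleftrightarrow>
     (\<exists>E\<in>sets M. \<exists>F\<in>sets N. \<exists>\<theta>.
        emeasure M E \<noteq> 0 \<and> emeasure N F \<noteq> 0 \<and>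
        nonsingular_isomorphism (restrict_space M E) (restrict_space N F) \<theta> \<and>
        (AE x in M. x \<in> E \<longrightarrow> \<theta> ` (action_orbit \<Gamma> a x \<inter> E) = action_orbit \<Lambda> b (\<theta> x) \<inter> F))"

definition topological_group_isomorphism ::
    "'g::lcsc_group set \<Rightarrow> 'h::lcsc_group set \<Rightarrow> ('g \<Rightarrow> 'h) \<Rightarrow> bool" where
  "topological_group_isomorphism S T \<delta> \<longleftrightarrow>
     homeomorphic_map (top_of_set S) (top_of_set T) \<delta> \<and>
     (\<forall>x\<in>S. \<forall>y\<in>S. \<delta> (x + y) = \<delta> x + \<delta> y)"

end

theory Submission
  imports Defs
begin

text \<open>
  An orbit equivalence extends to a Borel map \<open>\<theta>\<close> from a \<open>\<Gamma>\<close>-invariant conull subset of \<open>G\<close> to \<open>H\<close> with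
  \<open>\<theta> (\<gamma> + x) \<in> \<Lambda> + \<theta> x\<close>. For \<open>s\<close> in \<open>K = ker \<Delta>\<^sub>G\<close> close to the identity the map \<open>x \<mapsto> - \<theta> x + \<theta> (x + s)\<close> is nearly
  \<open>\<Gamma>\<close>-invariant, because the cocycle of \<open>\<theta>\<close> has countably many values. Strong ergodicity makes every
  preimage under this map nearly null or nearly conull, so the map equals a constant \<open>\<delta> s\<close> up to a
  small set. The constants form a continuous local homomorphism, which extends to \<open>K\<close> by
  monodromy; a path connected locally compact group is locally path connected, by an open mapping
  argument. By Fubini \<open>\<theta> (x\<^sub>0 + g) \<in> \<Lambda> + \<theta> x\<^sub>0 + \<delta> g\<close> for almost all \<open>g\<close> in \<open>K\<close>, and up to conjugation
  \<open>\<delta>\<close> pulls \<open>\<Lambda>\<close> back to \<open>\<Gamma>\<close>. Its image is not null, hence open and all of \<open>ker \<Delta>\<^sub>H\<close>; its kernel is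
  countable and closed, hence discrete, and then trivial since \<open>ker \<Delta>\<^sub>H\<close> is simply connected.
\<close>

text \<open>Openness of the kernel enters through \<open>haar_right\<close>: elements close to 0 are
  unimodular, so small right translations preserve Haar measure itself and not just its null sets.
  Additivity of the constants rests on this, since bad sets can be moved by right translation
  without growing. The probability \<open>\<mu>\<close> lacks that invariance, so the estimates pass
  back and forth between \<open>\<mu>\<close>, to which strong ergodicity applies, and Haar measure
  on compact sets. The hidden obstacle is local path connectedness: monodromy yields a homomorphism
  that agrees with the constants only at the ends of short paths, and simple connectedness does not
  by itself say that these ends fill a neighbourhood. The conjugation arises because
  \<open>\<Gamma>\<close> translates from the left while \<open>\<delta>\<close> describes
  increments on the right. On the side of \<open>H\<close> no ergodicity is available; there
  surjectivity comes from Steinhaus' theorem and connectedness. For the converse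
  \<open>\<delta>\<close> itself is the orbit equivalence, between the two kernels, which are open
  and hence non-null.\<close>

subsection \<open>Topological groups\<close>

text \<open>Sums are kept in the normal form with associativity to the right and - a for inverses.\<close>

lemmas grp = add.assoc minus_add

declare add_uminus_conv_diff [simp del]

lemma open_vimage_cont: "open {x. f x \<in> S}" if "open S" "continuous_on UNIV f"
  using open_vimage[OF that] by (simp add: vimage_def)

lemma zero_nbhd_symmetric:
  fixes U :: "'g::topological_group_add set"
  assumes "open U" "0 \<in> U"
  shows "\<exists>V. open V \<and> 0 \<in> V \<and> V \<subseteq> U \<and> (\<forall>x\<in>V. - x \<in> V) \<and> (\<forall>x\<in>V. \<forall>y\<in>V. x + y \<in> U)"
proof -
  have "open ((\<lambda>p. fst p + snd p) -` U)"
    by (intro open_vimage assms continuous_intros)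
  then obtain A B where "open A" "open B" "(0, 0) \<in> A \<times> B" "A \<times> B \<subseteq> (\<lambda>p. fst p + snd p) -` U"
    using assms(2) by (elim open_prod_elim[where x = "(0,0)"]) auto
  then have AB: "open A" "open B" "0 \<in> A" "0 \<in> B" "\<And>x y. x \<in> A \<Longrightarrow> y \<in> B \<Longrightarrow> x + y \<in> U"
    by auto
  define V where "V = (A \<inter> B \<inter> U) \<inter> {x. - x \<in> A \<inter> B \<inter> U}"
  have "open V" unfolding V_def
    by (intro open_Int AB assms open_vimage_cont continuous_intros)
  then show ?thesis by (intro exI[of _ V]) (use AB assms in \<open>auto simp: V_def\<close>)
qed

text \<open>Replaces a metric: a point of the closure differs from some point of \<open>A\<close> by
  a right factor in \<open>V\<close>.\<close>

lemma ex_near_closure: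
  fixes V :: "'g::topological_group_add set"
  assumes "open V" "0 \<in> V" "x \<in> closure A"
  shows "\<exists>a\<in>A. - a + x \<in> V"
proof -
  have "open {a. - a + x \<in> V}" by (intro open_vimage_cont assms continuous_intros)
  moreover have "x \<in> {a. - a + x \<in> V}" using assms by simp
  ultimately have "{a. - a + x \<in> V} \<inter> A \<noteq> {}"
    using assms(3) by (metis closure_iff_nhds_not_empty inf.commute subset_refl)
  then show ?thesis by auto
qed

text \<open>The closure of \<open>V\<close> lies in \<open>V + V\<close>. Hence a neighbourhood
  whose sums stay in \<open>U \<inter> W\<close> has its closure inside \<open>U\<close> and inside
  the compact \<open>C\<close>.\<close>

lemma zero_nbhd_compact:
  fixes U :: "'g::lcsc_group set"
  assumes "open U" "0 \<in> U"
  shows "\<exists>V. open V \<and> 0 \<in> V \<and> compact (closure V) \<and> closure V \<subseteq> U"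
proof -
  obtain W C :: "'g set" where W: "open W" "compact C" "0 \<in> W" "W \<subseteq> C"
    using locally_compact[of "0::'g"] by blast
  have UW: "open (U \<inter> W)" "0 \<in> U \<inter> W" using W assms by auto
  obtain V where V: "open V" "0 \<in> V" "V \<subseteq> U \<inter> W" "\<forall>x\<in>V. \<forall>y\<in>V. x + y \<in> U \<inter> W"
    using zero_nbhd_symmetric[OF UW] by blast
  have "closure V \<subseteq> U \<inter> W"
  proof
    fix x assume "x \<in> closure V"
    then obtain a where "a \<in> V" "- a + x \<in> V" using ex_near_closure[OF V(1,2)] by auto
    then show "x \<in> U \<inter> W" using V(4) by (metis add_minus_cancel)
  qed
  moreover have "compact (closure V)"
    using compact_Int_closed[OF W(2) closed_closure[of V]] calculation W(4)
    by (metis Int_absorb1 le_inf_iff order_trans)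
  ultimately show ?thesis using V by blast
qed

lemma measurable_uminus_group [measurable (raw)]:
  fixes f :: "'a \<Rightarrow> 'g::{second_countable_topology, topological_group_add}"
  assumes "f \<in> borel_measurable M"
  shows "(\<lambda>x. - f x) \<in> borel_measurable M"
  by (rule borel_measurable_continuous_on[OF _ assms]) (intro continuous_intros)

text \<open>By Lindelof, the translates of \<open>V\<close> have a countable subcover, which
  \<open>h\<close> enumerates.\<close>

lemma countable_translates:
  fixes V :: "'h::{topological_group_add, second_countable_topology} set"
  assumes "open V" "0 \<in> V"
  shows "\<exists>h::nat \<Rightarrow> 'h. \<forall>x. \<exists>i. - h i + x \<in> V"
proof -
  let ?F = "range (\<lambda>g. {x. - g + x \<in> V})"
  have "\<And>S. S \<in> ?F \<Longrightarrow> open S" by (auto intro!: open_vimage_cont assms continuous_intros)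
  then obtain F where F: "F \<subseteq> ?F" "countable F" "\<Union>F = \<Union>?F"
    by (rule Lindelof[of ?F])
  obtain G where G: "F = (\<lambda>g. {x. - g + x \<in> V}) ` G" "countable G"
    using countable_subset_image[of F "\<lambda>g. {x. - g + x \<in> V}" UNIV] F by auto
  have "x \<in> \<Union>?F" for x using assms(2) by (auto intro!: exI[of _ x])
  then have cover: "\<exists>g\<in>G. - g + x \<in> V" for x using F(3) G(1) by auto
  then have "G \<noteq> {}" by auto
  show ?thesis
  proof (intro exI[of _ "from_nat_into G"] allI)
    fix x obtain g where "g \<in> G" "- g + x \<in> V" using cover by blast
    then show "\<exists>i. - from_nat_into G i + x \<in> V" using from_nat_into_surj[OF G(2)] by metis
  qed
qed

lemma lcsc_group_cover_compact:
  "\<exists>\<C> :: 'g::lcsc_group set set. countable \<C> \<and> (\<forall>C\<in>\<C>. compact C) \<and> \<Union>\<C> = UNIV"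
proof -
  obtain V :: "'g set" where V: "open V" "0 \<in> V" "compact (closure V)"
    using zero_nbhd_compact[of UNIV] by blast
  obtain h :: "nat \<Rightarrow> 'g" where h: "\<And>x. \<exists>i. - h i + x \<in> V" using countable_translates[OF V(1,2)] by blast
  have "x \<in> (\<Union>i. (+) (h i) ` closure V)" for x
  proof -
    obtain i where "- h i + x \<in> closure V" using h closure_subset by blast
    then have "h i + (- h i + x) \<in> (+) (h i) ` closure V" by (rule imageI)
    then show ?thesis by auto
  qed
  moreover have "compact ((+) (h i) ` closure V)" for i
    by (intro compact_continuous_image V continuous_intros)
  ultimately show ?thesis by (intro exI[of _ "range (\<lambda>i. (+) (h i) ` closure V)"]) auto
qed

subsection \<open>Haar measure\<close>

locale haar =
  fixes M :: "'g::lcsc_group measure"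
  assumes left_haar: "left_haar_measure M"
begin

lemma sets_haar [measurable_cong, simp]: "sets M = sets borel"
  and haar_UNIV: "emeasure M UNIV \<noteq> 0"
  and haar_compact: "compact C \<Longrightarrow> emeasure M C < \<infinity>"
  using left_haar by (auto simp: left_haar_measure_def)

lemma space_haar [simp]: "space M = UNIV"
  using sets_eq_imp_space_eq[OF sets_haar] by simp

lemma haar_left: "emeasure M {x. g + x \<in> A} = emeasure M A" if "A \<in> sets borel"
proof -
  have "{x. g + x \<in> A} = (\<lambda>x. - g + x) ` A"
    by (auto simp: image_iff) (metis minus_add_cancel)
  then show ?thesis using left_haar that by (simp add: left_haar_measure_def)
qed

sublocale sigma_finite_measure M
proof
  obtain \<C> :: "'g set set" where "countable \<C>" "\<forall>C\<in>\<C>. compact C" "\<Union>\<C> = UNIV"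
    using lcsc_group_cover_compact by blast
  then show "\<exists>A. countable A \<and> A \<subseteq> sets M \<and> \<Union> A = space M \<and> (\<forall>a\<in>A. emeasure M a \<noteq> \<infinity>)"
    by (intro exI[of _ \<C>]) (auto dest!: haar_compact intro: borel_compact)
qed

end

lemma ennreal_cancel_right:
  assumes "ennreal a * m = ennreal b * m" "m \<noteq> 0" "m \<noteq> \<infinity>" "a > 0" "b > 0"
  shows "a = b"
  using assms by (cases m) (auto simp: ennreal_mult[symmetric] ennreal_inj)

lemma AE_ex_in:
  assumes "AE x in M. P x" "emeasure M K \<noteq> 0"
  shows "\<exists>x\<in>K. P x"
proof (rule ccontr)
  assume "\<not> ?thesis"
  moreover obtain N where N: "{x \<in> space M. \<not> P x} \<subseteq> N" "emeasure M N = 0" "N \<in> sets M"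
    using assms(1) by (rule AE_E)
  moreover have "K \<subseteq> space M" using emeasure_neq_0_sets[OF assms(2)] by (rule sets.sets_into_space)
  ultimately have "K \<subseteq> N" by auto
  from emeasure_mono[OF this N(3)] N(2) assms(2) show False by simp
qed

text \<open>Invariance is asked only for subsets of \<open>S\<close>, so that the image of Haar
  measure under an isomorphism onto an open subgroup, a measure carried by that subgroup, is covered
  as well.\<close>

definition left_invariant_on :: "'g::lcsc_group set \<Rightarrow> 'g measure \<Rightarrow> bool" where
  "left_invariant_on S P \<longleftrightarrow>
     (\<forall>g\<in>S. \<forall>A\<in>sets borel. A \<subseteq> S \<longrightarrow> emeasure P {x. g + x \<in> A} = emeasure P A)"

text \<open>Fubini on the set of all (x, y) with - y + x in A.\<close>

lemma left_invariant_null_inverse: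
  fixes P Q :: "'g::lcsc_group measure"
  assumes "sigma_finite_measure P" "sigma_finite_measure Q"
    and [measurable_cong]: "sets P = sets borel" "sets Q = sets borel"
    and [measurable]: "S \<in> sets borel" and S: "is_subgroup S"
    and P: "left_invariant_on S P"
    and Q: "left_invariant_on S Q"
    and "emeasure P S \<noteq> 0"
    and A [measurable]: "A \<in> sets borel" and "A \<subseteq> S" "emeasure P A = 0"
  shows "emeasure Q {x. - x \<in> A} = 0"
proof -
  interpret P: sigma_finite_measure P by fact
  interpret Q: sigma_finite_measure Q by fact
  interpret PQ: pair_sigma_finite P Q ..
  have sp: "space P = UNIV" "space Q = UNIV"
    using assms(3,4)[THEN sets_eq_imp_space_eq] by simp_all
  have S': "0 \<in> S" "\<And>x y. x \<in> S \<Longrightarrow> y \<in> S \<Longrightarrow> x + y \<in> S" "\<And>x. x \<in> S \<Longrightarrow> - x \<in> S"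
    using S by (auto simp: is_subgroup_def)
  define T where "T = {(x, y). x \<in> S \<and> y \<in> S \<and> - y + x \<in> A}"
  have "{p \<in> space (P \<Otimes>\<^sub>M Q). fst p \<in> S \<and> snd p \<in> S \<and> - snd p + fst p \<in> A} \<in> sets (P \<Otimes>\<^sub>M Q)"
    by measurable
  then have T [measurable]: "T \<in> sets (P \<Otimes>\<^sub>M Q)"
    by (simp add: T_def space_pair_measure sp split_beta')
  have B [measurable]: "{x. - x \<in> A} \<in> sets borel" by measurable
  have "emeasure (P \<Otimes>\<^sub>M Q) T = (\<integral>\<^sup>+y. emeasure P ((\<lambda>x. (x, y)) -` T) \<partial>Q)"
    by (rule PQ.emeasure_pair_measure_alt2[OF T])
  also have "\<dots> = (\<integral>\<^sup>+y. 0 \<partial>Q)"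
  proof (rule nn_integral_cong)
    fix y
    show "emeasure P ((\<lambda>x. (x, y)) -` T) = 0"
    proof (cases "y \<in> S")
      case True
      have "(\<lambda>x. (x, y)) -` T = {x. - y + x \<in> A}"
        using True \<open>A \<subseteq> S\<close> S' by (auto simp: T_def) (metis add_minus_cancel subsetD)
      then show ?thesis using P assms True S' by (simp add: left_invariant_on_def)
    qed (simp add: T_def)
  qed
  finally have 0: "emeasure (P \<Otimes>\<^sub>M Q) T = 0" by simp
  \<comment> \<open>In this order of integration the sections are left translates of the inverse of
    \<open>A\<close>, so the integral factors into a product with the \<open>P\<close>-mass of
    \<open>S\<close>.\<close>
  have "emeasure (P \<Otimes>\<^sub>M Q) T = (\<integral>\<^sup>+x. emeasure Q (Pair x -` T) \<partial>P)"
    by (rule Q.emeasure_pair_measure_alt[OF T])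
  also have "\<dots> = (\<integral>\<^sup>+x. emeasure Q {x. - x \<in> A} * indicator S x \<partial>P)"
  proof (rule nn_integral_cong)
    fix x
    show "emeasure Q (Pair x -` T) = emeasure Q {x. - x \<in> A} * indicator S x"
    proof (cases "x \<in> S")
      case True
      have "Pair x -` T = {y. - x + y \<in> {z. - z \<in> A}}"
        using True \<open>A \<subseteq> S\<close> S' by (auto simp: T_def grp) (metis add_minus_cancel minus_add minus_minus subsetD)
      moreover have "{z. - z \<in> A} \<subseteq> S"
      proof
        fix z assume "z \<in> {z. - z \<in> A}"
        then have "- (- z) \<in> S" using S' \<open>A \<subseteq> S\<close> by blast
        then show "z \<in> S" by simp
      qed
      then have "emeasure Q {y. - x + y \<in> {z. - z \<in> A}} = emeasure Q {z. - z \<in> A}"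
        using True S' Q B unfolding left_invariant_on_def by blast
      ultimately show ?thesis using True by simp
    qed (simp add: T_def)
  qed
  also have "\<dots> = emeasure Q {x. - x \<in> A} * emeasure P S"
    by (subst nn_integral_cmult_indicator) (auto simp: assms)
  finally show ?thesis using 0 \<open>emeasure P S \<noteq> 0\<close> by simp
qed

text \<open>Inversion carries \<open>P\<close>-null sets to \<open>Q\<close>-null sets and also
  \<open>Q\<close>-null sets to \<open>Q\<close>-null sets; applying the two in turn returns to
  \<open>A\<close>.\<close>

lemma left_invariant_null_iff:
  fixes P Q :: "'g::lcsc_group measure"
  assumes "sigma_finite_measure P" "sigma_finite_measure Q"
    and "sets P = sets borel" "sets Q = sets borel"
    and "S \<in> sets borel" and S: "is_subgroup S"
    and P: "left_invariant_on S P"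
    and Q: "left_invariant_on S Q"
    and "emeasure P S \<noteq> 0" "emeasure Q S \<noteq> 0"
    and A [measurable]: "A \<in> sets borel" and "A \<subseteq> S"
  shows "emeasure P A = 0 \<longleftrightarrow> emeasure Q A = 0"
proof -
  let ?B = "{x. - x \<in> A}"
  have B: "?B \<in> sets borel" by measurable
  have BS: "?B \<subseteq> S"
  proof
    fix x assume "x \<in> ?B"
    then have "- (- x) \<in> S" using S \<open>A \<subseteq> S\<close> unfolding is_subgroup_def by blast
    then show "x \<in> S" by simp
  qed
  have "{x. - x \<in> ?B} = A" by auto
  then show ?thesis
    using left_invariant_null_inverse[OF assms(1,2,3,4,5,6,7,8,9,11,12)]
      left_invariant_null_inverse[OF assms(2,1,4,3,5,6,8,7,10,11,12)]
      left_invariant_null_inverse[OF assms(2,2,4,4,5,6,8,8,10) B BS]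
      left_invariant_null_inverse[OF assms(1,1,3,3,5,6,7,7,9) B BS]
    by auto
qed

lemma is_subgroup_UNIV [simp]: "is_subgroup UNIV"
  by (simp add: is_subgroup_def)

context haar
begin

lemma haar_left_measurable [measurable]: "A \<in> sets borel \<Longrightarrow> {x. g + x \<in> A} \<in> sets borel"
  "A \<in> sets borel \<Longrightarrow> {x. x + g \<in> A} \<in> sets borel"
  "A \<in> sets borel \<Longrightarrow> {x::'g. - x \<in> A} \<in> sets borel"
proof -
  assume [measurable]: "A \<in> sets borel"
  show "{x. g + x \<in> A} \<in> sets borel" "{x. x + g \<in> A} \<in> sets borel" "{x::'g. - x \<in> A} \<in> sets borel"
    by measurable
qed

lemma haar_left_null_sets:
  assumes "A \<in> null_sets M"
  shows "{x. g + x \<in> A} \<in> null_sets M"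
proof -
  have A: "A \<in> sets borel" using null_setsD2[OF assms] by simp
  show ?thesis
    by (rule null_setsI) (use haar_left[OF A] null_setsD1[OF assms] haar_left_measurable(1)[OF A] in simp_all)
qed

lemma haar_left_invariant: "left_invariant_on S M"
  by (simp add: left_invariant_on_def haar_left)

lemma haar_inverse_null: "emeasure M {x. - x \<in> A} = 0" if "A \<in> sets borel" "emeasure M A = 0"
  by (rule left_invariant_null_inverse[where P = M and S = UNIV])
     (use that haar_left_invariant haar_UNIV sigma_finite_measure_axioms in auto)

text \<open>A right translation is a left translation conjugated by inversion, and each of these
  maps preserves null sets.\<close>

lemma haar_right_null: "emeasure M {x. x + g \<in> A} = 0" if [measurable]: "A \<in> sets borel" and 0: "emeasure M A = 0"
proof -
  have "emeasure M {y. - g + y \<in> {z. - z \<in> A}} = 0"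
    using haar_inverse_null[OF that] by (subst haar_left) auto
  then have "emeasure M {x. - x \<in> {y. - g + y \<in> {z. - z \<in> A}}} = 0"
    by (intro haar_inverse_null) auto
  then show ?thesis by (simp add: grp)
qed

text \<open>Countably many left translates of \<open>U\<close> cover the group, so a null
  \<open>U\<close> would make the whole measure vanish.\<close>

lemma haar_open_pos: "emeasure M U \<noteq> 0" if U: "open U" "U \<noteq> {}"
proof
  assume 0: "emeasure M U = 0"
  obtain u where u: "u \<in> U" using U(2) by blast
  have "open {x. u + x \<in> U}" "0 \<in> {x. u + x \<in> U}"
    using u by (auto intro!: open_vimage_cont U continuous_intros)
  from countable_translates[OF this] obtain h :: "nat \<Rightarrow> 'g" where h: "\<And>x. \<exists>i. u + (- h i + x) \<in> U" by blast
  have "{x. u + - h i + x \<in> U} \<in> null_sets M" for i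
    using 0 U(1) by (intro haar_left_null_sets null_setsI) simp_all
  then have "(\<Union>i. {x. u + - h i + x \<in> U}) \<in> null_sets M" by (rule null_sets_UN)
  moreover have "(\<Union>i. {x. u + - h i + x \<in> U}) = UNIV" using h by (auto simp: grp)
  ultimately show False using haar_UNIV by auto
qed

lemma haar_compact_pos: "\<exists>C. compact C \<and> emeasure M C \<noteq> 0 \<and> emeasure M C \<noteq> \<infinity>"
proof -
  obtain V :: "'g set" where V: "open V" "0 \<in> V" "compact (closure V)"
    using zero_nbhd_compact[of UNIV] by blast
  have "emeasure M V \<le> emeasure M (closure V)"
    by (intro emeasure_mono closure_subset) (auto simp: V)
  then have "emeasure M (closure V) \<noteq> 0" using haar_open_pos[of V] V(1,2) by (metis empty_iff le_zero_eq)
  then show ?thesis using V haar_compact[OF V(3)] by (intro exI[of _ "closure V"]) auto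
qed

lemma haar_left_distr: "distr M borel ((+) g) = M"
  by (rule measure_eqI) (auto simp: emeasure_distr vimage_def haar_left)

end

text \<open>Equality of null sets gives \<open>N\<close> a density \<open>f\<close>. Invariance
  makes \<open>f (g + x) = f x\<close> for each \<open>g\<close> and almost all \<open>x\<close>;
  Fubini then provides one \<open>x0\<close> for which this holds for almost all \<open>g\<close>,
  so \<open>f\<close> is constant almost everywhere.\<close>

lemma haar_unique:
  fixes M N :: "'g::lcsc_group measure"
  assumes "left_haar_measure M" "left_haar_measure N"
  shows "\<exists>c>0. \<forall>A\<in>sets borel. emeasure N A = ennreal c * emeasure M A"
proof -
  interpret M: haar M by unfold_locales fact
  interpret N: haar N by unfold_locales fact
  interpret pair_sigma_finite M M ..
  have ac: "absolutely_continuous M N"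
    unfolding absolutely_continuous_def
  proof
    fix A assume "A \<in> null_sets M"
    then show "A \<in> null_sets N"
      using left_invariant_null_iff[of M N UNIV A] M.sigma_finite_measure_axioms N.sigma_finite_measure_axioms
        M.haar_left_invariant N.haar_left_invariant M.haar_UNIV N.haar_UNIV
      by (auto simp: null_sets_def)
  qed
  define f where "f = RN_deriv M N"
  have f [measurable]: "f \<in> borel_measurable borel"
    using borel_measurable_RN_deriv[of M N] by (simp add: f_def)
  have dens: "density M f = N"
    unfolding f_def by (rule M.density_RN_deriv[OF ac]) simp
  have "density M (\<lambda>x. f (g + x)) = N" for g
  proof (rule measure_eqI)
    fix A assume "A \<in> sets (density M (\<lambda>x. f (g + x)))"
    then have A [measurable]: "A \<in> sets borel" by simp
    have "emeasure (density M (\<lambda>x. f (g + x))) A = (\<integral>\<^sup>+x. f (g + x) * indicator {y. - g + y \<in> A} (g + x) \<partial>M)"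
      by (subst emeasure_density) (auto intro!: nn_integral_cong simp: indicator_def)
    also have "\<dots> = (\<integral>\<^sup>+x. f x * indicator {y. - g + y \<in> A} x \<partial>distr M borel ((+) g))"
      by (subst nn_integral_distr) auto
    also have "\<dots> = emeasure (density M f) {y. - g + y \<in> A}"
      by (subst emeasure_density) (auto simp: M.haar_left_distr)
    also have "\<dots> = emeasure N A" using N.haar_left[OF A] by (simp add: dens)
    finally show "emeasure (density M (\<lambda>x. f (g + x))) A = emeasure N A" .
  qed simp
  then have "AE x in M. f (g + x) = f x" for g
    using dens by (intro M.density_unique) auto
  then have "AE g in M. AE x in M. f (g + x) = f x" by auto
  moreover have "{p \<in> space (M \<Otimes>\<^sub>M M). f (fst p + snd p) = f (snd p)} \<in> sets (M \<Otimes>\<^sub>M M)"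
    by measurable
  ultimately have "AE x in M. AE g in M. f (g + x) = f x"
    by (subst (asm) AE_commute) (auto simp: space_pair_measure split_beta')
  from AE_ex_in[OF this M.haar_UNIV] obtain x0 where x0: "AE g in M. f (g + x0) = f x0" by auto
  define c where "c = f x0"
  have "emeasure M {g. g + x0 \<in> {y. f y \<noteq> c}} = 0"
    using x0 unfolding c_def by (subst (asm) AE_iff_measurable[OF _ refl]) auto
  then have "emeasure M {x. x + - x0 \<in> {g. g + x0 \<in> {y. f y \<noteq> c}}} = 0"
    by (rule M.haar_right_null[rotated]) auto
  then have "emeasure M {y. f y \<noteq> c} = 0" by (simp add: grp)
  then have "AE y in M. f y = c"
    by (subst AE_iff_measurable[OF _ refl]) auto
  then have "N = density M (\<lambda>_. c)"
    unfolding dens[symmetric] by (intro density_cong) auto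
  then have eq: "emeasure N A = c * emeasure M A" if "A \<in> sets borel" for A
    using that by (simp add: emeasure_density nn_integral_cmult_indicator)
  have "c \<noteq> 0" using eq[of UNIV] N.haar_UNIV by auto
  moreover have "c \<noteq> \<infinity>"
  proof
    assume "c = \<infinity>"
    obtain C where C: "compact C" "emeasure M C \<noteq> 0"
      using M.haar_compact_pos by auto
    then show False using N.haar_compact[OF C(1)] eq[of C] \<open>c = \<infinity>\<close>
      by (auto simp: ennreal_top_mult borel_compact)
  qed
  ultimately obtain r where "r > 0" "c = ennreal r" by (cases c) auto
  with eq show ?thesis by auto
qed

section \<open>Right translation and the modular function\<close>

context haar
begin

lemma haar_right_translate: "left_haar_measure (distr M borel (\<lambda>x. x + g))"
  unfolding left_haar_measure_def
proof (intro conjI allI ballI impI)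
  fix C :: "'g set" assume "compact C"
  then have "compact ((\<lambda>x. x + - g) ` C)" by (intro compact_continuous_image continuous_intros)
  moreover have "(\<lambda>x. x + - g) ` C = {x. x + g \<in> C}"
    by (auto simp: image_iff grp intro!: bexI[where x = "_ + g"])
  ultimately show "emeasure (distr M borel (\<lambda>x. x + g)) C < \<infinity>"
    using haar_compact \<open>compact C\<close> by (simp add: emeasure_distr borel_compact vimage_def)
next
  fix h and A :: "'g set" assume A [measurable]: "A \<in> sets borel"
  have "(+) h ` A = {x. - h + x \<in> A}" by (auto simp: image_iff) (metis add_minus_cancel)
  moreover have "emeasure M {x. - h + x \<in> {x. x + g \<in> A}} = emeasure M {x. x + g \<in> A}"
    by (rule haar_left) auto
  ultimately show "emeasure (distr M borel (\<lambda>x. x + g)) ((+) h ` A) = emeasure (distr M borel (\<lambda>x. x + g)) A"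
    by (simp add: emeasure_distr vimage_def add.assoc)
qed (use haar_UNIV in \<open>auto simp: emeasure_distr\<close>)

lemma right_image: "(\<lambda>x. x + g) ` A = {x. x + - g \<in> A}" for g :: 'g
  by (auto simp: image_iff grp intro!: bexI[where x = "_ + - g"])

text \<open>The measure \<open>A \<mapsto> M (A + g)\<close> is again left invariant, so uniqueness
  supplies the factor. Every other Haar measure is a multiple of \<open>M\<close> and has the same
  factor, which makes the \<open>THE\<close> well defined.\<close>

lemma modular_function:
  shows modular_function_pos: "modular_function (g::'g) > 0"
    and emeasure_right: "A \<in> sets borel \<Longrightarrow> emeasure M {x. x + - g \<in> A} = ennreal (modular_function g) * emeasure M A"
proof -
  obtain c where c: "c > 0" "\<And>A. A \<in> sets borel \<Longrightarrow> emeasure (distr M borel (\<lambda>x. x + - g)) A = ennreal c * emeasure M A"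
    using haar_unique[OF left_haar haar_right_translate] by blast
  then have c': "emeasure M {x. x + - g \<in> A} = ennreal c * emeasure M A" if "A \<in> sets borel" for A
    using c(2)[OF that] that by (subst (asm) emeasure_distr) (auto simp: vimage_def)
  have "modular_function g = c" unfolding modular_function_def
  proof (rule the_equality, intro conjI allI ballI impI c)
    fix N :: "'g measure" and A :: "'g set" assume N: "left_haar_measure N" and A [measurable]: "A \<in> sets borel"
    obtain d where "d > 0" "\<And>A. A \<in> sets borel \<Longrightarrow> emeasure N A = ennreal d * emeasure M A"
      using haar_unique[OF left_haar N] by blast
    then show "emeasure N ((\<lambda>x. x + g) ` A) = ennreal c * emeasure N A"
      using A by (simp add: right_image c' ac_simps)
  next
    fix d assume d: "0 < d \<and> (\<forall>M. left_haar_measure M \<longrightarrow> (\<forall>A\<in>sets borel. emeasure M ((\<lambda>x::'g. x + g) ` A) = ennreal d * emeasure M A))"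
    obtain C where C: "compact C" "emeasure M C \<noteq> 0" "emeasure M C \<noteq> \<infinity>"
      using haar_compact_pos by auto
    moreover have "ennreal d * emeasure M C = ennreal c * emeasure M C"
      using d left_haar c'[of C] C by (simp add: right_image borel_compact)
    ultimately show "d = c" using c(1) d
      by (auto intro: ennreal_cancel_right)
  qed
  with c c' show "modular_function g > 0"
    and "A \<in> sets borel \<Longrightarrow> emeasure M {x. x + - g \<in> A} = ennreal (modular_function g) * emeasure M A" by auto
qed

lemma haar_right: "emeasure M {x. x + g \<in> A} = emeasure M A"
  if [measurable]: "A \<in> sets borel" and g: "g \<in> unimodular_part"
proof -
  have "emeasure M {x. x + - g \<in> {x. x + g \<in> A}} = emeasure M {x. x + g \<in> A}"
    using g by (subst emeasure_right) (auto simp: unimodular_part_def)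
  then show ?thesis by (simp add: grp)
qed

lemma modular_function_add: "modular_function (g + h) = modular_function g * modular_function (h::'g)"
proof -
  obtain C where C: "compact C" "emeasure M C \<noteq> 0" "emeasure M C \<noteq> \<infinity>"
    using haar_compact_pos by auto
  then have [measurable]: "C \<in> sets borel" by (simp add: borel_compact)
  have "ennreal (modular_function (g + h)) * emeasure M C = emeasure M {x. x + - (g + h) \<in> C}"
    by (subst emeasure_right) auto
  also have "{x. x + - (g + h) \<in> C} = {x. x + - h \<in> {x. x + - g \<in> C}}"
    by (simp add: grp)
  also have "emeasure M \<dots> = ennreal (modular_function h) * (ennreal (modular_function g) * emeasure M C)"
    using haar_left_measurable(2)[of C "- g"] by (subst emeasure_right) (auto simp: emeasure_right[symmetric])
  finally have "ennreal (modular_function (g + h)) * emeasure M C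
     = ennreal (modular_function g * modular_function h) * emeasure M C"
    using modular_function_pos[of g] modular_function_pos[of h] by (simp add: ennreal_mult ac_simps)
  then show ?thesis using C modular_function_pos[of g] modular_function_pos[of h] modular_function_pos[of "g + h"]
    by (auto intro!: ennreal_cancel_right[of _ "emeasure M C"])
qed

lemma subgroup_unimodular_part: "is_subgroup (unimodular_part :: 'g set)"
proof -
  have 0: "modular_function (0::'g) = 1"
    using modular_function_add[of 0 0] modular_function_pos[of 0] by auto
  have "modular_function g * modular_function (- g) = 1" for g :: 'g
    using modular_function_add[of g "- g"] 0 by simp
  then show ?thesis using 0 unfolding is_subgroup_def unimodular_part_def
    by (auto simp: modular_function_add) (metis mult_1)
qed

end

subsection \<open>Small right translations\<close>

text \<open>An epsilon-over-two scheme: an error \<open>t n\<close> that does not depend on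
  \<open>x\<close>, and a main term that vanishes in the limit for each fixed
  \<open>n\<close>.\<close>

lemma tendsto_zero_approx:
  fixes f :: "'a \<Rightarrow> ennreal"
  assumes t: "t \<longlonglongrightarrow> 0"
    and f: "\<And>n. \<exists>a. (a \<longlongrightarrow> 0) F \<and> (\<forall>\<^sub>F x in F. f x \<le> a x + t n)"
  shows "(f \<longlongrightarrow> 0) F"
proof (rule order_tendstoI)
  fix e :: ennreal assume "0 < e"
  with t have "\<forall>\<^sub>F n in sequentially. t n < e" by (rule order_tendstoD)
  then obtain n where n: "t n < e" by (auto simp: eventually_sequentially)
  obtain a where a: "(a \<longlongrightarrow> 0) F" "\<forall>\<^sub>F x in F. f x \<le> a x + t n" using f by blast
  have "((\<lambda>x. a x + t n) \<longlongrightarrow> 0 + t n) F" by (intro tendsto_intros a)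
  then have "\<forall>\<^sub>F x in F. a x + t n < e" using n by (intro order_tendstoD(2)[where a = e]) auto
  with a(2) show "\<forall>\<^sub>F x in F. f x < e" by eventually_elim auto
qed auto

lemma tendsto_zero_mono:
  fixes f g :: "'a \<Rightarrow> ennreal"
  assumes "(g \<longlongrightarrow> 0) F" "\<forall>\<^sub>F x in F. f x \<le> g x"
  shows "(f \<longlongrightarrow> 0) F"
  by (rule tendsto_sandwich[of "\<lambda>_. 0" f F g 0]) (use assms in auto)

text \<open>Finitely many pieces cover \<open>X\<close> up to small mass because \<open>X\<close>
  has finite measure. The filter is left open, as the lemma serves both sequences of sets and
  translations tending to 0.\<close>

lemma emeasure_tendsto_zero_countable:
  fixes S :: "'b \<Rightarrow> 'a set" and D :: "nat \<Rightarrow> 'a set"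
  assumes D [measurable]: "\<And>i. D i \<in> sets N" and X [measurable]: "X \<in> sets N" and "emeasure N X < \<infinity>"
    and null: "emeasure N (X - (\<Union>i. D i)) = 0"
    and S: "\<forall>\<^sub>F x in F. S x \<in> sets N \<and> S x \<subseteq> X"
    and lim: "\<And>i. ((\<lambda>x. emeasure N (S x \<inter> D i)) \<longlongrightarrow> 0) F"
  shows "((\<lambda>x. emeasure N (S x)) \<longlongrightarrow> 0) F"
proof (rule tendsto_zero_approx)
  let ?R = "\<lambda>n. X - (\<Union>i<n. D i)"
  have "(\<lambda>n. emeasure N (?R n)) \<longlonglongrightarrow> emeasure N (\<Inter>n. ?R n)"
  proof (rule Lim_emeasure_decseq)
    show "emeasure N (?R n) \<noteq> \<infinity>" for n
      using emeasure_mono[of "?R n" X N] assms(3) by (auto simp: top_unique)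
  qed (auto simp: decseq_def)
  also have "(\<Inter>n. ?R n) = X - (\<Union>i. D i)" by auto
  finally show "(\<lambda>n. emeasure N (?R n)) \<longlonglongrightarrow> 0" using null by simp
  fix n
  have "((\<lambda>x. \<Sum>i<n. emeasure N (S x \<inter> D i)) \<longlongrightarrow> (\<Sum>i<n. 0)) F"
    by (intro tendsto_sum lim)
  moreover have "\<forall>\<^sub>F x in F. emeasure N (S x) \<le> (\<Sum>i<n. emeasure N (S x \<inter> D i)) + emeasure N (?R n)"
    using S
  proof eventually_elim
    case (elim x)
    then have [measurable]: "S x \<in> sets N" by simp
    have "emeasure N (S x) \<le> emeasure N ((\<Union>i<n. S x \<inter> D i) \<union> ?R n)"
      using elim by (intro emeasure_mono) auto
    also have "\<dots> \<le> emeasure N (\<Union>i<n. S x \<inter> D i) + emeasure N (?R n)"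
      by (intro emeasure_subadditive) auto
    also have "emeasure N (\<Union>i<n. S x \<inter> D i) \<le> (\<Sum>i<n. emeasure N (S x \<inter> D i))"
      by (intro emeasure_subadditive_finite) auto
    finally show ?case by (simp add: add_right_mono)
  qed
  ultimately show "\<exists>a. (a \<longlongrightarrow> 0) F \<and> (\<forall>\<^sub>F x in F. emeasure N (S x) \<le> a x + emeasure N (?R n))"
    by (intro exI[of _ "\<lambda>x. \<Sum>i<n. emeasure N (S x \<inter> D i)"]) auto
qed

text \<open>The epsilon-delta form of absolute continuity for a finite \<open>N\<close>. If it
  failed, sets of \<open>M\<close>-mass below \<open>(1/2)^n\<close> and \<open>N\<close>-mass at
  least \<open>e\<close> would have an \<open>M\<close>-null limsup by Borel-Cantelli, while
  continuity from above keeps its \<open>N\<close>-mass at least \<open>e\<close>.\<close>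

lemma absolutely_continuous_tendsto_zero:
  assumes ac: "absolutely_continuous M N" and sets [measurable_cong]: "sets N = sets M"
    and fin: "finite_measure N"
    and S: "\<forall>\<^sub>F x in F. S x \<in> sets M"
    and lim: "((\<lambda>x. emeasure M (S x)) \<longlongrightarrow> 0) F"
  shows "((\<lambda>x. emeasure N (S x)) \<longlongrightarrow> 0) F"
proof (rule order_tendstoI)
  interpret N: finite_measure N by fact
  fix e :: ennreal assume e: "0 < e"
  have "\<exists>d>0. \<forall>A\<in>sets M. emeasure M A < d \<longrightarrow> emeasure N A < e"
  proof (rule ccontr)
    assume "\<not> ?thesis"
    moreover have "ennreal ((1/2)^n) > 0" for n by simp
    ultimately have "\<exists>A\<in>sets M. emeasure M A < ennreal ((1/2)^n) \<and> \<not> emeasure N A < e" for n :: nat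
      by blast
    then obtain A where A: "\<And>n. A n \<in> sets M" "\<And>n. emeasure M (A n) < ennreal ((1/2)^n)" "\<And>n. e \<le> emeasure N (A n)"
      by (metis not_less)
    note A(1) [measurable]
    have "limsup A \<in> null_sets M"
    proof (rule borel_cantelli_limsup1)
      show "emeasure M (A n) < \<infinity>" for n using A(2)[of n] by (metis ennreal_less_top infinity_ennreal_def order.strict_trans)
      have "measure M (A n) \<le> (1/2)^n" for n
        using A(2)[of n] by (simp add: measure_def enn2real_leI less_imp_le)
      then show "summable (\<lambda>n. measure M (A n))"
        by (intro summable_comparison_test'[OF summable_geometric[of "1/2::real"]]) auto
    qed simp
    then have "limsup A \<in> null_sets N" using ac by (auto simp: absolutely_continuous_def)
    moreover have lims: "limsup A = (\<Inter>n. \<Union>i\<in>{n..}. A i)" by (simp add: limsup_INF_SUP)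
    moreover have "(\<lambda>n. emeasure N (\<Union>i\<in>{n..}. A i)) \<longlonglongrightarrow> emeasure N (\<Inter>n. \<Union>i\<in>{n..}. A i)"
      by (intro Lim_emeasure_decseq) (fastforce simp: decseq_def)+
    ultimately have "(\<lambda>n. emeasure N (\<Union>i\<in>{n..}. A i)) \<longlonglongrightarrow> 0" by auto
    then have "\<forall>\<^sub>F n in sequentially. emeasure N (\<Union>i\<in>{n..}. A i) < e" using e by (rule order_tendstoD)
    then obtain n where n: "emeasure N (\<Union>i\<in>{n..}. A i) < e" by (auto simp: eventually_sequentially)
    have "e \<le> emeasure N (A n)" by (rule A)
    also have "\<dots> \<le> emeasure N (\<Union>i\<in>{n..}. A i)" by (intro emeasure_mono) auto
    finally show False using n by simp
  qed
  then obtain d where d: "d > 0" "\<And>A. A \<in> sets M \<Longrightarrow> emeasure M A < d \<Longrightarrow> emeasure N A < e" by blast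
  from order_tendstoD(2)[OF lim d(1)] S show "\<forall>\<^sub>F x in F. emeasure N (S x) < e"
    by eventually_elim (use d in auto)
qed auto

lemma decreasing_nhds_basis:
  fixes x :: "'a::first_countable_topology"
  shows "\<exists>X::nat \<Rightarrow> 'a set. decseq X \<and> (\<forall>n. open (X n)) \<and> (\<forall>n. x \<in> X n)
    \<and> (\<forall>S. open S \<longrightarrow> x \<in> S \<longrightarrow> (\<exists>n. X n \<subseteq> S))"
proof -
  obtain A :: "nat \<Rightarrow> 'a set" where A: "\<forall>i. x \<in> A i \<and> open (A i)" "\<forall>S. open S \<and> x \<in> S \<longrightarrow> (\<exists>i. A i \<subseteq> S)"
    using first_countable_basis[of x] by blast
  show ?thesis
  proof (intro exI[of _ "\<lambda>n. \<Inter>i\<le>n. A i"] conjI allI impI)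
    fix S assume "open S" "x \<in> S"
    then obtain n where "A n \<subseteq> S" using A(2) by blast
    then show "\<exists>n. (\<Inter>i\<le>n. A i) \<subseteq> S" by (intro exI[of _ n]) auto
  qed (use A in \<open>auto simp: decseq_def\<close>)
qed

lemma tendsto_uminus_nhds_zero: "filterlim uminus (nhds (0::'g::topological_group_add)) (nhds 0)"
  using tendsto_uminus_nhds[of "0::'g"] by simp

lemma compact_add:
  fixes A B :: "'g::topological_group_add set"
  assumes "compact A" "compact B"
  shows "compact ((\<lambda>p. fst p + snd p) ` (A \<times> B))"
  by (intro compact_continuous_image compact_Times assms continuous_intros)

locale haar_open = haar M for M :: "'g::lcsc_group measure" +
  assumes open_unimodular_part: "open (unimodular_part :: 'g set)"
begin

lemma eventually_unimodular: "\<forall>\<^sub>F s in nhds 0. s \<in> (unimodular_part :: 'g set)"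
  using subgroup_unimodular_part
  by (intro eventually_nhds_in_open open_unimodular_part) (auto simp: is_subgroup_def)

text \<open>The open neighbourhoods of C decrease to C, and C + s lies in them for s near 0.\<close>

lemma compact_translation:
  assumes "compact C"
  shows "((\<lambda>s. emeasure M {x\<in>C. x + s \<notin> C}) \<longlongrightarrow> 0) (nhds 0)"
proof -
  obtain V :: "'g set" where V: "open V" "0 \<in> V" "compact (closure V)"
    using zero_nbhd_compact[of UNIV] by blast
  obtain X :: "nat \<Rightarrow> 'g set" where X: "decseq X" "\<And>n. open (X n)" "\<And>n. 0 \<in> X n"
    "\<And>S. open S \<Longrightarrow> 0 \<in> S \<Longrightarrow> \<exists>n. X n \<subseteq> S"
    using decreasing_nhds_basis[of "0::'g"] by blast
  have [measurable]: "C \<in> sets borel" using assms by (rule borel_compact)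
  define W where "W n = (\<Union>c\<in>C. {x. - c + x \<in> X n \<inter> V})" for n
  have oW: "open (W n)" for n unfolding W_def
    by (intro open_UN ballI open_vimage_cont open_Int X V continuous_intros)
  then have [measurable]: "W n \<in> sets borel" for n by simp
  \<comment> \<open>All \<open>W n\<close> stay in one compact set; continuity from above needs this
    finiteness.\<close>
  have "W n \<subseteq> (\<lambda>p. fst p + snd p) ` (C \<times> closure V)" for n
    using closure_subset[of V] by (force simp: W_def image_iff intro!: bexI[where x = "(_, - _ + _)"])
  then have "W n - C \<subseteq> (\<lambda>p. fst p + snd p) ` (C \<times> closure V)" for n by blast
  then have fin: "emeasure M (W n - C) \<noteq> \<infinity>" for n
    using haar_compact[OF compact_add[OF assms V(3)]] borel_compact[OF compact_add[OF assms V(3)]]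
      emeasure_mono[of "W n - C" "(\<lambda>p. fst p + snd p) ` (C \<times> closure V)" M]
    by (auto simp: top_unique)
  have CW: "x \<in> C" if xW: "\<And>n. x \<in> W n" for x
  proof (rule ccontr)
    assume "x \<notin> C"
    have "open {v. x + - v \<in> - C}"
      using assms by (intro open_vimage_cont continuous_intros) (auto intro: compact_imp_closed)
    then obtain n where "X n \<subseteq> {v. x + - v \<in> - C}"
      using X(4)[of "{v. x + - v \<in> - C}"] \<open>x \<notin> C\<close> by auto
    moreover obtain c where "c \<in> C" "- c + x \<in> X n" using xW[of n] by (auto simp: W_def)
    ultimately have "x + - (- c + x) \<in> - C" by blast
    moreover have "x + - (- c + x) = c" by (simp only: minus_add add_minus_cancel minus_minus)
    ultimately show False using \<open>c \<in> C\<close> by simp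
  qed
  have "(\<Inter>n. W n - C) = {}"
  proof (rule equals0I)
    fix x assume x: "x \<in> (\<Inter>n. W n - C)"
    then have "x \<in> W n" for n by simp
    from CW[OF this] have "x \<in> C" .
    with x show False by simp
  qed
  moreover have "(\<lambda>n. emeasure M (W n - C)) \<longlonglongrightarrow> emeasure M (\<Inter>n. W n - C)"
  proof (rule Lim_emeasure_decseq[OF _ _ fin])
    have "W n \<subseteq> W m" if "m \<le> n" for m n
      using decseqD[OF X(1) that] unfolding W_def by blast
    then show "decseq (\<lambda>n. W n - C)" unfolding decseq_def by blast
  qed auto
  ultimately have lim: "(\<lambda>n. emeasure M (W n - C)) \<longlonglongrightarrow> 0" by (simp only: emeasure_empty)
  show ?thesis
  proof (rule tendsto_zero_approx[OF lim])
    fix n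
    have "\<forall>\<^sub>F s in nhds 0. s \<in> X n \<inter> V" using X V by (intro eventually_nhds_in_open) auto
    with eventually_unimodular have "\<forall>\<^sub>F s in nhds 0. emeasure M {x\<in>C. x + s \<notin> C} \<le> 0 + emeasure M (W n - C)"
    proof eventually_elim
      case (elim s)
      have "x + s \<in> W n" if "x \<in> C" for x
        using elim that unfolding W_def by (intro UN_I[of x]) auto
      then have "{x\<in>C. x + s \<notin> C} \<subseteq> {x. x + s \<in> W n - C}" by auto
      then have "emeasure M {x\<in>C. x + s \<notin> C} \<le> emeasure M {x. x + s \<in> W n - C}"
        by (rule emeasure_mono) measurable
      \<comment> \<open>Here the open kernel is used: \<open>s\<close> is unimodular, so right
        translation by it preserves \<open>M\<close>.\<close>
      also have "\<dots> = emeasure M (W n - C)" using elim by (intro haar_right) auto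
      finally show ?case by simp
    qed
    then show "\<exists>a. (a \<longlongrightarrow> 0) (nhds 0) \<and> (\<forall>\<^sub>F s in nhds 0. emeasure M {x\<in>C. x + s \<notin> C} \<le> a s + emeasure M (W n - C))"
      by (intro exI[of _ "\<lambda>_. 0"]) auto
  qed
qed

text \<open>If \<open>C + s\<close> missed \<open>C\<close>, all of \<open>C\<close> would leave
  \<open>C\<close>, against \<open>compact_translation\<close>. This turns positive measure into
  open neighbourhoods, first for closures of reachable sets and later for images of
  homomorphisms.\<close>

lemma steinhaus:
  assumes "compact C" "emeasure M C \<noteq> 0"
  shows "\<forall>\<^sub>F s in nhds 0. \<exists>x\<in>C. x + s \<in> C"
proof -
  have "\<forall>\<^sub>F s in nhds 0. emeasure M {x\<in>C. x + s \<notin> C} < emeasure M C"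
    using assms compact_translation[OF assms(1)] by (intro order_tendstoD) (auto simp: zero_less_iff_neq_zero)
  then show ?thesis
  proof eventually_elim
    case (elim s)
    then have "{x\<in>C. x + s \<notin> C} \<noteq> C" by auto
    then show ?case by auto
  qed
qed

text \<open>A point that enters \<open>B\<close> under \<open>s\<close> becomes, seen from
  \<open>x + s\<close>, a point that leaves \<open>B\<close> under \<open>- s\<close>. Since
  \<open>x + s\<close> need not lie in \<open>C\<close>, the hypothesis is applied to the larger
  compact set \<open>?C\<close>.\<close>

lemma borel_translation_inside:
  assumes [measurable]: "B \<in> sets borel"
    and lim: "\<And>C. compact C \<Longrightarrow> ((\<lambda>s. emeasure M {x\<in>C. x \<in> B \<and> x + s \<notin> B}) \<longlongrightarrow> 0) (nhds 0)"
    and "compact C"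
  shows "((\<lambda>s. emeasure M {x\<in>C. (x \<in> B) \<noteq> (x + s \<in> B)}) \<longlongrightarrow> 0) (nhds 0)"
proof -
  obtain V :: "'g set" where V: "open V" "0 \<in> V" "compact (closure V)"
    using zero_nbhd_compact[of UNIV] by blast
  let ?C = "(\<lambda>p. fst p + snd p) ` (C \<times> closure V)"
  have C: "compact ?C" by (rule compact_add) fact+
  note [measurable] = borel_compact[OF C] borel_compact[OF \<open>compact C\<close>]
  let ?b = "\<lambda>s. emeasure M {x\<in>?C. x \<in> B \<and> x + s \<notin> B}"
  have "((\<lambda>s. ?b (- s)) \<longlongrightarrow> 0) (nhds 0)"
    by (rule filterlim_compose[OF lim[OF C] tendsto_uminus_nhds_zero])
  from tendsto_add[OF lim[OF \<open>compact C\<close>] this]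
  have lim0: "((\<lambda>s. emeasure M {x\<in>C. x \<in> B \<and> x + s \<notin> B} + ?b (- s)) \<longlongrightarrow> 0) (nhds 0)" by simp
  have "\<forall>\<^sub>F s in nhds 0. s \<in> V" using V by (intro eventually_nhds_in_open)
  with eventually_unimodular
  have "\<forall>\<^sub>F s in nhds 0. emeasure M {x\<in>C. (x \<in> B) \<noteq> (x + s \<in> B)} \<le> emeasure M {x\<in>C. x \<in> B \<and> x + s \<notin> B} + ?b (- s)"
  proof eventually_elim
    case (elim s)
    have "emeasure M {x\<in>C. (x \<in> B) \<noteq> (x + s \<in> B)} \<le> emeasure M ({x\<in>C. x \<in> B \<and> x + s \<notin> B} \<union> {x. x + s \<in> {x\<in>?C. x \<in> B \<and> x + - s \<notin> B}})"
    proof (intro emeasure_mono)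
      show "{x\<in>C. (x \<in> B) \<noteq> (x + s \<in> B)} \<subseteq> {x\<in>C. x \<in> B \<and> x + s \<notin> B} \<union> {x. x + s \<in> {x\<in>?C. x \<in> B \<and> x + - s \<notin> B}}"
        using elim closure_subset[of V] by (auto simp: grp intro!: image_eqI[where x = "(_, s)"])
    qed measurable
    also have "\<dots> \<le> emeasure M {x\<in>C. x \<in> B \<and> x + s \<notin> B} + emeasure M {x. x + s \<in> {x\<in>?C. x \<in> B \<and> x + - s \<notin> B}}"
      by (intro emeasure_subadditive) measurable
    also have "emeasure M {x. x + s \<in> {x\<in>?C. x \<in> B \<and> x + - s \<notin> B}} = ?b (- s)"
      using elim by (intro haar_right) measurable
    finally show ?case .
  qed
  with lim0 show ?thesis by (rule tendsto_zero_mono)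
qed

text \<open>Induction from the compact sets, which generate the Borel sets by sigma-compactness. The
  symmetric form of the condition makes complements trivial, and
  \<open>borel_translation_inside\<close> reduces countable unions to the points that leave the
  union.\<close>

lemma borel_translation:
  assumes "B \<in> sets borel" "compact C"
  shows "((\<lambda>s. emeasure M {x\<in>C. (x \<in> B) \<noteq> (x + s \<in> B)}) \<longlongrightarrow> 0) (nhds 0)"
proof -
  obtain \<C> :: "'g set set" where \<C>: "countable \<C>" "\<forall>C\<in>\<C>. compact C" "\<Union>\<C> = UNIV"
    using lcsc_group_cover_compact by blast
  have "borel = sigma UNIV ((\<lambda>x. x) ` Collect compact :: 'g set set)"
  proof (rule borel_eq_sigmaI1[OF borel_eq_closed, where F = "\<lambda>x. x"])
    fix A :: "'g set" assume "A \<in> Collect closed"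
    then have "A \<inter> C \<in> Collect compact" if "C \<in> \<C>" for C using that \<C> by (auto intro: closed_Int_compact)
    then have "(\<Union>C\<in>\<C>. A \<inter> C) \<in> sets (sigma UNIV (Collect compact))"
      using \<C> by (intro sets.countable_UN'') auto
    also have "(\<Union>C\<in>\<C>. A \<inter> C) = A" using \<C>(3) by auto
    finally show "A \<in> sets (sigma UNIV ((\<lambda>x. x) ` Collect compact))" by simp
  qed (auto intro: borel_compact)
  then have sb: "sets borel = sigma_sets UNIV (Collect compact :: 'g set set)"
    by (metis image_ident sets_measure_of subset_UNIV Pow_UNIV)
  have "Int_stable (Collect compact :: 'g set set)" by (auto simp: Int_stable_def)
  moreover have "(Collect compact :: 'g set set) \<subseteq> Pow UNIV" by auto
  moreover have "B \<in> sigma_sets UNIV (Collect compact)" using assms sb by simp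
  ultimately have "B \<in> sets borel \<and> (\<forall>C. compact C \<longrightarrow> ((\<lambda>s. emeasure M {x\<in>C. (x \<in> B) \<noteq> (x + s \<in> B)}) \<longlongrightarrow> 0) (nhds 0))"
  proof (induction rule: sigma_sets_induct_disjoint)
    case (basic Q)
    then have Q [measurable]: "Q \<in> sets borel" and cQ: "compact Q" by (auto intro: borel_compact)
    have "((\<lambda>s. emeasure M {x\<in>C. x \<in> Q \<and> x + s \<notin> Q}) \<longlongrightarrow> 0) (nhds 0)" if "compact C" for C
      by (rule tendsto_zero_mono[OF compact_translation[OF cQ]])
         (auto intro!: always_eventually emeasure_mono)
    then show ?case using borel_translation_inside[OF Q] Q by blast
  next
    case empty
    then show ?case by simp
  next
    case (compl A)
    then show ?case by (auto simp: Compl_eq_Diff_UNIV[symmetric] intro!: borel_comp)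
  next
    case (union A)
    then have A [measurable]: "\<And>i. A i \<in> sets borel" by auto
    have "((\<lambda>s. emeasure M {x\<in>C. x \<in> (\<Union>i. A i) \<and> x + s \<notin> (\<Union>i. A i)}) \<longlongrightarrow> 0) (nhds 0)" if C: "compact C" for C
    proof (rule emeasure_tendsto_zero_countable[where D = A and X = "C \<inter> (\<Union>i. A i)"])
      note [measurable] = borel_compact[OF C]
      show "emeasure M (C \<inter> (\<Union>i. A i)) < \<infinity>"
        using emeasure_mono[of "C \<inter> (\<Union>i. A i)" C M] haar_compact[OF C] by (simp add: order.strict_trans1)
      show "\<forall>\<^sub>F s in nhds 0. {x\<in>C. x \<in> (\<Union>i. A i) \<and> x + s \<notin> (\<Union>i. A i)} \<in> sets M \<and>
            {x\<in>C. x \<in> (\<Union>i. A i) \<and> x + s \<notin> (\<Union>i. A i)} \<subseteq> C \<inter> (\<Union>i. A i)"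
        by (auto intro!: always_eventually)
      fix i
      have "((\<lambda>s. emeasure M {x\<in>C. (x \<in> A i) \<noteq> (x + s \<in> A i)}) \<longlongrightarrow> 0) (nhds 0)"
        using union C by blast
      then show "((\<lambda>s. emeasure M ({x\<in>C. x \<in> (\<Union>i. A i) \<and> x + s \<notin> (\<Union>i. A i)} \<inter> A i)) \<longlongrightarrow> 0) (nhds 0)"
        by (rule tendsto_zero_mono) (auto intro!: always_eventually emeasure_mono)
      have "C \<inter> (\<Union>i. A i) - (\<Union>i. A i) = {}" by blast
      then show "emeasure M (C \<inter> (\<Union>i. A i) - (\<Union>i. A i)) = 0" by (simp only: emeasure_empty)
    qed (use borel_compact[OF C] in auto)
    moreover have "(\<Union>i. A i) \<in> sets borel" by measurable
    ultimately show ?case using borel_translation_inside[of "\<Union>i. A i"] by blast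
  qed
  then show ?thesis using assms by blast
qed

end

subsection \<open>Local path connectedness\<close>

text \<open>The path component of 0 in \<open>V\<close>, with explicit paths because they are
  multiplied pointwise.\<close>

definition reachable :: "'g::topological_group_add set \<Rightarrow> 'g set" where
  "reachable V = {g. \<exists>p. continuous_on {0..1::real} p \<and> p 0 = 0 \<and> p 1 = g \<and> p ` {0..1} \<subseteq> V}"

lemma reachable_subset: "reachable V \<subseteq> V"
  by (auto simp: reachable_def)

lemma reachable_diff:
  assumes "x \<in> reachable U" "y \<in> reachable U" "\<And>u v. u \<in> U \<Longrightarrow> v \<in> U \<Longrightarrow> - u + v \<in> V"
  shows "- x + y \<in> reachable V"
proof -
  obtain p q where pq: "continuous_on {0..1::real} p" "p 0 = 0" "p 1 = x" "p ` {0..1} \<subseteq> U"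
    "continuous_on {0..1::real} q" "q 0 = 0" "q 1 = y" "q ` {0..1} \<subseteq> U"
    using assms(1,2) unfolding reachable_def by blast
  then show ?thesis unfolding reachable_def using assms(3)
    by (intro CollectI exI[of _ "\<lambda>t. - p t + q t"]) (auto intro!: continuous_intros)
qed

text \<open>Two paths that run through the same finite list of V-small basic open sets differ by a
  path in V, and there are only countably many such lists.\<close>

lemma countable_reachable_cover:
  fixes K V :: "'g::{topological_group_add, second_countable_topology} set"
  assumes K: "\<And>g. g \<in> K \<Longrightarrow> g \<in> reachable UNIV" and V: "open V" "0 \<in> V"
  shows "\<exists>F. countable F \<and> K \<subseteq> (\<Union>c\<in>F. {g. - c + g \<in> reachable V})"
proof -
  obtain \<B> :: "'g set set" where \<B>: "countable \<B>" "topological_basis \<B>"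
    using ex_countable_basis by blast
  define \<S> where "\<S> = {b \<in> \<B>. \<forall>x\<in>b. \<forall>y\<in>b. - x + y \<in> V}"
  have small: "\<exists>b\<in>\<S>. g \<in> b" for g
  proof -
    obtain U where U: "open U" "0 \<in> U" "\<forall>x\<in>U. - x \<in> U" "\<forall>x\<in>U. \<forall>y\<in>U. x + y \<in> V"
      using zero_nbhd_symmetric[OF V] by blast
    have "open {x. - g + x \<in> U}" by (intro open_vimage_cont U continuous_intros)
    then obtain b where b: "b \<in> \<B>" "g \<in> b" "b \<subseteq> {x. - g + x \<in> U}"
      using topological_basisE[OF \<B>(2), of "{x. - g + x \<in> U}" g] U by auto
    have "- x + y \<in> V" if "x \<in> b" "y \<in> b" for x y
    proof -
      have "- (- g + x) \<in> U" "- g + y \<in> U" using that b U by auto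
      then have "- (- g + x) + (- g + y) \<in> V" using U(4) by blast
      then show ?thesis by (simp add: grp)
    qed
    then show ?thesis using b by (auto simp: \<S>_def)
  qed
  \<comment> \<open>With \<open>n = length l - 1\<close> equal pieces of the interval the floor runs
    from 0 to \<open>n\<close>, the value \<open>n\<close> being reached at \<open>t = 1\<close>;
    hence \<open>n + 1\<close> list entries.\<close>
  define good where "good l g \<longleftrightarrow> l \<noteq> [] \<and> (\<exists>p. continuous_on {0..1::real} p \<and> p 0 = 0 \<and> p 1 = g \<and>
    (\<forall>t\<in>{0..1}. p t \<in> l ! nat \<lfloor>t * (length l - 1)\<rfloor>))" for l and g :: 'g
  have index: "nat \<lfloor>t * real n\<rfloor> \<le> n" if "t \<in> {0..1}" for t :: real and n
  proof -
    have "t * real n \<le> 1 * real n" using that by (intro mult_right_mono) auto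
    then show ?thesis by linarith
  qed
  have ex_good: "\<exists>l\<in>lists \<S>. good l g" if g: "g \<in> K" for g
  proof -
    obtain p where p: "continuous_on {0..1::real} p" "p 0 = 0" "p 1 = g"
      using K[OF g] unfolding reachable_def by blast
    have "\<exists>T. open T \<and> T \<inter> {0..1} = p -` b \<inter> {0..1}" if "b \<in> \<S>" for b
      using p(1) \<B>(2) that unfolding continuous_on_open_invariant \<S>_def
      by (auto dest: topological_basis_open)
    then obtain T where T: "\<And>b. b \<in> \<S> \<Longrightarrow> open (T b)" "\<And>b. b \<in> \<S> \<Longrightarrow> T b \<inter> {0..1} = p -` b \<inter> {0..1}"
      by metis
    have cover: "{0..1} \<subseteq> \<Union>(T ` \<S>)"
    proof
      fix t :: real assume t: "t \<in> {0..1}"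
      obtain b where "b \<in> \<S>" "p t \<in> b" using small by blast
      then show "t \<in> \<Union>(T ` \<S>)" using T(2)[of b] t by blast
    qed
    have ne: "T ` \<S> \<noteq> {}" using small by blast
    obtain d where d: "d > 0" "\<And>A. A \<subseteq> {0..1} \<Longrightarrow> diameter A < d \<Longrightarrow> \<exists>B\<in>T ` \<S>. A \<subseteq> B"
      using Lebesgue_number_lemma[OF compact_Icc ne cover] T(1) by (metis imageE)
    obtain n :: nat where n: "n > 0" "1 / real n < d"
      using reals_Archimedean[OF d(1)] by (metis inverse_eq_divide zero_less_Suc)
    have "\<exists>b\<in>\<S>. \<forall>t\<in>{0..1}. nat \<lfloor>t * real n\<rfloor> = i \<longrightarrow> p t \<in> b" for i
    proof -
      let ?A = "{0..1} \<inter> {real i / n..real (Suc i) / n}"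
      have "diameter ?A \<le> diameter {real i / n..real (Suc i) / n}"
        by (intro diameter_subset) auto
      also have "real i / n \<le> real (Suc i) / n" by (intro divide_right_mono) auto
      then have "diameter {real i / n..real (Suc i) / n} = 1 / n"
        by (simp add: diameter_closed_interval diff_divide_distrib[symmetric])
      finally obtain b where b: "b \<in> \<S>" "?A \<subseteq> T b" using d(2)[of ?A] n by auto
      show ?thesis
      proof (intro bexI[of _ b] ballI impI b)
        fix t :: real assume t: "t \<in> {0..1}" "nat \<lfloor>t * real n\<rfloor> = i"
        then have "0 \<le> t * real n" by simp
        then have "real i \<le> t * n" "t * n \<le> real (Suc i)" using t(2) by linarith+
        then have "t \<in> ?A" using t(1) n(1) by (simp add: field_simps)
        then have "t \<in> T b \<inter> {0..1}" using b(2) by blast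
        then show "p t \<in> b" using T(2)[OF b(1)] by blast
      qed
    qed
    then obtain b where b: "\<And>i. b i \<in> \<S>" "\<And>i t. t \<in> {0..1} \<Longrightarrow> nat \<lfloor>t * real n\<rfloor> = i \<Longrightarrow> p t \<in> b i"
      by metis
    have "p t \<in> map b [0..<Suc n] ! nat \<lfloor>t * real n\<rfloor>" if "t \<in> {0..1}" for t
      using b(2)[OF that refl] index[OF that, of n] by (simp add: nth_append less_Suc_eq_le del: upt_Suc)
    then have "good (map b [0..<Suc n]) g"
      unfolding good_def using p by (intro conjI exI[of _ p]) auto
    moreover have "map b [0..<Suc n] \<in> lists \<S>" using b(1) by auto
    ultimately show ?thesis by blast
  qed
  have diff: "- c + g \<in> reachable V" if l: "l \<in> lists \<S>" and good: "good l c" "good l g" for l c g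
  proof -
    obtain p where p: "continuous_on {0..1::real} p" "p 0 = 0" "p 1 = c"
      "\<And>t. t \<in> {0..1} \<Longrightarrow> p t \<in> l ! nat \<lfloor>t * (length l - 1)\<rfloor>"
      using good(1) unfolding good_def by blast
    obtain q where q: "continuous_on {0..1::real} q" "q 0 = 0" "q 1 = g"
      "\<And>t. t \<in> {0..1} \<Longrightarrow> q t \<in> l ! nat \<lfloor>t * (length l - 1)\<rfloor>"
      using good(2) unfolding good_def by blast
    have "- p t + q t \<in> V" if t: "t \<in> {0..1}" for t
    proof -
      have "nat \<lfloor>t * (length l - 1)\<rfloor> < length l"
        using index[OF t, of "length l - 1"] good(1) by (cases l) (auto simp: good_def)
      then have "l ! nat \<lfloor>t * (length l - 1)\<rfloor> \<in> \<S>" using l by (meson in_listsD nth_mem)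
      then show ?thesis using p(4)[OF t] q(4)[OF t] by (simp add: \<S>_def)
    qed
    then show ?thesis using p q unfolding reachable_def
      by (intro CollectI exI[of _ "\<lambda>t. - p t + q t"]) (auto intro!: continuous_intros)
  qed
  \<comment> \<open>One end point per list. On a list without any end point \<open>SOME\<close> is
    arbitrary, which only adds a further element to a countable set.\<close>
  define F where "F = (\<lambda>l. SOME c. good l c) ` lists \<S>"
  have "countable F" unfolding F_def using \<B>(1) by (intro countable_image countable_lists) (simp add: \<S>_def)
  moreover have "g \<in> (\<Union>c\<in>F. {g. - c + g \<in> reachable V})" if gK: "g \<in> K" for g
  proof -
    obtain l where l: "l \<in> lists \<S>" "good l g" using ex_good[OF gK] by blast
    then have "good l (SOME c. good l c)" by (intro someI)
    then have "- (SOME c. good l c) + g \<in> reachable V" using diff l by blast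
    moreover have "(SOME c. good l c) \<in> F" using l by (auto simp: F_def)
    ultimately show ?thesis by blast
  qed
  ultimately show ?thesis by blast
qed

text \<open>Countably many translates of \<open>reachable U\<close> cover \<open>K\<close>, so its
  closure is non-null and Steinhaus applies. The closure is taken because it is compact and Borel,
  which is not evident for \<open>reachable U\<close> itself; removing it is the task of the next
  lemma.\<close>

lemma (in haar_open) closure_reachable_nbhd:
  fixes K V :: "'g set"
  assumes "open K" "K \<noteq> {}" and K: "\<And>g. g \<in> K \<Longrightarrow> g \<in> reachable UNIV"
    and V: "open V" "0 \<in> V"
  shows "\<exists>N. open N \<and> 0 \<in> N \<and> N \<subseteq> closure (reachable V)"
proof -
  obtain V' where V': "open V'" "0 \<in> V'" "V' \<subseteq> V" "\<forall>x\<in>V'. - x \<in> V'" "\<forall>x\<in>V'. \<forall>y\<in>V'. x + y \<in> V"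
    using zero_nbhd_symmetric[OF V] by blast
  obtain U where U: "open U" "0 \<in> U" "compact (closure U)" "closure U \<subseteq> V'"
    using zero_nbhd_compact[OF V'(1,2)] by blast
  have U': "- u + v \<in> V" if "u \<in> U" "v \<in> U" for u v using that U(4) V' closure_subset by (metis subsetD)
  let ?Q = "closure (reachable U)"
  have Q: "compact ?Q" using compact_Int_closed[OF U(3) closed_closure[of "reachable U"]]
    closure_mono[OF reachable_subset[of U]] by (simp add: Int_absorb1)
  then have [measurable]: "?Q \<in> sets borel" by (rule borel_compact)
  obtain F where F: "countable F" "K \<subseteq> (\<Union>c\<in>F. {g. - c + g \<in> reachable U})"
    using countable_reachable_cover[OF K U(1,2)] by blast
  have "emeasure M ?Q \<noteq> 0"
  proof
    assume 0: "emeasure M ?Q = 0"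
    have "{g. - c + g \<in> ?Q} \<in> null_sets M" for c
      using 0 by (intro haar_left_null_sets null_setsI) simp_all
    then have null: "(\<Union>c\<in>F. {g. - c + g \<in> ?Q}) \<in> null_sets M" by (rule null_sets_UN'[OF F(1)])
    have "K \<subseteq> (\<Union>c\<in>F. {g. - c + g \<in> ?Q})"
      by (rule subset_trans[OF F(2)]) (intro UN_mono order_refl Collect_mono impI subsetD[OF closure_subset])
    then have "K \<in> null_sets M" by (rule null_sets_subset[OF null, rotated]) (simp add: assms(1))
    then show False using haar_open_pos[OF assms(1,2)] by auto
  qed
  from steinhaus[OF Q this]
  obtain N where N: "open N" "0 \<in> N" "\<And>s. s \<in> N \<Longrightarrow> \<exists>x\<in>?Q. x + s \<in> ?Q"
    by (auto simp: eventually_nhds)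
  have "s \<in> closure (reachable V)" if sN: "s \<in> N" for s
  proof -
    obtain x where x: "x \<in> ?Q" "x + s \<in> ?Q" using N(3)[OF sN] by blast
    have "(\<lambda>p. - fst p + snd p) ` closure (reachable U \<times> reachable U) \<subseteq> closure (reachable V)"
    proof (rule image_closure_subset)
      show "(\<lambda>p. - fst p + snd p) ` (reachable U \<times> reachable U) \<subseteq> closure (reachable V)"
        using reachable_diff[OF _ _ U'] closure_subset by fastforce
    qed (auto intro!: continuous_intros)
    moreover have "(x, x + s) \<in> closure (reachable U \<times> reachable U)"
      using x by (simp add: closure_Times)
    ultimately have "- x + (x + s) \<in> closure (reachable V)" by force
    then show ?thesis by simp
  qed
  then show ?thesis using N by blast
qed

text \<open>Successive approximation by a uniformly convergent product of shorter and shorter paths,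
  as in the open mapping theorem.\<close>

lemma (in haar_open) reachable_nbhd:
  fixes K V :: "'g set"
  assumes "open K" "K \<noteq> {}" and K: "\<And>g. g \<in> K \<Longrightarrow> g \<in> reachable UNIV"
    and V: "open V" "0 \<in> V"
  shows "\<exists>N. open N \<and> 0 \<in> N \<and> N \<subseteq> reachable V"
proof -
  obtain X :: "nat \<Rightarrow> 'g set" where X: "\<And>n. open (X n)" "\<And>n. 0 \<in> X n"
    "\<And>S. open S \<Longrightarrow> 0 \<in> S \<Longrightarrow> \<exists>n. X n \<subseteq> S"
    using decreasing_nhds_basis[of "0::'g"] by blast
  define P where "P n A \<longleftrightarrow> open A \<and> 0 \<in> A \<and> compact (closure A) \<and> closure A \<subseteq> V \<inter> X n" for n A
  \<comment> \<open>Sums of two elements of one stage lie in the previous stage, so all corrections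
    from stage \<open>n\<close> on add up to an element of \<open>closure (W n)\<close>. The sets
    \<open>X n\<close> force these errors to shrink to 0.\<close>
  have "\<exists>W. \<forall>n. P n (W n) \<and> (\<forall>x\<in>closure (W (Suc n)). \<forall>y\<in>closure (W (Suc n)). x + y \<in> W n)"
  proof (rule dependent_nat_choice)
    show "\<exists>A. P 0 A" using zero_nbhd_compact[of "V \<inter> X 0"] V X by (auto simp: P_def)
    fix A n assume A: "P n A"
    then obtain B where B: "open B" "0 \<in> B" "B \<subseteq> A" "\<forall>x\<in>B. \<forall>y\<in>B. x + y \<in> A"
      using zero_nbhd_symmetric[of A] unfolding P_def by blast
    have "open (B \<inter> (V \<inter> X (Suc n)))" "0 \<in> B \<inter> (V \<inter> X (Suc n))"
      by (intro open_Int B V X) (simp add: B V X)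
    then obtain C where "open C" "0 \<in> C" "compact (closure C)" "closure C \<subseteq> B \<inter> (V \<inter> X (Suc n))"
      using zero_nbhd_compact by blast
    then show "\<exists>C. P (Suc n) C \<and> (\<forall>x\<in>closure C. \<forall>y\<in>closure C. x + y \<in> A)"
      using B unfolding P_def by (intro exI[of _ C]) blast
  qed
  then obtain W where W: "\<And>n. open (W n)" "\<And>n. 0 \<in> W n" "\<And>n. compact (closure (W n))"
    "\<And>n. closure (W n) \<subseteq> V" "\<And>n. closure (W n) \<subseteq> X n"
    "\<And>n x y. x \<in> closure (W (Suc n)) \<Longrightarrow> y \<in> closure (W (Suc n)) \<Longrightarrow> x + y \<in> W n"
    unfolding P_def by (metis le_inf_iff)
  have W0: "0 \<in> closure (W n)" for n using W(2) closure_subset by blast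
  obtain N where N: "\<And>n. open (N n)" "\<And>n. 0 \<in> N n" "\<And>n. N n \<subseteq> closure (reachable (W n))"
    using closure_reachable_nbhd[OF assms(1,2) K W(1,2)] by metis
  have "g \<in> reachable V" if g: "g \<in> N 1" for g
  proof -
    \<comment> \<open>The clause for \<open>n = 0\<close> starts with the constant path, so that the
      limit path itself takes its values in \<open>closure (W 0)\<close>, hence in
      \<open>V\<close>.\<close>
    define R where "R n s \<longleftrightarrow> continuous_on {0..1::real} s \<and> s 0 = 0 \<and> - s 1 + g \<in> N (Suc n) \<and> (n = 0 \<longrightarrow> s = (\<lambda>_. 0))" for n s
    have "\<exists>s. \<forall>n. R n (s n) \<and> (\<forall>t\<in>{0..1}. - s n t + s (Suc n) t \<in> W (Suc n))"
    proof (rule dependent_nat_choice)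
      show "\<exists>s. R 0 s" using g by (intro exI[of _ "\<lambda>_. 0"]) (simp add: R_def)
      fix s n assume s: "R n s"
      then have "- s 1 + g \<in> closure (reachable (W (Suc n)))" using N(3) by (auto simp: R_def)
      from ex_near_closure[OF N(1,2) this] obtain a where a: "a \<in> reachable (W (Suc n))"
        "- a + (- s 1 + g) \<in> N (Suc (Suc n))" by blast
      then obtain p where p: "continuous_on {0..1::real} p" "p 0 = 0" "p 1 = a" "p ` {0..1} \<subseteq> W (Suc n)"
        unfolding reachable_def by blast
      show "\<exists>s'. R (Suc n) s' \<and> (\<forall>t\<in>{0..1}. - s t + s' t \<in> W (Suc n))"
        using s p a by (intro exI[of _ "\<lambda>t. s t + p t"])
          (auto simp: R_def grp intro!: continuous_intros)
    qed
    then obtain s where s: "\<And>n. continuous_on {0..1::real} (s n)" "\<And>n. s n 0 = 0" "\<And>n. - s n 1 + g \<in> N (Suc n)"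
      "s 0 = (\<lambda>_. 0)" "\<And>n t. t \<in> {0..1} \<Longrightarrow> - s n t + s (Suc n) t \<in> W (Suc n)"
      unfolding R_def by metis
    \<comment> \<open>The limit at \<open>t\<close> is a common point of nested compact sets, found
      by compactness rather than by a Cauchy argument. At both ends the value is prescribed, since
      the path has to end exactly at \<open>g\<close>.\<close>
    have "\<exists>x. (\<forall>n. - s n t + x \<in> closure (W n)) \<and> (t = 0 \<longrightarrow> x = 0) \<and> (t = 1 \<longrightarrow> x = g)" if t: "t \<in> {0..1}" for t
    proof -
      consider "t = 0" | "t = 1" | "t \<noteq> 0" "t \<noteq> 1" by blast
      then show ?thesis
      proof cases
        case 1
        then show ?thesis using s(2) W0 by auto
      next
        case 2
        have "- s n 1 + g \<in> closure (W n)" for n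
        proof -
          have "- s n 1 + g \<in> closure (W (Suc n))"
            using s(3)[of n] N(3)[of "Suc n"] closure_mono[OF reachable_subset[of "W (Suc n)"]] by blast
          then have "- s n 1 + g + 0 \<in> W n" using W(6) W0 by blast
          then show ?thesis using closure_subset by auto
        qed
        with 2 show ?thesis by auto
      next
        case 3
        define E where "E n = {x. - s n t + x \<in> closure (W n)}" for n
        have dec: "E (Suc n) \<subseteq> E n" for n
        proof
          fix x assume "x \<in> E (Suc n)"
          then have "- s (Suc n) t + x \<in> closure (W (Suc n))" by (simp add: E_def)
          moreover have "- s n t + s (Suc n) t \<in> closure (W (Suc n))" using s(5)[OF t] closure_subset by blast
          ultimately have "(- s n t + s (Suc n) t) + (- s (Suc n) t + x) \<in> W n" by (rule W(6)[rotated])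
          then show "x \<in> E n" using closure_subset[of "W n"] by (auto simp: E_def grp)
        qed
        then have dec': "E n \<subseteq> E m" if "m \<le> n" for m n using that by (rule lift_Suc_antimono_le)
        have clE: "closed (E n)" for n
          using closed_vimage[OF closed_closure, of "\<lambda>x. - s n t + x" "W n"]
          by (simp add: E_def vimage_def continuous_intros)
        have "E 0 \<inter> \<Inter>(E ` UNIV) \<noteq> {}"
        proof (rule compact_imp_fip_image)
          show "compact (E 0)" using W(3)[of 0] by (simp add: E_def s(4))
          fix I :: "nat set" assume "finite I"
          then obtain m where m: "\<And>i. i \<in> I \<Longrightarrow> i \<le> m" by (meson finite_nat_set_iff_bounded_le)
          have "s m t \<in> E m" using W0 by (simp add: E_def)
          then have "s m t \<in> E 0 \<inter> \<Inter>(E ` I)" using dec' m by blast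
          then show "E 0 \<inter> \<Inter>(E ` I) \<noteq> {}" by blast
        qed (use clE in auto)
        then obtain x where "\<And>n. x \<in> E n" by blast
        then show ?thesis using 3 by (auto simp: E_def)
      qed
    qed
    then obtain p where p: "\<And>n t. t \<in> {0..1} \<Longrightarrow> - s n t + p t \<in> closure (W n)" "p 0 = 0" "p 1 = g"
      by (metis atLeastAtMost_iff order_refl zero_le_one)
    have "continuous_on {0..1} p"
      unfolding continuous_on_def tendsto_def
    proof (intro ballI allI impI)
      fix t :: real and O' assume t: "t \<in> {0..1}" and O': "open O'" "p t \<in> O'"
      have O0: "open {v. p t + v \<in> O'}" "0 \<in> {v. p t + v \<in> O'}"
        using O' by (auto intro!: open_vimage_cont continuous_intros)
      obtain A where A: "open A" "0 \<in> A" "\<forall>x\<in>A. \<forall>y\<in>A. x + y \<in> {v. p t + v \<in> O'}"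
        using zero_nbhd_symmetric[OF O0] by blast
      obtain B where B: "open B" "0 \<in> B" "B \<subseteq> A" "\<forall>x\<in>B. - x \<in> B" "\<forall>x\<in>B. \<forall>y\<in>B. x + y \<in> A"
        using zero_nbhd_symmetric[OF A(1,2)] by blast
      obtain n where n: "closure (W n) \<subseteq> B" using X(3)[OF B(1,2)] W(5) by blast
      have "open {x. - s n t + x \<in> B}" by (intro open_vimage_cont B continuous_intros)
      moreover have "(s n \<longlongrightarrow> s n t) (at t within {0..1})" using s(1) t by (simp add: continuous_on_def)
      ultimately have "\<forall>\<^sub>F u in at t within {0..1}. s n u \<in> {x. - s n t + x \<in> B}"
        using B(2) by (intro topological_tendstoD) auto
      moreover have "\<forall>\<^sub>F u in at t within {0..1}. u \<in> {0..1}" by (simp add: eventually_at_filter)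
      ultimately show "\<forall>\<^sub>F u in at t within {0..1}. p u \<in> O'"
      proof eventually_elim
        case (elim u)
        have "- (- s n t + p t) \<in> B" using p(1)[OF t] n B(4) by blast
        then have "- (- s n t + p t) + (- s n t + s n u) \<in> A" using B(5) elim by blast
        moreover have "- s n u + p u \<in> A" using p(1)[OF elim(2)] n B(3) by blast
        ultimately have "p t + (- (- s n t + p t) + (- s n t + s n u) + (- s n u + p u)) \<in> O'" using A(3) by blast
        then show ?case by (simp add: grp)
      qed
    qed
    moreover have "p ` {0..1} \<subseteq> V" using p(1)[of _ 0] s(4) W(4)[of 0] by auto
    ultimately show ?thesis using p(2,3) unfolding reachable_def by blast
  qed
  then show ?thesis using N(1,2) by blast
qed

subsection \<open>Monodromy\<close>

lemma connected_Icc_local_const: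
  fixes F :: "real \<Rightarrow> 'a"
  assumes "\<And>t. t \<in> {0..1} \<Longrightarrow> \<exists>d>0. \<forall>u\<in>{0..1}. \<bar>u - t\<bar> < d \<longrightarrow> F u = F t"
  shows "F 1 = F 0"
proof (rule connected_local_const[of "{0..1}"])
  show "\<forall>t\<in>{0..1}. \<forall>\<^sub>F u in at t within {0..1}. F t = F u"
  proof
    fix t :: real assume "t \<in> {0..1}"
    from assms[OF this] obtain d where "d > 0" "\<forall>u\<in>{0..1}. \<bar>u - t\<bar> < d \<longrightarrow> F u = F t" by blast
    then show "\<forall>\<^sub>F u in at t within {0..1}. F t = F u"
      unfolding eventually_at by (intro exI[of _ d]) (auto simp: dist_real_def)
  qed
qed auto

lemma continuous_difference_small:
  fixes p :: "real \<Rightarrow> 'g::topological_group_add"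
  assumes "continuous_on S p" "t \<in> S" "open V" "0 \<in> V"
  shows "\<exists>d>0. \<forall>u\<in>S. \<bar>u - t\<bar> < d \<longrightarrow> - p t + p u \<in> V"
proof -
  have "(p \<longlongrightarrow> p t) (at t within S)" using assms by (simp add: continuous_on_def)
  moreover have "open {x. - p t + x \<in> V}" by (intro open_vimage_cont assms continuous_intros)
  ultimately have "\<forall>\<^sub>F u in at t within S. p u \<in> {x. - p t + x \<in> V}"
    using assms(4) by (intro topological_tendstoD) auto
  then obtain d where d: "d > 0" "\<And>u. u \<in> S \<Longrightarrow> u \<noteq> t \<Longrightarrow> dist u t < d \<Longrightarrow> - p t + p u \<in> V"
    unfolding eventually_at by auto
  show ?thesis
  proof (intro exI[of _ d] conjI ballI impI d(1))
    fix u assume "u \<in> S" "\<bar>u - t\<bar> < d"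
    then show "- p t + p u \<in> V" using d(2)[of u] assms(4) by (cases "u = t") (auto simp: dist_real_def)
  qed
qed

text \<open>\<open>simply_connected\<close> says that any two loops are freely homotopic; a homotopy
  between constant loops traces a path between their points.\<close>

lemma simply_connected_path:
  assumes "simply_connected S" "a \<in> S" "b \<in> S"
  shows "\<exists>p. continuous_on {0..1::real} p \<and> p ` {0..1} \<subseteq> S \<and> p 0 = a \<and> p 1 = b"
proof -
  have "homotopic_loops S (\<lambda>_. a) (\<lambda>_. b)"
    using assms(2,3) assms(1)[unfolded simply_connected_def, THEN spec[of _ "\<lambda>_. a"], THEN spec[of _ "\<lambda>_. b"]]
    by (auto simp: path_def pathfinish_def pathstart_def path_image_def)
  then obtain h where h: "continuous_on ({0..1::real} \<times> {0..1::real}) h" "h ` ({0..1} \<times> {0..1}) \<subseteq> S"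
    "\<forall>x\<in>{0..1}. h (0, x) = a" "\<forall>x\<in>{0..1}. h (1, x) = b"
    unfolding homotopic_loops by (auto simp: image_subset_iff Pi_iff)
  have "continuous_on {0..1} (\<lambda>t. h (t, 0))"
    by (rule continuous_on_compose2[OF h(1)]) (auto intro!: continuous_intros)
  then show ?thesis using h by (intro exI[of _ "\<lambda>t. h (t, 0)"]) auto
qed

section \<open>Lifting paths along a local homomorphism\<close>

locale local_homomorphism =
  fixes W :: "'g::topological_group_add set" and \<delta> :: "'g \<Rightarrow> 'h::group_add"
  assumes W: "open W" "0 \<in> W"
    and \<delta>: "g \<in> W \<Longrightarrow> h \<in> W \<Longrightarrow> g + h \<in> W \<Longrightarrow> \<delta> (g + h) = \<delta> g + \<delta> h"
begin

lemma \<delta>0: "\<delta> 0 = 0"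
  using \<delta>[of 0 0] W add_left_cancel[of "\<delta> 0" "\<delta> 0" 0] by simp

definition step :: "(real \<Rightarrow> 'g) \<Rightarrow> (real \<Rightarrow> 'h) \<Rightarrow> real \<Rightarrow> real \<Rightarrow> bool" where
  "step p q t u \<longleftrightarrow> - p t + p u \<in> W \<and> q u = q t + \<delta> (- p t + p u)"

text \<open>A development of \<open>p\<close> in the target: near each \<open>t\<close> its
  increments are the \<open>\<delta>\<close>-images of those of \<open>p\<close>. The target is a
  bare group here, so \<open>q\<close> is governed by increments and not by continuity.\<close>

definition lift :: "real set \<Rightarrow> (real \<Rightarrow> 'g) \<Rightarrow> (real \<Rightarrow> 'h) \<Rightarrow> bool" where
  "lift S p q \<longleftrightarrow> (\<forall>t\<in>S. \<exists>d>0. \<forall>u\<in>S. \<bar>u - t\<bar> < d \<longrightarrow> step p q t u)"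

text \<open>\<open>\<phi>\<close> is a reparametrisation. The factor 2 admits
  \<open>t \<mapsto> 2 * t\<close> and \<open>t \<mapsto> 2 * t - 1\<close>, which occur when two
  paths are concatenated.\<close>

lemma lift_transfer:
  assumes l: "lift S p q" and \<phi>: "\<And>t. t \<in> T \<Longrightarrow> \<phi> t \<in> S" "\<And>t u. \<bar>\<phi> u - \<phi> t\<bar> \<le> 2 * \<bar>u - t\<bar>"
    and st: "\<And>t u. t \<in> T \<Longrightarrow> u \<in> T \<Longrightarrow> step p q (\<phi> t) (\<phi> u) \<Longrightarrow> step p' q' t u"
  shows "lift T p' q'"
  unfolding lift_def
proof
  fix t assume t: "t \<in> T"
  obtain d where d: "d > 0" "\<And>u. u \<in> S \<Longrightarrow> \<bar>u - \<phi> t\<bar> < d \<Longrightarrow> step p q (\<phi> t) u"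
    using l \<phi>(1)[OF t] unfolding lift_def by blast
  show "\<exists>d>0. \<forall>u\<in>T. \<bar>u - t\<bar> < d \<longrightarrow> step p' q' t u"
  proof (intro exI[of _ "d / 2"] conjI ballI impI)
    fix u assume u: "u \<in> T" "\<bar>u - t\<bar> < d / 2"
    then have "\<bar>\<phi> u - \<phi> t\<bar> < d" using \<phi>(2)[of u t] by simp
    then show "step p' q' t u" using st[OF t u(1)] d(2) \<phi>(1) u(1) by blast
  qed (use d(1) in simp)
qed

lemma small: "\<exists>V. open V \<and> 0 \<in> V \<and> V \<subseteq> W \<and> (\<forall>x\<in>V. - x \<in> V) \<and> (\<forall>x\<in>V. \<forall>y\<in>V. x + y \<in> W)"
  by (rule zero_nbhd_symmetric[OF W])

text \<open>The discrepancy between the lifts of two close paths is locally constant: around the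
  small quadrilateral \<open>p t\<close>, \<open>p u\<close>, \<open>p' u\<close>,
  \<open>p' t\<close> the increments satisfy \<open>a + b = c + d\<close> inside \<open>W\<close>,
  and \<open>\<delta>\<close> respects both sums. Uniqueness of lifts and invariance under small
  homotopies are both instances.\<close>

lemma lift_compare:
  assumes V: "open V" "0 \<in> V" "V \<subseteq> W" "\<forall>x\<in>V. \<forall>y\<in>V. x + y \<in> W"
    and p: "continuous_on {0..1} p'" and l: "lift {0..1} p q" "lift {0..1} p' q'"
    and close: "\<And>t. t \<in> {0..1} \<Longrightarrow> - p t + p' t \<in> V"
  shows "q 1 + \<delta> (- p 1 + p' 1) + - q' 1 = q 0 + \<delta> (- p 0 + p' 0) + - q' 0"
proof (rule connected_Icc_local_const)
  fix t :: real assume t: "t \<in> {0..1}"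
  obtain d1 where d1: "d1 > 0" "\<And>u. u \<in> {0..1} \<Longrightarrow> \<bar>u - t\<bar> < d1 \<Longrightarrow> step p q t u"
    using l(1) t unfolding lift_def by blast
  obtain d2 where d2: "d2 > 0" "\<And>u. u \<in> {0..1} \<Longrightarrow> \<bar>u - t\<bar> < d2 \<Longrightarrow> step p' q' t u"
    using l(2) t unfolding lift_def by blast
  obtain d3 where d3: "d3 > 0" "\<And>u. u \<in> {0..1} \<Longrightarrow> \<bar>u - t\<bar> < d3 \<Longrightarrow> - p' t + p' u \<in> V"
    using continuous_difference_small[OF p t V(1,2)] by blast
  show "\<exists>d>0. \<forall>u\<in>{0..1}. \<bar>u - t\<bar> < d \<longrightarrow>
    q u + \<delta> (- p u + p' u) + - q' u = q t + \<delta> (- p t + p' t) + - q' t"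
  proof (intro exI[of _ "min d1 (min d2 d3)"] conjI ballI impI)
    fix u :: real assume u: "u \<in> {0..1}" "\<bar>u - t\<bar> < min d1 (min d2 d3)"
    define a b c d where "a = - p t + p u" and "b = - p u + p' u" and "c = - p t + p' t" and "d = - p' t + p' u"
    have abcd: "a + b = c + d" by (simp add: a_def b_def c_def d_def grp)
    have st: "step p q t u" "step p' q' t u" using d1(2)[OF u(1)] d2(2)[OF u(1)] u(2) by auto
    have "d \<in> V" unfolding d_def using d3(2)[OF u(1)] u(2) by auto
    then have in_W: "a \<in> W" "b \<in> W" "c \<in> W" "d \<in> W" "c + d \<in> W"
      using st(1) close[OF u(1)] close[OF t] V(3,4) unfolding a_def b_def c_def step_def by auto
    have "\<delta> a + \<delta> b = \<delta> c + \<delta> d" using \<delta>[of a b] \<delta>[of c d] in_W abcd by simp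
    moreover have "q u = q t + \<delta> a" "q' u = q' t + \<delta> d" using st by (simp_all add: a_def d_def step_def)
    ultimately have "q u + \<delta> b + - q' u = q t + (\<delta> c + \<delta> d) + - (q' t + \<delta> d)"
      by (simp add: add.assoc)
    also have "\<dots> = q t + \<delta> c + - q' t" by (simp only: minus_add add.assoc add_minus_cancel)
    finally show "q u + \<delta> (- p u + p' u) + - q' u = q t + \<delta> (- p t + p' t) + - q' t"
      by (simp only: b_def c_def)
  qed (use d1 d2 d3 in auto)
qed

lemma lift_unique:
  assumes "continuous_on {0..1} p" "lift {0..1} p q" "lift {0..1} p q'" "q 0 = q' 0"
  shows "q 1 = q' 1"
proof -
  obtain V where V: "open V" "0 \<in> V" "V \<subseteq> W" "\<forall>x\<in>V. \<forall>y\<in>V. x + y \<in> W"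
    using small by blast
  have "q 1 + - q' 1 = 0"
    using lift_compare[OF V assms(1,2,3)] V(2) assms(4) by (simp add: \<delta>0)
  then show ?thesis using right_minus_eq[of "q 1" "q' 1"] by (simp add: diff_conv_add_uminus)
qed

lemma lift_concat:
  assumes "lift {a..b} p q" "lift {b..c} p q" "a \<le> b" "b \<le> c"
  shows "lift {a..c} p q"
  unfolding lift_def
proof
  fix t assume t: "t \<in> {a..c}"
  obtain d where d: "d > 0" "\<And>u. t \<le> b \<Longrightarrow> u \<in> {a..b} \<Longrightarrow> \<bar>u - t\<bar> < d \<Longrightarrow> step p q t u"
  proof (cases "t \<le> b")
    case True
    then have "t \<in> {a..b}" using t by simp
    then show ?thesis using assms(1) that unfolding lift_def by blast
  qed (use that[of 1] in simp)
  obtain d' where d': "d' > 0" "\<And>u. t \<ge> b \<Longrightarrow> u \<in> {b..c} \<Longrightarrow> \<bar>u - t\<bar> < d' \<Longrightarrow> step p q t u"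
  proof (cases "t \<ge> b")
    case True
    then have "t \<in> {b..c}" using t by simp
    then show ?thesis using assms(2) that unfolding lift_def by blast
  qed (use that[of 1] in simp)
  \<comment> \<open>Within distance \<open>e\<close> the point \<open>u\<close> stays on the same
    side of \<open>b\<close> as \<open>t\<close>. For \<open>t = b\<close> both halves apply and 1
    is a dummy radius.\<close>
  define e where "e = (if t = b then 1 else \<bar>t - b\<bar>)"
  show "\<exists>d>0. \<forall>u\<in>{a..c}. \<bar>u - t\<bar> < d \<longrightarrow> step p q t u"
  proof (intro exI[of _ "min e (min d d')"] conjI ballI impI)
    fix u assume u: "u \<in> {a..c}" "\<bar>u - t\<bar> < min e (min d d')"
    then have "t \<le> b \<and> u \<le> b \<or> b \<le> t \<and> b \<le> u" by (auto simp: e_def split: if_splits)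
    then show "step p q t u" using d(2) d'(2) u by auto
  qed (use d(1) d'(1) in \<open>simp add: e_def\<close>)
qed

lemma lift_exists:
  fixes p :: "real \<Rightarrow> 'g"
  assumes "continuous_on {0..1} p"
  shows "\<exists>q. q 0 = 0 \<and> lift {0..1} p q"
proof -
  \<comment> \<open>Bisection asks for lifts on all short intervals around a point, including those
    that stick out of \<open>{0..1}\<close>, so \<open>p\<close> is extended by constants.\<close>
  define p' where "p' t = p (max 0 (min 1 t))" for t
  have cont: "continuous_on UNIV p'" unfolding p'_def
    by (rule continuous_on_compose2[OF assms]) (auto intro!: continuous_intros)
  have "\<exists>q. lift {0..1} p' q"
  proof (rule Bolzano[of 0 1 "\<lambda>a b. \<exists>q. lift {a..b} p' q"])
    fix a b c :: real assume "\<exists>q. lift {a..b} p' q" "\<exists>q. lift {b..c} p' q" and abc: "a \<le> b" "b \<le> c"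
    then obtain q1 q2 where q1: "lift {a..b} p' q1" and q2: "lift {b..c} p' q2" by blast
    \<comment> \<open>Lifts may be translated from the left; the second one is shifted to match the
      first at \<open>b\<close>.\<close>
    define q where "q t = (if t \<le> b then q1 t else q1 b + (- q2 b + q2 t))" for t
    have q1': "t \<le> b \<Longrightarrow> q t = q1 t" and q2': "t \<ge> b \<Longrightarrow> q t = q1 b + (- q2 b + q2 t)" for t
      by (auto simp: q_def dest: antisym)
    have "lift {a..b} p' q" by (rule lift_transfer[OF q1, where \<phi> = "\<lambda>t. t"]) (simp_all add: step_def q1')
    moreover have "lift {b..c} p' q" by (rule lift_transfer[OF q2, where \<phi> = "\<lambda>t. t"]) (simp_all add: step_def q2' add.assoc)
    ultimately have "lift {a..c} p' q" using abc by (rule lift_concat)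
    then show "\<exists>q. lift {a..c} p' q" by blast
  next
    fix x :: real
    obtain V where V: "open V" "0 \<in> V" "V \<subseteq> W" "\<forall>x\<in>V. - x \<in> V" "\<forall>x\<in>V. \<forall>y\<in>V. x + y \<in> W"
      using small by blast
    obtain d where d: "d > 0" "\<And>u. \<bar>u - x\<bar> < d \<Longrightarrow> - p' x + p' u \<in> V"
      using continuous_difference_small[OF cont UNIV_I V(1,2)] by blast
    have *: "- p' s + p' u \<in> W" if "\<bar>s - x\<bar> < d" "\<bar>u - x\<bar> < d" for s u
    proof -
      have "- (- p' x + p' s) + (- p' x + p' u) \<in> W" using V d(2) that by blast
      then show ?thesis by (simp add: grp)
    qed
    show "\<exists>d>0. \<forall>a b. a \<le> x \<and> x \<le> b \<and> b - a < d \<longrightarrow> (\<exists>q. lift {a..b} p' q)"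
    proof (intro exI[of _ d] conjI allI impI d(1))
      fix a b assume ab: "a \<le> x \<and> x \<le> b \<and> b - a < d"
      have *: "- p' t + p' u \<in> W" "\<delta> (- p' a + p' u) = \<delta> (- p' a + p' t) + \<delta> (- p' t + p' u)"
        if tu: "t \<in> {a..b}" "u \<in> {a..b}" for t u
      proof -
        have "\<bar>t - x\<bar> < d" "\<bar>u - x\<bar> < d" "\<bar>a - x\<bar> < d" using ab tu by auto
        note w = *[OF this(3) this(1)] *[OF this(1) this(2)] *[OF this(3) this(2)]
        have "(- p' a + p' t) + (- p' t + p' u) = - p' a + p' u" by (simp add: grp)
        then show "- p' t + p' u \<in> W" "\<delta> (- p' a + p' u) = \<delta> (- p' a + p' t) + \<delta> (- p' t + p' u)"
          using \<delta>[OF w(1,2)] w by simp_all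
      qed
      have "lift {a..b} p' (\<lambda>u. \<delta> (- p' a + p' u))" unfolding lift_def step_def
        by (intro ballI exI[of _ 1] conjI impI *) simp_all
      then show "\<exists>q. lift {a..b} p' q" by blast
    qed
  qed auto
  then obtain q where q: "lift {0..1} p' q" by blast
  have "lift {0..1} p (\<lambda>t. - q 0 + q t)"
    by (rule lift_transfer[OF q, where \<phi> = "\<lambda>t. t"]) (simp_all add: step_def p'_def add.assoc)
  then show ?thesis by (intro exI[of _ "\<lambda>t. - q 0 + q t"]) simp
qed

text \<open>Monodromy along a homotopy from the constant loop. The homotopy is one of free loops, so
  the base point moves and the end point of the lift changes by conjugation; what is locally
  constant is whether it is 0.\<close>

lemma lift_loop:
  fixes p :: "real \<Rightarrow> 'g"
  assumes S: "simply_connected S" and p: "continuous_on {0..1} p" "p ` {0..1} \<subseteq> S" "p 0 = p 1"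
    and q: "lift {0..1} p q" "q 0 = 0"
  shows "q 1 = 0"
proof -
  obtain V where V: "open V" "0 \<in> V" "V \<subseteq> W" "\<forall>x\<in>V. \<forall>y\<in>V. x + y \<in> W"
    using small by blast
  have "p 0 \<in> S" using p(2) by auto
  then have "homotopic_loops S (\<lambda>_. p 0) p"
    using p S[unfolded simply_connected_def, THEN spec[of _ "\<lambda>_. p 0"], THEN spec[of _ p]]
    by (auto simp: path_def pathfinish_def pathstart_def path_image_def)
  then obtain h where h: "continuous_on ({0..1::real} \<times> {0..1::real}) h"
    "\<forall>x\<in>{0..1}. h (0, x) = p 0" "\<forall>x\<in>{0..1}. h (1, x) = p x" "\<forall>t\<in>{0..1}. h (t, 1) = h (t, 0)"
    unfolding homotopic_loops by (auto simp: pathfinish_def pathstart_def)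
  have hs: "continuous_on {0..1} (\<lambda>t. h (s, t))" if "s \<in> {0..1}" for s
    by (rule continuous_on_compose2[OF h(1)]) (use that in \<open>auto intro!: continuous_intros\<close>)
  then have "\<forall>s\<in>{0..1}. \<exists>q. q 0 = 0 \<and> lift {0..1} (\<lambda>t. h (s, t)) q" using lift_exists by blast
  then obtain Q where Q: "\<And>s. s \<in> {0..1} \<Longrightarrow> Q s 0 = 0" "\<And>s. s \<in> {0..1} \<Longrightarrow> lift {0..1} (\<lambda>t. h (s, t)) (Q s)"
    by metis
  have "(Q 1 1 = 0) = (Q 0 1 = 0)"
  proof (rule connected_Icc_local_const)
    fix s :: real assume s: "s \<in> {0..1}"
    have "continuous_on ({0..1} \<times> {0..1}) (\<lambda>z. - h (s, snd z) + h z)"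
      using s by (intro continuous_intros h(1) continuous_on_compose2[OF h(1)]) auto
    then obtain T where T: "open T" "T \<inter> ({0..1} \<times> {0..1}) = (\<lambda>z. - h (s, snd z) + h z) -` V \<inter> ({0..1} \<times> {0..1})"
      using V(1) unfolding continuous_on_open_invariant by blast
    have "(s, t) \<in> T" if "t \<in> {0..1}" for t
    proof -
      have "(s, t) \<in> (\<lambda>z. - h (s, snd z) + h z) -` V \<inter> ({0..1} \<times> {0..1})" using s that V(2) by simp
      then show ?thesis using T(2) by (metis IntD1)
    qed
    then have sT: "{s} \<times> {0..1} \<subseteq> T" by (simp add: subset_iff)
    \<comment> \<open>The tube lemma makes the closeness of neighbouring loops uniform along the
      whole loop.\<close>
    obtain X where X: "s \<in> X" "open X" "X \<times> {0..1} \<subseteq> T"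
      using Elementary_Topology.tube_lemma[OF compact_Icc T(1) sT] by (elim exE conjE)
    then obtain d where d: "d > 0" "\<And>u. \<bar>u - s\<bar> < d \<Longrightarrow> u \<in> X"
      using open_real[of X] by blast
    show "\<exists>d>0. \<forall>u\<in>{0..1}. \<bar>u - s\<bar> < d \<longrightarrow> (Q u 1 = 0) = (Q s 1 = 0)"
    proof (intro exI[of _ d] conjI ballI impI d(1))
      fix u :: real assume u: "u \<in> {0..1}" "\<bar>u - s\<bar> < d"
      have "- h (s, t) + h (u, t) \<in> V" if t: "t \<in> {0..1}" for t
      proof -
        have "(u, t) \<in> T \<inter> ({0..1} \<times> {0..1})" using X(3) d(2)[OF u(2)] t u by blast
        then show ?thesis unfolding T(2) by simp
      qed
      from lift_compare[OF V hs[OF u(1)] Q(2)[OF s] Q(2)[OF u(1)] this]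
      have "Q s 1 + \<delta> (- h (s, 0) + h (u, 0)) + - Q u 1 = \<delta> (- h (s, 0) + h (u, 0))"
        using h(4) s u Q(1) by simp
      then show "(Q u 1 = 0) = (Q s 1 = 0)"
        by (metis add.right_neutral add_0 add_right_cancel add_left_cancel add.inverse_neutral neg_equal_0_iff_equal)
    qed
  qed
  moreover have "Q 0 1 = 0"
  proof -
    have "lift {0..1} (\<lambda>t. h (0, t)) (\<lambda>_. 0)" unfolding lift_def step_def using h(2) W(2)
      by (intro ballI exI[of _ 1]) (auto simp: \<delta>0)
    from lift_unique[OF hs Q(2) this] Q(1) show ?thesis by simp
  qed
  moreover have "Q 1 1 = q 1"
  proof (rule lift_unique[OF p(1) _ q(1), of "Q 1"])
    show "lift {0..1} p (Q 1)" by (rule lift_transfer[OF Q(2)[of 1], where \<phi> = "\<lambda>t. t"]) (use h(3) in \<open>auto simp: step_def\<close>)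
  qed (use Q(1) q(2) in simp)
  ultimately show ?thesis by simp
qed

text \<open>The graph of the extended homomorphism, kept as a relation until monodromy shows that it
  is single-valued.\<close>

definition holonomy :: "'g set \<Rightarrow> 'g \<Rightarrow> 'h \<Rightarrow> bool" where
  "holonomy S g h \<longleftrightarrow> (\<exists>p q. continuous_on {0..1} p \<and> p ` {0..1} \<subseteq> S \<and> p 0 = 0 \<and> p 1 = g \<and>
     lift {0..1} p q \<and> q 0 = 0 \<and> q 1 = h)"

lemma holonomy_exists:
  assumes "simply_connected S" "0 \<in> S" "g \<in> S"
  shows "\<exists>h. holonomy S g h"
  using simply_connected_path[OF assms] lift_exists unfolding holonomy_def by metis

lemma holonomy_add:
  assumes S: "\<forall>x\<in>S. \<forall>y\<in>S. x + y \<in> S" and "holonomy S g h" "holonomy S g' h'"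
  shows "holonomy S (g + g') (h + h')"
proof -
  obtain p q where p: "continuous_on {0..1} p" "p ` {0..1} \<subseteq> S" "p 0 = 0" "p 1 = g"
    and q: "lift {0..1} p q" "q 0 = 0" "q 1 = h" using assms(2) unfolding holonomy_def by blast
  obtain p' q' where p': "continuous_on {0..1} p'" "p' ` {0..1} \<subseteq> S" "p' 0 = 0" "p' 1 = g'"
    and q': "lift {0..1} p' q'" "q' 0 = 0" "q' 1 = h'" using assms(3) unfolding holonomy_def by blast
  \<comment> \<open>The path \<open>p\<close> followed by \<open>g + p'\<close>, each at double
    speed. The clamps write this as one pointwise sum, so continuity requires no gluing.\<close>
  define r where "r t = p (min 1 (2 * t)) + p' (max 0 (2 * t - 1))" for t
  define s where "s t = q (min 1 (2 * t)) + q' (max 0 (2 * t - 1))" for t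
  have r1: "r t = p (2 * t)" "s t = q (2 * t)" if "t \<le> 1/2" for t
    using that p'(3) q'(2) by (auto simp: r_def s_def)
  have r2: "r t = g + p' (2 * t - 1)" "s t = h + q' (2 * t - 1)" if "t \<ge> 1/2" for t
    using that p(4) q(3) by (auto simp: r_def s_def)
  have two: "\<bar>2 * u - c - (2 * t - c)\<bar> \<le> 2 * \<bar>u - t\<bar>" for c t u :: real by (simp add: abs_if)
  have "lift {0..1/2} r s"
    by (rule lift_transfer[OF q(1) _ two[of _ 0]]) (simp_all add: r1 step_def)
  moreover have "lift {1/2..1} r s"
    by (rule lift_transfer[OF q'(1) _ two[of _ 1]]) (simp_all add: r2 step_def grp)
  ultimately have "lift {0..1} r s" by (rule lift_concat) auto
  moreover have "continuous_on {0..1} r" unfolding r_def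
    by (intro continuous_intros continuous_on_compose2[OF p(1)] continuous_on_compose2[OF p'(1)]) auto
  moreover have "r ` {0..1} \<subseteq> S"
  proof
    fix x assume "x \<in> r ` {0..1}"
    then obtain t where t: "t \<in> {0..1}" "x = r t" by blast
    have "p (min 1 (2 * t)) \<in> S" "p' (max 0 (2 * t - 1)) \<in> S" using t p(2) p'(2) by (auto simp: image_subset_iff)
    then show "x \<in> S" using S t by (simp add: r_def)
  qed
  moreover have "r 0 = 0" "r 1 = g + g'" "s 0 = 0" "s 1 = h + h'"
    using p p' q q' by (auto simp: r_def s_def)
  ultimately show ?thesis unfolding holonomy_def by blast
qed

lemma holonomy_zero: "simply_connected S \<Longrightarrow> holonomy S 0 h \<Longrightarrow> h = 0"
  using lift_loop unfolding holonomy_def by metis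

lemma holonomy_unique:
  assumes S: "simply_connected S" "0 \<in> S" "\<forall>x\<in>S. \<forall>y\<in>S. x + y \<in> S" "- g \<in> S"
    and "holonomy S g h" "holonomy S g h'"
  shows "h = h'"
proof -
  obtain k where k: "holonomy S (- g) k" using holonomy_exists[OF S(1,2,4)] by blast
  have "h + k = 0" "h' + k = 0"
    using holonomy_zero[OF S(1)] holonomy_add[OF S(3) assms(5) k] holonomy_add[OF S(3) assms(6) k] by auto
  then show ?thesis by (metis add_right_cancel)
qed

text \<open>Along a path inside a small \<open>V\<close> the function \<open>\<delta> (p t)\<close>
  is itself a lift, so the extension agrees with \<open>\<delta>\<close> at the ends of such
  paths.\<close>

lemma holonomy_small: "\<exists>V. open V \<and> 0 \<in> V \<and> (\<forall>S. \<forall>g\<in>reachable (V \<inter> S). holonomy S g (\<delta> g))"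
proof -
  obtain V where V: "open V" "0 \<in> V" "V \<subseteq> W" "\<forall>x\<in>V. - x \<in> V" "\<forall>x\<in>V. \<forall>y\<in>V. x + y \<in> W"
    using small by blast
  have "holonomy S g (\<delta> g)" if "g \<in> reachable (V \<inter> S)" for S g
  proof -
    obtain p where p: "continuous_on {0..1::real} p" "p 0 = 0" "p 1 = g" "p ` {0..1} \<subseteq> V \<inter> S"
      using \<open>g \<in> reachable (V \<inter> S)\<close> unfolding reachable_def by blast
    have *: "- p t + p u \<in> W" "\<delta> (p u) = \<delta> (p t) + \<delta> (- p t + p u)" if "t \<in> {0..1}" "u \<in> {0..1}" for t u
    proof -
      have "p t \<in> V" "p u \<in> V" using p(4) that by auto
      then have "- p t + p u \<in> W" "p t \<in> W" "p u \<in> W" using V by auto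
      then show "- p t + p u \<in> W" "\<delta> (p u) = \<delta> (p t) + \<delta> (- p t + p u)"
        using \<delta>[of "p t" "- p t + p u"] by simp_all
    qed
    have "lift {0..1} p (\<lambda>t. \<delta> (p t))" unfolding lift_def step_def
      by (intro ballI exI[of _ 1] conjI impI *) simp_all
    then show ?thesis unfolding holonomy_def
      by (intro exI[of _ p] exI[of _ "\<lambda>t. \<delta> (p t)"]) (use p in \<open>auto simp: \<delta>0\<close>)
  qed
  then show ?thesis using V by blast
qed

end

text \<open>Agreement with \<open>\<delta>\<close> is claimed on \<open>N\<close> only: it needs
  paths inside a small set, and \<open>reachable_nbhd\<close> provides them on a
  neighbourhood.\<close>

lemma (in haar_open) local_homomorphism_extends:
  fixes K W :: "'g set" and \<delta> :: "'g \<Rightarrow> 'h::group_add"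
  assumes K: "open K" "is_subgroup K" "simply_connected K" and W: "open W" "0 \<in> W"
    and \<delta>: "\<And>g h. g \<in> W \<Longrightarrow> h \<in> W \<Longrightarrow> g + h \<in> W \<Longrightarrow> \<delta> (g + h) = \<delta> g + \<delta> h"
  shows "\<exists>\<delta>' N. open N \<and> 0 \<in> N \<and> N \<subseteq> K \<and> (\<forall>g\<in>N. \<delta>' g = \<delta> g) \<and> (\<forall>g\<in>K. \<forall>h\<in>K. \<delta>' (g + h) = \<delta>' g + \<delta>' h)"
proof -
  interpret local_homomorphism W \<delta> by unfold_locales (fact W \<delta>)+
  have S: "0 \<in> K" "\<forall>x\<in>K. \<forall>y\<in>K. x + y \<in> K" "\<And>x. x \<in> K \<Longrightarrow> - x \<in> K"
    using K(2) unfolding is_subgroup_def by blast+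
  define \<delta>' where "\<delta>' g = (THE h. holonomy K g h)" for g
  have hol: "\<delta>' g = h" if "g \<in> K" "holonomy K g h" for g h
    unfolding \<delta>'_def using that holonomy_unique[OF K(3) S(1,2) S(3)] by (intro the_equality) auto
  have hol': "holonomy K g (\<delta>' g)" if g: "g \<in> K" for g
    using holonomy_exists[OF K(3) S(1) g] hol[OF g] by blast
  obtain V where V: "open V" "0 \<in> V" "\<And>S g. g \<in> reachable (V \<inter> S) \<Longrightarrow> holonomy S g (\<delta> g)"
    using holonomy_small by blast
  have reach: "g \<in> reachable UNIV" if "g \<in> K" for g
    using simply_connected_path[OF K(3) S(1) that] by (auto simp: reachable_def)
  have "open (V \<inter> K)" "0 \<in> V \<inter> K" "K \<noteq> {}" using V K S by auto
  then obtain N where N: "open N" "0 \<in> N" "N \<subseteq> reachable (V \<inter> K)"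
    using reachable_nbhd[OF K(1) _ reach] by blast
  have NK: "N \<subseteq> K" using N(3) reachable_subset[of "V \<inter> K"] by blast
  show ?thesis
  proof (intro exI[of _ \<delta>'] exI[of _ N] conjI ballI)
    fix g assume "g \<in> N"
    then show "\<delta>' g = \<delta> g" using hol V(3) N(3) NK by blast
  next
    fix g h assume "g \<in> K" "h \<in> K"
    then show "\<delta>' (g + h) = \<delta>' g + \<delta>' h"
      using S(2) by (intro hol holonomy_add hol') auto
  qed (use N NK in auto)
qed

subsection \<open>Strong ergodicity\<close>

text \<open>The union of all basic open sets of small mass has small mass, and at most one point lies
  outside of it.\<close>

lemma (in prob_space) atom_if_no_intermediate_mass:
  fixes f :: "'a \<Rightarrow> 'b::{t2_space, second_countable_topology}"
  assumes f [measurable]: "f \<in> borel_measurable M" and e: "0 < e" "e \<le> 1/3"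
    and B: "\<And>B. B \<in> sets borel \<Longrightarrow> prob (f -` B \<inter> space M) < e \<or> prob (f -` B \<inter> space M) > 1 - e"
  shows "\<exists>c. prob (f -` {c} \<inter> space M) > 1 - e"
proof -
  obtain \<B> :: "'b set set" where \<B>: "countable \<B>" "topological_basis \<B>"
    using ex_countable_basis by blast
  have opn: "open b" if "b \<in> \<B>" for b using topological_basis_open[OF \<B>(2) that] .
  define \<S> where "\<S> = {b \<in> \<B>. prob (f -` b \<inter> space M) < e}"
  define p where "p A = prob (f -` A \<inter> space M)" for A
  have p_mono: "p A \<le> p A'" if "A \<subseteq> A'" "A' \<in> sets borel" for A A'
    unfolding p_def using that by (intro finite_measure_mono) (auto intro: measurable_sets[OF f])
  have p_Un: "p (A \<union> A') \<le> p A + p A'" if "A \<in> sets borel" "A' \<in> sets borel" for A A'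
    unfolding p_def vimage_Un Int_Un_distrib2
    using that by (intro measure_Un_le measurable_sets[OF f])
  have sb: "b \<in> sets borel" if "b \<in> \<S>" for b using opn that by (auto simp: \<S>_def)
  have fin: "finite F \<Longrightarrow> F \<subseteq> \<S> \<Longrightarrow> p (\<Union>F) < e" for F
  proof (induction F rule: finite_induct)
    case (insert b F)
    have bF: "b \<in> sets borel" "\<Union>F \<in> sets borel"
      using insert sb by (auto intro!: sets.finite_Union)
    have "p b < e" using insert.prems by (auto simp: \<S>_def p_def)
    \<comment> \<open>The bound \<open>1/3\<close> comes from here: \<open>2 * e \<le> 1 - e\<close>
      excludes the upper alternative for the union, so its mass drops below \<open>e\<close>
      again.\<close>
    then have "p (b \<union> \<Union>F) < 2 * e" using p_Un[OF bF] insert.IH insert.prems by auto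
    then show ?case using B[of "b \<union> \<Union>F"] bF e unfolding p_def by auto
  qed (use e in \<open>simp add: p_def\<close>)
  have cS: "countable \<S>" using \<B>(1) by (simp add: \<S>_def)
  have "p (\<Union>\<S>) < e"
  proof (cases "\<S> = {}")
    case False
    let ?b = "from_nat_into \<S>"
    define T where "T n = f -` (\<Union>i\<le>n. ?b i) \<inter> space M" for n
    have "(\<Union>i\<le>n. ?b i) \<in> sets borel" for n
      by (rule sets.finite_UN) (simp_all add: sb[OF from_nat_into[OF False]])
    then have "range T \<subseteq> sets M" unfolding T_def using measurable_sets[OF f] by blast
    moreover have "incseq T" unfolding T_def incseq_def by fastforce
    ultimately have lim: "(\<lambda>n. prob (T n)) \<longlonglongrightarrow> prob (\<Union>n. T n)"
      by (rule finite_Lim_measure_incseq)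
    have "\<Union>\<S> = (\<Union>n. ?b n)" using range_from_nat_into[OF False cS] by auto
    then have "(\<Union>n. T n) = f -` (\<Union>\<S>) \<inter> space M" by (auto simp: T_def)
    moreover have "prob (T n) < e" for n
      using fin[of "?b ` {..n}"] from_nat_into[OF False] by (auto simp: p_def T_def)
    then have "prob (\<Union>n. T n) \<le> e"
      by (intro LIMSEQ_le_const2[OF lim]) (auto intro!: exI[of _ 0] less_imp_le)
    ultimately have "p (\<Union>\<S>) \<le> e" unfolding p_def by simp
    moreover have "\<Union>\<S> \<in> sets borel" using cS sb by (intro sets.countable_Union) auto
    ultimately show ?thesis using B[of "\<Union>\<S>"] e unfolding p_def by auto
  qed (use e in \<open>simp add: p_def\<close>)
  moreover have US [measurable]: "\<Union>\<S> \<in> sets borel" using cS sb by (intro sets.countable_Union) auto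
  moreover have "f -` (- \<Union>\<S>) \<inter> space M = space M - (f -` (\<Union>\<S>) \<inter> space M)" by blast
  ultimately have big: "p (- \<Union>\<S>) > 1 - e"
    using prob_compl[OF measurable_sets[OF f US]] unfolding p_def by simp
  have "- \<Union>\<S> \<noteq> {}"
  proof
    assume "- \<Union>\<S> = {}"
    then show False using big e unfolding p_def by simp
  qed
  then obtain c where c: "c \<notin> \<Union>\<S>" by blast
  \<comment> \<open>Two distinct points outside would have disjoint basic neighbourhoods, each of
    mass above \<open>1 - e\<close>.\<close>
  have "x = c" if x: "x \<notin> \<Union>\<S>" for x
  proof (rule ccontr)
    assume ne: "x \<noteq> c"
    obtain U V where UV: "open U" "open V" "x \<in> U" "c \<in> V" "U \<inter> V = {}"
      using hausdorff[OF ne] by blast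
    obtain b where b: "b \<in> \<B>" "x \<in> b" "b \<subseteq> U" using topological_basisE[OF \<B>(2) UV(1,3)] by blast
    obtain b' where b': "b' \<in> \<B>" "c \<in> b'" "b' \<subseteq> V" using topological_basisE[OF \<B>(2) UV(2,4)] by blast
    have "b \<notin> \<S>" "b' \<notin> \<S>" using b(2) b'(2) c x by (meson UnionI)+
    then have "\<not> p b < e" "\<not> p b' < e" using b(1) b'(1) unfolding \<S>_def p_def by simp_all
    then have bb: "p b > 1 - e" "p b' > 1 - e"
      using B[OF borel_open[OF opn[OF b(1)]]] B[OF borel_open[OF opn[OF b'(1)]]] unfolding p_def by simp_all
    have "p b + p b' = prob ((f -` b \<inter> space M) \<union> (f -` b' \<inter> space M))"
      unfolding p_def using b b' UV(5) opn
      by (intro finite_measure_Union[symmetric] measurable_sets[OF f]) auto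
    also have "\<dots> \<le> 1" by simp
    finally show False using bb e by simp
  qed
  then have "- \<Union>\<S> \<subseteq> {c}" by auto
  from p_mono[OF this] big show ?thesis unfolding p_def by (intro exI[of _ c]) auto
qed

section \<open>Orbit maps and almost invariant sets\<close>

lemma (in haar) AE_right:
  assumes "AE x in M. P x"
  shows "AE x in M. P (x + s)"
proof -
  obtain N where N: "{x \<in> space M. \<not> P x} \<subseteq> N" "emeasure M N = 0" "N \<in> sets M"
    using assms by (rule AE_E)
  have "{x. x + s \<in> N} \<in> null_sets M"
    using haar_right_null[of N s] N by (intro null_setsI) auto
  then show ?thesis by (rule AE_I') (use N(1) in auto)
qed

lemma is_subgroupD:
  assumes "is_subgroup S"
  shows "0 \<in> S" "x \<in> S \<Longrightarrow> y \<in> S \<Longrightarrow> x + y \<in> S" "x \<in> S \<Longrightarrow> - x \<in> S"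
  using assms by (auto simp: is_subgroup_def)

lemma subgroup_orbit_shift:
  assumes S: "is_subgroup S" and ab: "a \<in> S" "b \<in> S"
  shows "(\<exists>s\<in>S. b + y = s + (a + x)) \<longleftrightarrow> (\<exists>s\<in>S. y = s + x)"
proof
  assume "\<exists>s\<in>S. b + y = s + (a + x)"
  then obtain s where s: "s \<in> S" "b + y = s + (a + x)" by blast
  have "y = - b + (b + y)" by simp
  also have "\<dots> = (- b + s + a) + x" unfolding s(2) by (simp only: add.assoc)
  finally show "\<exists>s\<in>S. y = s + x" using s(1) ab is_subgroupD(2,3)[OF S] by blast
next
  assume "\<exists>s\<in>S. y = s + x"
  then obtain s where s: "s \<in> S" "y = s + x" by blast
  then have "b + y = (b + s + - a) + (a + x)" by (simp add: grp)
  then show "\<exists>s\<in>S. b + y = s + (a + x)" using s(1) ab is_subgroupD(2,3)[OF S] by blast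
qed

text \<open>\<open>\<theta>\<close> is total but constrained only on the invariant conull set
  \<open>G0\<close>. The forward direction of \<open>orbits\<close> yields the cocycle; the backward
  direction is what later recovers \<open>\<Gamma>\<close> from \<open>\<Lambda>\<close>.\<close>

locale orbit_map = haar_open M for M :: "'g::lcsc_group measure" +
  fixes \<mu> :: "'g measure" and \<Gamma> :: "'g set" and \<Lambda> :: "'h::lcsc_group set" and \<theta> :: "'g \<Rightarrow> 'h" and G0 :: "'g set"
  assumes prob: "prob_space \<mu>" and sets_\<mu> [measurable_cong, simp]: "sets \<mu> = sets borel"
    and ac: "absolutely_continuous M \<mu>" "absolutely_continuous \<mu> M"
    and \<Gamma>: "is_subgroup \<Gamma>" "countable \<Gamma>" and \<Lambda>: "is_subgroup \<Lambda>" "countable \<Lambda>"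
    and strongly_ergodic: "strongly_ergodic_action \<Gamma> (+) \<mu>"
    and \<theta> [measurable]: "\<theta> \<in> borel_measurable borel" and G0 [measurable]: "G0 \<in> sets borel"
    and G0_conull: "emeasure M (- G0) = 0"
    and G0_invariant: "\<gamma> \<in> \<Gamma> \<Longrightarrow> x \<in> G0 \<Longrightarrow> \<gamma> + x \<in> G0"
    and orbits: "x \<in> G0 \<Longrightarrow> y \<in> G0 \<Longrightarrow> (\<exists>\<gamma>\<in>\<Gamma>. y = \<gamma> + x) \<longleftrightarrow> (\<exists>l\<in>\<Lambda>. \<theta> y = l + \<theta> x)"
begin

sublocale \<mu>: prob_space \<mu> by (rule prob)

lemma space_\<mu> [simp]: "space \<mu> = UNIV"
  using sets_eq_imp_space_eq[OF sets_\<mu>] by simp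

lemma null_\<mu>_iff: "A \<in> sets borel \<Longrightarrow> emeasure \<mu> A = 0 \<longleftrightarrow> emeasure M A = 0"
  using ac unfolding absolutely_continuous_def null_sets_def by auto

end

text \<open>An element of the full group agrees with elements of \<open>\<Gamma>\<close> on
  countably many pieces that exhaust the space up to a null set, so asymptotic invariance under
  \<open>\<Gamma>\<close> suffices.\<close>

lemma almost_invariantI:
  fixes \<Gamma> :: "'g::lcsc_group set"
  assumes "prob_space \<mu>" and sets_\<mu> [measurable_cong]: "sets \<mu> = sets borel"
    and \<Gamma>: "is_subgroup \<Gamma>" "countable \<Gamma>"
    and A [measurable]: "\<And>n. A n \<in> sets borel"
    and lim: "\<And>\<gamma>. \<gamma> \<in> \<Gamma> \<Longrightarrow> (\<lambda>n. emeasure \<mu> {x. (x \<in> A n) \<noteq> (\<gamma> + x \<in> A n)}) \<longlonglongrightarrow> 0"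
  shows "almost_invariant_sequence \<mu> (orbit_relation \<Gamma> (+) \<mu>) A"
  unfolding almost_invariant_sequence_def
proof (intro conjI allI ballI)
  interpret \<mu>: prob_space \<mu> by fact
  have sp [simp]: "space \<mu> = UNIV" using sets_eq_imp_space_eq[OF sets_\<mu>] by simp
  show "A n \<in> sets \<mu>" for n by simp
  fix h assume "h \<in> full_group \<mu> (orbit_relation \<Gamma> (+) \<mu>)"
  then have h: "nonsingular_isomorphism \<mu> \<mu> h" "AE x in \<mu>. (h x, x) \<in> orbit_relation \<Gamma> (+) \<mu>"
    by (auto simp: full_group_def)
  define k where "k = inv_into UNIV h"
  have bij: "bij h" and k [measurable]: "k \<in> borel_measurable \<mu>"
    and nonsing: "\<And>B. B \<in> sets borel \<Longrightarrow> h -` B \<in> null_sets \<mu> \<longleftrightarrow> B \<in> null_sets \<mu>"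
    using h(1) unfolding nonsingular_isomorphism_def k_def
    by (auto simp: measurable_cong_sets[OF refl sets_\<mu>])
  have hk: "h (k y) = y" and kh: "k (h x) = x" for x y
    using bij by (auto simp: k_def bij_is_surj bij_is_inj surj_f_inv_f)
  have k' [measurable]: "k \<in> borel_measurable borel" using k by (simp cong: measurable_cong_sets)
  obtain N where N: "{x \<in> space \<mu>. (h x, x) \<notin> orbit_relation \<Gamma> (+) \<mu>} \<subseteq> N" "emeasure \<mu> N = 0" "N \<in> sets \<mu>"
    using h(2) by (rule AE_E)
  have "k -` N \<in> sets borel" using measurable_sets[OF k', of N] N(3) sets_\<mu> by simp
  moreover have "h -` (k -` N) = N" using kh by auto
  ultimately have kN: "k -` N \<in> null_sets \<mu>" using nonsing[of "k -` N"] N by (auto intro: null_setsI)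
  have orb: "\<exists>\<gamma>\<in>\<Gamma>. k y = \<gamma> + y" if y: "y \<notin> k -` N" for y
  proof -
    have "(h (k y), k y) \<in> orbit_relation \<Gamma> (+) \<mu>" using N(1) y by auto
    then obtain \<gamma> where "\<gamma> \<in> \<Gamma>" "y = \<gamma> + k y" by (auto simp: orbit_relation_def action_orbit_def hk)
    then show ?thesis using is_subgroupD(3)[OF \<Gamma>(1)] by (intro bexI[of _ "- \<gamma>"]) (metis minus_add_cancel)
  qed
  have "\<Gamma> \<noteq> {}" using is_subgroupD(1)[OF \<Gamma>(1)] by auto
  define g where "g = from_nat_into \<Gamma>"
  have g: "g i \<in> \<Gamma>" for i unfolding g_def by (rule from_nat_into) fact
  have D [measurable]: "{x. k x = g i + x} \<in> sets borel" for i
    using measurable_equality_set[of k borel "\<lambda>x. g i + x"] by simp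
  define S where "S n = {y. (y \<in> A n) \<noteq> (k y \<in> A n)}" for n
  have S [measurable]: "S n \<in> sets borel" for n unfolding S_def by measurable
  have "(\<lambda>n. emeasure \<mu> (S n)) \<longlonglongrightarrow> 0"
  proof (rule emeasure_tendsto_zero_countable[where X = UNIV and D = "\<lambda>i. {x. k x = g i + x}"])
    have "y \<in> (\<Union>i. {x. k x = g i + x})" if y: "y \<notin> k -` N" for y
    proof -
      obtain \<gamma> where "\<gamma> \<in> \<Gamma>" "k y = \<gamma> + y" using orb[OF y] by blast
      moreover obtain i where "g i = \<gamma>" using from_nat_into_surj[OF \<Gamma>(2) \<open>\<gamma> \<in> \<Gamma>\<close>] by (auto simp: g_def)
      ultimately show ?thesis by auto
    qed
    then have "UNIV - (\<Union>i. {x. k x = g i + x}) \<subseteq> k -` N" by blast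
    from emeasure_mono[OF this, of \<mu>] kN show "emeasure \<mu> (UNIV - (\<Union>i. {x. k x = g i + x})) = 0" by (metis le_zero_eq null_setsD1 null_setsD2)
    show "\<forall>\<^sub>F n in sequentially. S n \<in> sets \<mu> \<and> S n \<subseteq> UNIV" by simp
    fix i
    show "(\<lambda>n. emeasure \<mu> (S n \<inter> {x. k x = g i + x})) \<longlonglongrightarrow> 0"
      by (rule tendsto_zero_mono[OF lim[OF g[of i]]])
         (auto intro!: always_eventually emeasure_mono simp: S_def)
  qed (auto simp: less_top[symmetric])
  then have "(\<lambda>n. measure \<mu> (S n)) \<longlonglongrightarrow> 0"
    unfolding measure_def by (intro tendsto_enn2real) auto
  moreover have "(A n - h ` A n) \<union> (h ` A n - A n) = S n" for n
  proof -
    have "y \<in> h ` A n \<longleftrightarrow> k y \<in> A n" for y using hk kh by (metis image_iff)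
    then show ?thesis by (auto simp: S_def)
  qed
  ultimately show "(\<lambda>n. measure \<mu> ((A n - h ` A n) \<union> (h ` A n - A n))) \<longlonglongrightarrow> 0" by simp
qed

text \<open>Strong ergodicity implies ergodicity: a constant sequence of one invariant set is almost
  invariant.\<close>

lemma strongly_ergodic_conull:
  fixes \<Gamma> :: "'g::lcsc_group set"
  assumes prob: "prob_space \<mu>" and sets: "sets \<mu> = sets borel"
    and \<Gamma>: "is_subgroup \<Gamma>" "countable \<Gamma>" and se: "strongly_ergodic_action \<Gamma> (+) \<mu>"
    and A: "A \<in> sets borel" and inv: "\<And>\<gamma> x. \<gamma> \<in> \<Gamma> \<Longrightarrow> x \<in> A \<Longrightarrow> \<gamma> + x \<in> A"
    and "emeasure \<mu> A \<noteq> 0"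
  shows "emeasure \<mu> (- A) = 0"
proof -
  interpret \<mu>: prob_space \<mu> by fact
  have sp: "space \<mu> = UNIV" using sets_eq_imp_space_eq[OF sets] by simp
  have iff: "\<gamma> + x \<in> A \<longleftrightarrow> x \<in> A" if "\<gamma> \<in> \<Gamma>" for \<gamma> x
    using inv[OF that, of x] inv[OF is_subgroupD(3)[OF \<Gamma>(1) that], of "\<gamma> + x"] by auto
  have "almost_invariant_sequence \<mu> (orbit_relation \<Gamma> (+) \<mu>) (\<lambda>n. A)"
    by (rule almost_invariantI[OF prob sets \<Gamma>]) (simp_all add: A iff)
  then have "(\<lambda>n::nat. \<mu>.prob A * (1 - \<mu>.prob A)) \<longlonglongrightarrow> 0"
    using se unfolding strongly_ergodic_action_def strongly_ergodic_def by blast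
  then have "\<mu>.prob A = 0 \<or> \<mu>.prob A = 1" by (simp add: LIMSEQ_const_iff)
  then have "\<mu>.prob A = 1" using assms(8) by (auto simp: \<mu>.emeasure_eq_measure)
  then have "\<mu>.prob (UNIV - A) = 0" using \<mu>.prob_compl[of A] A sets sp by simp
  then show ?thesis by (simp add: \<mu>.emeasure_eq_measure Compl_eq_Diff_UNIV)
qed

section \<open>Displacement under small right translations\<close>

context orbit_map
begin

text \<open>\<open>borel_translation\<close> controls Haar measure one compact set at a time; since
  \<open>\<mu>\<close> is finite, countably many compact pieces can be combined.\<close>

lemma translation_\<mu>:
  assumes B [measurable]: "B \<in> sets borel"
  shows "((\<lambda>s. emeasure \<mu> {x. (x \<in> B) \<noteq> (x + s \<in> B)}) \<longlongrightarrow> 0) (nhds 0)"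
proof -
  obtain \<C> :: "'g set set" where \<C>: "countable \<C>" "\<forall>C\<in>\<C>. compact C" "\<Union>\<C> = UNIV"
    using lcsc_group_cover_compact by blast
  then have ne: "\<C> \<noteq> {}" by auto
  define D where "D = from_nat_into \<C>"
  have cD: "compact (D i)" for i using \<C>(2) from_nat_into[OF ne] by (auto simp: D_def)
  note [measurable] = borel_compact[OF cD]
  have UD: "(\<Union>i. D i) = UNIV" unfolding D_def using range_from_nat_into[OF ne \<C>(1)] \<C>(3) by simp
  show ?thesis
  proof (rule emeasure_tendsto_zero_countable[where X = UNIV and D = D])
    show "emeasure \<mu> (UNIV - (\<Union>i. D i)) = 0" by (simp only: UD Diff_cancel emeasure_empty)
    show "\<forall>\<^sub>F s in nhds 0. {x. (x \<in> B) \<noteq> (x + s \<in> B)} \<in> sets \<mu> \<and> {x. (x \<in> B) \<noteq> (x + s \<in> B)} \<subseteq> UNIV"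
      by (auto intro!: always_eventually)
    fix i
    have eq: "{x. (x \<in> B) \<noteq> (x + s \<in> B)} \<inter> D i = {x\<in>D i. (x \<in> B) \<noteq> (x + s \<in> B)}" for s by auto
    show "((\<lambda>s. emeasure \<mu> ({x. (x \<in> B) \<noteq> (x + s \<in> B)} \<inter> D i)) \<longlongrightarrow> 0) (nhds 0)"
      unfolding eq
      by (rule absolutely_continuous_tendsto_zero[OF ac(1) _ _ _ borel_translation[OF B cD]])
         (auto intro!: always_eventually \<mu>.finite_measure_axioms)
  qed (auto simp: less_top[symmetric])
qed

text \<open>Meant for pieces \<open>D i\<close> on which some Borel datum is constant or nearly so:
  a bad point is one that its translation moves out of its piece, and each piece is nearly invariant
  under small translations.\<close>

lemma \<mu>_tendsto_zero_cover:
  fixes D :: "nat \<Rightarrow> 'g set"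
  assumes D [measurable]: "\<And>i. D i \<in> sets borel" and S: "\<And>s. S s \<in> sets borel"
    and null: "emeasure \<mu> (UNIV - (\<Union>i. D i)) = 0"
    and sub: "\<And>s i x. x \<in> S s \<Longrightarrow> x \<in> D i \<Longrightarrow> x + s \<notin> D i"
  shows "((\<lambda>s. emeasure \<mu> (S s)) \<longlongrightarrow> 0) (nhds 0)"
proof (rule emeasure_tendsto_zero_countable[where X = UNIV and D = D])
  show "\<forall>\<^sub>F s in nhds 0. S s \<in> sets \<mu> \<and> S s \<subseteq> UNIV" using S by (auto intro!: always_eventually)
  fix i
  have "S s \<inter> D i \<subseteq> {x. (x \<in> D i) \<noteq> (x + s \<in> D i)}" for s using sub by blast
  then show "((\<lambda>s. emeasure \<mu> (S s \<inter> D i)) \<longlongrightarrow> 0) (nhds 0)"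
    by (intro tendsto_zero_mono[OF translation_\<mu>[OF D]] always_eventually allI emeasure_mono) auto
qed (use null in \<open>auto simp: less_top[symmetric]\<close>)

lemma \<mu>_mass_0_1:
  assumes A: "\<And>n. A n \<in> sets borel"
    and "\<And>\<gamma>. \<gamma> \<in> \<Gamma> \<Longrightarrow> (\<lambda>n. emeasure \<mu> {x. (x \<in> A n) \<noteq> (\<gamma> + x \<in> A n)}) \<longlonglongrightarrow> 0"
  shows "(\<lambda>n. \<mu>.prob (A n) * (1 - \<mu>.prob (A n))) \<longlonglongrightarrow> 0"
  using strongly_ergodic almost_invariantI[OF prob sets_\<mu> \<Gamma> assms]
  unfolding strongly_ergodic_action_def strongly_ergodic_def by blast

lemma ergodic:
  assumes A: "A \<in> sets borel" and inv: "\<And>\<gamma> x. \<gamma> \<in> \<Gamma> \<Longrightarrow> x \<in> A \<Longrightarrow> \<gamma> + x \<in> A" and "emeasure M A \<noteq> 0"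
  shows "AE x in M. x \<in> A"
proof -
  have "emeasure \<mu> (- A) = 0"
    by (rule strongly_ergodic_conull[OF prob sets_\<mu> \<Gamma> strongly_ergodic A])
       (use inv assms(3) null_\<mu>_iff[OF A] in auto)
  then have "emeasure M (- A) = 0" using null_\<mu>_iff[of "- A"] A by simp
  then show ?thesis using A by (intro AE_I[of _ _ "- A"]) auto
qed

text \<open>A left factor common to \<open>\<theta> x\<close> and \<open>\<theta> (x + s)\<close>
  cancels, which makes the displacement blind to a locally constant cocycle.\<close>

definition displ :: "'g \<Rightarrow> 'g \<Rightarrow> 'h" where
  "displ s x = - \<theta> x + \<theta> (x + s)"

lemma displ_measurable [measurable]: "displ s \<in> borel_measurable borel"
  unfolding displ_def by measurable

lemma displ_neq_sets: "{x. displ s (g + x) \<noteq> displ s x} \<in> sets borel"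
proof -
  have "{x. displ s (g + x) = displ s x} \<in> sets borel"
    using measurable_equality_set[of "\<lambda>x. displ s (g + x)" borel "displ s"] by simp
  from borel_comp[OF this] show ?thesis by (simp add: Compl_eq)
qed

lemma displ_add: "displ (s + t) x = displ s x + displ t (x + s)"
  by (simp add: displ_def grp)

text \<open>The cocycle takes values in the countable group, so it is nearly invariant under small
  right translations.\<close>

lemma displ_almost_invariant:
  assumes \<gamma>: "\<gamma> \<in> \<Gamma>"
  shows "((\<lambda>s. emeasure \<mu> {x. displ s (\<gamma> + x) \<noteq> displ s x}) \<longlongrightarrow> 0) (nhds 0)"
proof -
  have ne: "\<Lambda> \<noteq> {}" using is_subgroupD(1)[OF \<Lambda>(1)] by auto
  define l where "l = from_nat_into \<Lambda>"
  define D where "D i = {x. \<theta> (\<gamma> + x) = l i + \<theta> x}" for i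
  have D [measurable]: "D i \<in> sets borel" for i
    using measurable_equality_set[of "\<lambda>x. \<theta> (\<gamma> + x)" borel "\<lambda>x. l i + \<theta> x"] by (simp add: D_def)
  show ?thesis
  proof (rule \<mu>_tendsto_zero_cover[OF D displ_neq_sets])
    have "x \<in> (\<Union>i. D i)" if x: "x \<in> G0" for x
    proof -
      obtain k where "k \<in> \<Lambda>" "\<theta> (\<gamma> + x) = k + \<theta> x" using orbits[OF x G0_invariant[OF \<gamma> x]] \<gamma> by blast
      moreover obtain i where "l i = k" using from_nat_into_surj[OF \<Lambda>(2) \<open>k \<in> \<Lambda>\<close>] by (auto simp: l_def)
      ultimately show ?thesis by (auto simp: D_def)
    qed
    then have "UNIV - (\<Union>i. D i) \<subseteq> - G0" by blast
    from emeasure_mono[OF this, of \<mu>] show "emeasure \<mu> (UNIV - (\<Union>i. D i)) = 0"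
      using null_\<mu>_iff[of "- G0"] G0_conull by auto
    show "x + s \<notin> D i" if "x \<in> {x. displ s (\<gamma> + x) \<noteq> displ s x}" "x \<in> D i" for s i x
    proof
      assume "x + s \<in> D i"
      then have "displ s (\<gamma> + x) = displ s x" using that(2) by (simp add: D_def displ_def grp)
      then show False using that(1) by simp
    qed
  qed
qed

lemma displ_eq_sets [measurable]: "{x. displ s x = c} \<in> sets borel"
  "{x. displ s x \<noteq> c} \<in> sets borel"
proof -
  have "displ s -` {c} \<in> sets borel"
    using measurable_sets[OF displ_measurable, of "{c}"] by simp
  then show *: "{x. displ s x = c} \<in> sets borel" by (simp add: vimage_def)
  from borel_comp[OF *] show "{x. displ s x \<noteq> c} \<in> sets borel" by (simp add: Compl_eq)
qed

text \<open>Argued along sequences, because strong ergodicity speaks of sequences. Without a heavy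
  atom some Borel set has a preimage of mass between \<open>e\<close> and \<open>1 - e\<close>;
  along \<open>s n\<close> tending to 0 these preimages would form a non-trivial almost invariant
  sequence.\<close>

lemma eventually_displ_concentrated:
  assumes e: "0 < e" "e \<le> 1/3"
  shows "\<forall>\<^sub>F s in nhds 0. \<exists>c. \<mu>.prob {x. displ s x = c} > 1 - e"
proof (subst eventually_nhds_iff_sequentially, intro allI impI)
  fix s :: "nat \<Rightarrow> 'g" assume s: "s \<longlonglongrightarrow> 0"
  let ?P = "\<lambda>n. \<exists>c. \<mu>.prob {x. displ (s n) x = c} > 1 - e"
  \<comment> \<open>Where \<open>?P n\<close> holds, \<open>B n\<close> may be any Borel set; the
    sequence must be defined for every \<open>n\<close>.\<close>
  have "\<exists>B. B \<in> sets borel \<and> (\<not> ?P n \<longrightarrow> \<mu>.prob (displ (s n) -` B) \<ge> e \<and> \<mu>.prob (displ (s n) -` B) \<le> 1 - e)" for n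
  proof (cases "?P n")
    case False
    have "displ (s n) \<in> borel_measurable \<mu>" by simp
    from \<mu>.atom_if_no_intermediate_mass[OF this e] False
    obtain B where "B \<in> sets borel" "\<not> (\<mu>.prob (displ (s n) -` B) < e \<or> \<mu>.prob (displ (s n) -` B) > 1 - e)"
      by (simp add: vimage_singleton_eq[abs_def] vimage_def) blast
    then show ?thesis by (auto simp: not_less)
  qed auto
  then obtain B where B: "\<And>n. B n \<in> sets borel"
    "\<And>n. \<not> ?P n \<Longrightarrow> \<mu>.prob (displ (s n) -` B n) \<ge> e \<and> \<mu>.prob (displ (s n) -` B n) \<le> 1 - e"
    by metis
  define A where "A n = displ (s n) -` B n" for n
  have A: "A n \<in> sets borel" for n
    using measurable_sets[OF displ_measurable B(1)] by (simp add: A_def)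
  have "(\<lambda>n. emeasure \<mu> {x. (x \<in> A n) \<noteq> (\<gamma> + x \<in> A n)}) \<longlonglongrightarrow> 0" if \<gamma>: "\<gamma> \<in> \<Gamma>" for \<gamma>
  proof (rule tendsto_zero_mono)
    show "(\<lambda>n. emeasure \<mu> {x. displ (s n) (\<gamma> + x) \<noteq> displ (s n) x}) \<longlonglongrightarrow> 0"
      by (rule filterlim_compose[OF displ_almost_invariant[OF \<gamma>] s])
    show "\<forall>\<^sub>F n in sequentially. emeasure \<mu> {x. (x \<in> A n) \<noteq> (\<gamma> + x \<in> A n)}
      \<le> emeasure \<mu> {x. displ (s n) (\<gamma> + x) \<noteq> displ (s n) x}"
      by (intro always_eventually allI emeasure_mono) (auto simp: A_def displ_neq_sets)
  qed
  from \<mu>_mass_0_1[OF A this] have "(\<lambda>n. \<mu>.prob (A n) * (1 - \<mu>.prob (A n))) \<longlonglongrightarrow> 0" .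
  then have "\<forall>\<^sub>F n in sequentially. \<mu>.prob (A n) * (1 - \<mu>.prob (A n)) < e * e"
    using e by (intro order_tendstoD) auto
  then show "\<forall>\<^sub>F n in sequentially. ?P n"
  proof eventually_elim
    case (elim n)
    show ?case
    proof (rule ccontr)
      assume "\<not> ?P n"
      then have "\<mu>.prob (A n) \<ge> e" "1 - \<mu>.prob (A n) \<ge> e" using B(2)[of n] by (auto simp: A_def)
      then have "e * e \<le> \<mu>.prob (A n) * (1 - \<mu>.prob (A n))" using e by (intro mult_mono) auto
      then show False using elim by simp
    qed
  qed
qed

text \<open>A mass above one half belongs to at most one value; \<open>2/3\<close> matches the range
  \<open>e \<le> 1/3\<close>. Where no such value exists the choice is arbitrary, which does not
  happen for \<open>s\<close> near 0.\<close>

definition local_hom :: "'g \<Rightarrow> 'h" where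
  "local_hom s = (SOME c. \<mu>.prob {x. displ s x = c} > 2/3)"

lemma displ_local_hom:
  "((\<lambda>s. emeasure \<mu> {x. displ s x \<noteq> local_hom s}) \<longlongrightarrow> 0) (nhds 0)"
proof -
  have "((\<lambda>s. \<mu>.prob {x. displ s x \<noteq> local_hom s}) \<longlongrightarrow> 0) (nhds 0)"
  proof (rule order_tendstoI)
    fix a :: real assume a: "0 < a"
    define e where "e = min a (1/3)"
    have e: "0 < e" "e \<le> 1/3" "e \<le> a" using a by (auto simp: e_def)
    from eventually_displ_concentrated[OF e(1,2)]
    show "\<forall>\<^sub>F s in nhds 0. \<mu>.prob {x. displ s x \<noteq> local_hom s} < a"
    proof eventually_elim
      case (elim s)
      then obtain c where c: "\<mu>.prob {x. displ s x = c} > 1 - e" by blast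
      have "\<mu>.prob {x. displ s x = local_hom s} > 2/3"
        unfolding local_hom_def by (rule someI[of _ c]) (use c e in simp)
      have "local_hom s = c"
      proof (rule ccontr)
        assume ne: "local_hom s \<noteq> c"
        have "\<mu>.prob {x. displ s x = c} + \<mu>.prob {x. displ s x = local_hom s}
          = \<mu>.prob ({x. displ s x = c} \<union> {x. displ s x = local_hom s})"
          using ne by (intro \<mu>.finite_measure_Union[symmetric]) auto
        also have "\<dots> \<le> 1" by simp
        finally show False using \<open>\<mu>.prob {x. displ s x = local_hom s} > 2/3\<close> c e by simp
      qed
      moreover have "\<mu>.prob {x. displ s x \<noteq> c} = 1 - \<mu>.prob {x. displ s x = c}"
        using \<mu>.prob_compl[of "{x. displ s x = c}"] by (simp add: Compl_eq_Diff_UNIV[symmetric] Compl_eq)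
      ultimately show ?case using c e by simp
    qed
  qed (auto intro!: always_eventually order.strict_trans2[OF _ measure_nonneg])
  from tendsto_ennrealI[OF this] show ?thesis by (simp add: \<mu>.emeasure_eq_measure)
qed

text \<open>Weakens \<open>displ s x = c\<close> by a factor from \<open>\<Lambda>\<close>. The
  weaker condition is invariant under \<open>\<Gamma>\<close> on \<open>G0\<close>, so ergodicity
  spreads it from a non-null set to almost every point, and it can be added and inverted, so it
  spreads from small \<open>s\<close> to a whole connected group.\<close>

definition orbitwise :: "'g \<Rightarrow> 'h \<Rightarrow> bool" where
  "orbitwise s c \<longleftrightarrow> (AE x in M. \<exists>l\<in>\<Lambda>. \<theta> (x + s) = l + (\<theta> x + c))"

lemma orbitwise_add:
  assumes "orbitwise s c" "orbitwise t d"
  shows "orbitwise (s + t) (c + d)"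
  using assms(1) AE_right[OF assms(2)[unfolded orbitwise_def], of s] unfolding orbitwise_def
proof eventually_elim
  case (elim x)
  then obtain l l' where "l \<in> \<Lambda>" "\<theta> (x + s) = l + (\<theta> x + c)" "l' \<in> \<Lambda>" "\<theta> (x + s + t) = l' + (\<theta> (x + s) + d)"
    by blast
  then show ?case using is_subgroupD(2)[OF \<Lambda>(1)] by (intro bexI[of _ "l' + l"]) (auto simp: grp)
qed

lemma orbitwise_minus:
  assumes "orbitwise s c"
  shows "orbitwise (- s) (- c)"
  using AE_right[OF assms[unfolded orbitwise_def], of "- s"] unfolding orbitwise_def
proof eventually_elim
  case (elim x)
  then obtain l where l: "l \<in> \<Lambda>" "\<theta> x = l + (\<theta> (x + - s) + c)" by (auto simp: grp)
  then have "- l + (\<theta> x + - c) = \<theta> (x + - s)" by (simp add: grp)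
  then show ?case using is_subgroupD(3)[OF \<Lambda>(1)] l(1) by (intro bexI[of _ "- l"]) auto
qed

lemma orbitwise_if_nonnull:
  assumes "emeasure M {x. displ s x = c} \<noteq> 0"
  shows "orbitwise s c"
proof -
  define B where "B = {x. x \<in> G0 \<and> x + s \<in> G0 \<and> (\<exists>l\<in>\<Lambda>. \<theta> (x + s) = l + (\<theta> x + c))}"
  have m: "{x. \<theta> (x + s) = l + (\<theta> x + c)} \<in> sets borel" for l
    using measurable_equality_set[of "\<lambda>x. \<theta> (x + s)" borel "\<lambda>x. l + (\<theta> x + c)"] by simp
  have "B = G0 \<inter> {x. x + s \<in> G0} \<inter> (\<Union>l\<in>\<Lambda>. {x. \<theta> (x + s) = l + (\<theta> x + c)})" by (auto simp: B_def)
  then have B [measurable]: "B \<in> sets borel" using m \<Lambda>(2)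
    by (auto intro!: sets.Int sets.countable_UN'')
  have inv: "\<gamma> + x \<in> B" if \<gamma>: "\<gamma> \<in> \<Gamma>" and x: "x \<in> B" for \<gamma> x
  proof -
    have G: "x \<in> G0" "x + s \<in> G0" "\<gamma> + x \<in> G0" "\<gamma> + (x + s) \<in> G0"
      using x G0_invariant[OF \<gamma>] by (auto simp: B_def)
    obtain l where l: "l \<in> \<Lambda>" "\<theta> (x + s) = l + (\<theta> x + c)" using x by (auto simp: B_def)
    obtain k where k: "k \<in> \<Lambda>" "\<theta> (\<gamma> + x) = k + \<theta> x" using orbits[OF G(1,3)] \<gamma> by blast
    obtain k' where k': "k' \<in> \<Lambda>" "\<theta> (\<gamma> + (x + s)) = k' + \<theta> (x + s)" using orbits[OF G(2,4)] \<gamma> by blast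
    have "\<theta> (\<gamma> + x + s) = (k' + (l + - k)) + (\<theta> (\<gamma> + x) + c)" using l k k' by (simp add: grp)
    moreover have "k' + (l + - k) \<in> \<Lambda>" using l k k' is_subgroupD(2,3)[OF \<Lambda>(1)] by blast
    ultimately have "\<exists>l\<in>\<Lambda>. \<theta> (\<gamma> + x + s) = l + (\<theta> (\<gamma> + x) + c)" by blast
    then show ?thesis using G unfolding B_def mem_Collect_eq by (simp add: add.assoc)
  qed
  have "AE x in M. x \<in> G0" using G0_conull by (intro AE_I[of _ _ "- G0"]) auto
  from this AE_right[OF this, of s] have "AE x in M. x \<in> G0 \<and> x + s \<in> G0" by eventually_elim simp
  then have "AE x in M. x \<in> {x. displ s x = c} \<longrightarrow> x \<in> B"
  proof eventually_elim
    case (elim x)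
    then show ?case using is_subgroupD(1)[OF \<Lambda>(1)]
      by (auto simp: B_def displ_def grp intro!: bexI[of _ 0])
  qed
  then have "emeasure M {x. displ s x = c} \<le> emeasure M B"
    by (intro emeasure_mono_AE) auto
  then have "emeasure M B \<noteq> 0" using assms by auto
  then have "AE x in M. x \<in> B" by (intro ergodic[OF B]) (simp_all add: inv)
  then show ?thesis unfolding orbitwise_def
    by eventually_elim (auto simp: B_def)
qed

text \<open>Returns from \<open>\<mu>\<close> to Haar measure on a compact set: the additivity proof
  translates a bad set from the right, and it is \<open>M\<close> that this preserves.\<close>

lemma emeasure_compact_tendsto_zero:
  assumes C: "compact C" and S: "\<And>s. S s \<in> sets borel" and lim: "((\<lambda>s. emeasure \<mu> (S s)) \<longlongrightarrow> 0) F"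
  shows "((\<lambda>s. emeasure M {x\<in>C. x \<in> S s}) \<longlongrightarrow> 0) F"
proof -
  define N where "N = density M (indicator C)"
  have [measurable]: "C \<in> sets borel" using C by (rule borel_compact)
  have N: "emeasure N A = emeasure M {x\<in>C. x \<in> A}" if "A \<in> sets borel" for A
    unfolding N_def using that by (subst emeasure_restricted) (auto simp: Int_def)
  have "absolutely_continuous \<mu> N" unfolding absolutely_continuous_def
  proof
    fix A assume A: "A \<in> null_sets \<mu>"
    have "A \<in> sets borel" using null_setsD2[OF A] by simp
    then have m: "A \<in> sets borel" "emeasure M A = 0" using null_\<mu>_iff[of A] null_setsD1[OF A] by simp_all
    have "emeasure M {x\<in>C. x \<in> A} \<le> emeasure M A" by (rule emeasure_mono) (use m in auto)
    then show "A \<in> null_sets N" using N[OF m(1)] m by (intro null_setsI) (auto simp: N_def)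
  qed
  moreover have "finite_measure N"
    by (rule finite_measureI) (use N[of UNIV] haar_compact[OF C] in \<open>simp add: N_def\<close>)
  ultimately have "((\<lambda>s. emeasure N (S s)) \<longlongrightarrow> 0) F"
    by (intro absolutely_continuous_tendsto_zero[OF _ _ _ _ lim]) (auto simp: N_def S intro!: always_eventually)
  then show ?thesis using N[OF S] by simp
qed

lemma local_hom:
  shows "\<exists>W. open W \<and> 0 \<in> W \<and> (\<forall>s\<in>W. orbitwise s (local_hom s)) \<and>
      (\<forall>s\<in>W. \<forall>t\<in>W. s + t \<in> W \<longrightarrow> local_hom (s + t) = local_hom s + local_hom t)"
    and "(local_hom \<longlongrightarrow> 0) (nhds 0)"
proof -
  obtain C where C: "compact C" "emeasure M C \<noteq> 0" "emeasure M C \<noteq> \<infinity>"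
    using haar_compact_pos by blast
  have [measurable]: "C \<in> sets borel" using C(1) by (rule borel_compact)
  define m where "m = measure M C"
  have mC: "emeasure M C = ennreal m" unfolding m_def using C(3) by (simp add: emeasure_eq_ennreal_measure)
  have m: "m > 0" using mC C(2) by (metis ennreal_eq_0_iff not_le)
  define bad where "bad s = {x\<in>C. displ s x \<noteq> local_hom s}" for s
  have bad [measurable]: "bad s \<in> sets borel" for s unfolding bad_def by (simp add: Collect_conj_eq)
  have "((\<lambda>s. emeasure M (bad s)) \<longlongrightarrow> 0) (nhds 0)"
    unfolding bad_def using emeasure_compact_tendsto_zero[OF C(1) _ displ_local_hom] by simp
  \<comment> \<open>Four sets of this size are removed from \<open>C\<close> in the additivity
    argument, so a fifth of the mass each leaves a point over.\<close>
  then have e1: "\<forall>\<^sub>F s in nhds 0. emeasure M (bad s) < ennreal (m / 5)"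
    using m by (intro order_tendstoD) auto
  have e2: "\<forall>\<^sub>F s in nhds 0. emeasure M {x\<in>C. x + s \<notin> C} < ennreal (m / 5)"
    using m by (intro order_tendstoD(2)[OF compact_translation[OF C(1)]]) auto
  from e1 e2 eventually_unimodular
  have "\<forall>\<^sub>F s in nhds 0. s \<in> unimodular_part \<and> emeasure M (bad s) < ennreal (m / 5) \<and> emeasure M {x\<in>C. x + s \<notin> C} < ennreal (m / 5)"
    by eventually_elim simp
  then obtain W where W: "open W" "0 \<in> W" "\<And>s. s \<in> W \<Longrightarrow> s \<in> unimodular_part"
    "\<And>s. s \<in> W \<Longrightarrow> emeasure M (bad s) < ennreal (m / 5)" "\<And>s. s \<in> W \<Longrightarrow> emeasure M {x\<in>C. x + s \<notin> C} < ennreal (m / 5)"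
    unfolding eventually_nhds by blast
  have small: "\<exists>x\<in>C. x \<notin> A" if A: "A \<in> sets borel" "emeasure M A < ennreal m" for A
  proof (rule ccontr)
    assume "\<not> ?thesis"
    then have "C \<subseteq> A" by blast
    from emeasure_mono[OF this, of M] A mC show False by auto
  qed
  have "orbitwise s (local_hom s)" if s: "s \<in> W" for s
  proof (rule orbitwise_if_nonnull)
    have "emeasure M C \<le> emeasure M (bad s \<union> {x. displ s x = local_hom s})"
      by (intro emeasure_mono) (auto simp: bad_def)
    also have "\<dots> \<le> emeasure M (bad s) + emeasure M {x. displ s x = local_hom s}"
      by (intro emeasure_subadditive) auto
    finally have *: "ennreal m \<le> emeasure M (bad s) + emeasure M {x. displ s x = local_hom s}" by (simp add: mC)
    have "emeasure M (bad s) < ennreal m"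
      using W(4)[OF s] by (rule order.strict_trans) (use m in \<open>simp add: ennreal_less_iff\<close>)
    then show "emeasure M {x. displ s x = local_hom s} \<noteq> 0" using * by auto
  qed
  moreover have "local_hom (s + t) = local_hom s + local_hom t" if st: "s \<in> W" "t \<in> W" "s + t \<in> W" for s t
  proof -
    let ?T = "{x. x + s \<in> bad t}"
    \<comment> \<open>At a point of \<open>C\<close> off \<open>?A\<close> the displacements by
      \<open>s\<close> and \<open>s + t\<close>, and by \<open>t\<close> from \<open>x + s\<close>,
      all take their typical values; \<open>displ_add\<close> links the three.\<close>
    let ?A = "(bad s \<union> bad (s + t)) \<union> ({x\<in>C. x + s \<notin> C} \<union> ?T)"
    have T: "?T \<in> sets borel" by (rule haar_left_measurable) (rule bad)
    have CC: "{x\<in>C. x + s \<notin> C} \<in> sets borel" by measurable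
    have "emeasure M ?A \<le> emeasure M (bad s \<union> bad (s + t)) + emeasure M ({x\<in>C. x + s \<notin> C} \<union> ?T)"
      using T CC by (intro emeasure_subadditive) auto
    also have "\<dots> \<le> (emeasure M (bad s) + emeasure M (bad (s + t))) + (emeasure M {x\<in>C. x + s \<notin> C} + emeasure M ?T)"
      using T CC by (intro add_mono emeasure_subadditive) auto
    also have "emeasure M ?T = emeasure M (bad t)" by (rule haar_right[OF bad W(3)[OF st(1)]])
    also have "(emeasure M (bad s) + emeasure M (bad (s + t))) + (emeasure M {x\<in>C. x + s \<notin> C} + emeasure M (bad t))
      \<le> (ennreal (m / 5) + ennreal (m / 5)) + (ennreal (m / 5) + ennreal (m / 5))"
      using W(4)[OF st(1)] W(4)[OF st(2)] W(4)[OF st(3)] W(5)[OF st(1)] by (intro add_mono less_imp_le)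
    also have "\<dots> = ennreal (m / 5 + m / 5 + (m / 5 + m / 5))" using m by (simp only: ennreal_plus[symmetric] divide_nonneg_pos less_imp_le add_nonneg_nonneg zero_less_numeral)
    also have "\<dots> < ennreal m" using m by (simp add: ennreal_less_iff)
    finally obtain x where x: "x \<in> C" "x \<notin> ?A" using small[of ?A] T CC by auto
    then have "displ s x = local_hom s" "displ (s + t) x = local_hom (s + t)" "displ t (x + s) = local_hom t"
      by (auto simp: bad_def)
    then show ?thesis by (metis displ_add)
  qed
  ultimately show "\<exists>W. open W \<and> 0 \<in> W \<and> (\<forall>s\<in>W. orbitwise s (local_hom s)) \<and>
      (\<forall>s\<in>W. \<forall>t\<in>W. s + t \<in> W \<longrightarrow> local_hom (s + t) = local_hom s + local_hom t)"
    using W(1,2) by blast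
  show "(local_hom \<longlongrightarrow> 0) (nhds 0)"
  proof (rule topological_tendstoI)
    fix V :: "'h set" assume V: "open V" "0 \<in> V"
    obtain V' where V': "open V'" "0 \<in> V'" "\<forall>x\<in>V'. - x \<in> V'" "\<forall>x\<in>V'. \<forall>y\<in>V'. x + y \<in> V"
      using zero_nbhd_symmetric[OF V] by blast
    obtain h :: "nat \<Rightarrow> 'h" where h: "\<And>x. \<exists>i. - h i + x \<in> V'" using countable_translates[OF V'(1,2)] by blast
    \<comment> \<open>Countably many cells on which the values of \<open>\<theta>\<close> are
      \<open>V\<close>-close. If \<open>x\<close> and \<open>x + s\<close> share a cell, then
      \<open>displ s x\<close> lies in \<open>V\<close>.\<close>
    define D where "D i = {x. - h i + \<theta> x \<in> V'}" for i
    have D [measurable]: "D i \<in> sets borel" for i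
    proof -
      have "open {y. - h i + y \<in> V'}" by (intro open_vimage_cont V' continuous_intros)
      from measurable_sets[OF \<theta> borel_open[OF this]] show ?thesis by (simp add: D_def vimage_def)
    qed
    have Vm: "{x. displ s x \<notin> V} \<in> sets borel" for s
    proof -
      have "displ s -` (- V) \<in> sets borel"
        using measurable_sets[OF displ_measurable, of "- V"] V(1) by simp
      then show ?thesis by (simp add: vimage_def)
    qed
    have "((\<lambda>s. emeasure \<mu> {x. displ s x \<notin> V}) \<longlongrightarrow> 0) (nhds 0)"
    proof (rule \<mu>_tendsto_zero_cover[OF D Vm])
      have "(\<Union>i. D i) = UNIV" using h by (auto simp: D_def)
      then show "emeasure \<mu> (UNIV - (\<Union>i. D i)) = 0" by (simp only: Diff_cancel emeasure_empty)
      show "x + s \<notin> D i" if "x \<in> {x. displ s x \<notin> V}" "x \<in> D i" for s i x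
      proof
        assume "x + s \<in> D i"
        then have "- (- h i + \<theta> x) + (- h i + \<theta> (x + s)) \<in> V" using that(2) V'(3,4) by (auto simp: D_def)
        then show False using that(1) by (simp add: displ_def grp)
      qed
    qed
    from tendsto_add[OF this displ_local_hom]
    have "\<forall>\<^sub>F s in nhds 0. emeasure \<mu> {x. displ s x \<notin> V} + emeasure \<mu> {x. displ s x \<noteq> local_hom s} < 1"
      by (intro order_tendstoD) auto
    then show "\<forall>\<^sub>F s in nhds 0. local_hom s \<in> V"
    proof eventually_elim
      case (elim s)
      show ?case
      proof (rule ccontr)
        assume "local_hom s \<notin> V"
        then have "UNIV \<subseteq> {x. displ s x \<notin> V} \<union> {x. displ s x \<noteq> local_hom s}" by auto
        then have "emeasure \<mu> UNIV \<le> emeasure \<mu> ({x. displ s x \<notin> V} \<union> {x. displ s x \<noteq> local_hom s})"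
          using Vm by (intro emeasure_mono) auto
        also have "\<dots> \<le> emeasure \<mu> {x. displ s x \<notin> V} + emeasure \<mu> {x. displ s x \<noteq> local_hom s}"
          using Vm by (intro emeasure_subadditive) auto
        finally show False using elim \<mu>.emeasure_space_1 by simp
      qed
    qed
  qed
qed

end

subsection \<open>Homomorphisms on open subgroups\<close>

lemma open_subgroup:
  fixes T :: "'g::topological_group_add set"
  assumes T: "is_subgroup T" and N: "open N" "0 \<in> N" "N \<subseteq> T"
  shows "open T" "closed T"
proof -
  have coset: "open {x. - t + x \<in> N}" "t \<in> {x. - t + x \<in> N}" for t
    using N by (auto intro!: open_vimage_cont continuous_intros)
  show "open T"
  proof (subst open_subopen, intro ballI exI conjI)
    fix t assume t: "t \<in> T"
    show "{x. - t + x \<in> N} \<subseteq> T"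
    proof
      fix x assume "x \<in> {x. - t + x \<in> N}"
      then have "t + (- t + x) \<in> T" using is_subgroupD(2)[OF T t] N(3) by blast
      then show "x \<in> T" by simp
    qed
  qed (rule coset)+
  have "open (- T)"
  proof (subst open_subopen, intro ballI exI conjI)
    fix t assume t: "t \<in> - T"
    show "{x. - t + x \<in> N} \<subseteq> - T"
    proof
      fix x assume x: "x \<in> {x. - t + x \<in> N}"
      show "x \<in> - T"
      proof
        assume "x \<in> T"
        moreover have "- (- t + x) \<in> T" using x N(3) is_subgroupD(3)[OF T] by blast
        ultimately have "x + - (- t + x) \<in> T" by (rule is_subgroupD(2)[OF T])
        then show False using t by (simp add: grp)
      qed
    qed
  qed (rule coset)+
  then show "closed T" by (simp add: closed_open)
qed

lemma connected_subset_subgroup: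
  fixes T :: "'g::topological_group_add set"
  assumes "connected K" "0 \<in> K" and T: "is_subgroup T" "open N" "0 \<in> N" "N \<subseteq> T"
  shows "K \<subseteq> T"
proof (rule ccontr)
  assume "\<not> K \<subseteq> T"
  moreover have "open T" "open (- T)" using open_subgroup[OF T] by auto
  ultimately show False
    using connectedD[OF assms(1), of T "- T"] assms(2) is_subgroupD(1)[OF T(1)] by blast
qed

lemma simply_connected_imp_connected_group:
  assumes "simply_connected S"
  shows "connected S"
proof (rule path_connected_imp_connected)
  show "path_connected S" unfolding path_connected_def path_def path_image_def pathstart_def pathfinish_def
    using simply_connected_path[OF assms] by blast
qed

locale homomorphism_on =
  fixes K :: "'g::{topological_group_add, t2_space} set" and d :: "'g \<Rightarrow> 'h::topological_group_add"
  assumes K: "is_subgroup K" and add: "x \<in> K \<Longrightarrow> y \<in> K \<Longrightarrow> d (x + y) = d x + d y"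
begin

lemma zero: "d 0 = 0"
  using add[OF is_subgroupD(1)[OF K] is_subgroupD(1)[OF K]] add_left_cancel[of "d 0" "d 0" 0] by simp

lemma minus: "x \<in> K \<Longrightarrow> d (- x) = - d x"
  using add[of x "- x"] is_subgroupD(3)[OF K] zero minus_unique[of "d x" "d (- x)"] by simp

lemma continuous:
  assumes "open K" "(d \<longlongrightarrow> 0) (nhds 0)"
  shows "continuous_on K d"
  unfolding continuous_on_eq_continuous_at[OF assms(1)] isCont_def
proof
  fix x assume x: "x \<in> K"
  have "filterlim (\<lambda>y. - x + y) (nhds (- x + x)) (at x)" by (intro tendsto_intros)
  then have "filterlim (\<lambda>y. - x + y) (nhds 0) (at x)" by simp
  from filterlim_compose[OF assms(2) this] have "((\<lambda>y. d (- x + y)) \<longlongrightarrow> 0) (at x)" .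
  then have "((\<lambda>y. d x + d (- x + y)) \<longlongrightarrow> d x + 0) (at x)" by (intro tendsto_intros)
  then have lim: "((\<lambda>y. d x + d (- x + y)) \<longlongrightarrow> d x) (at x)" by simp
  have "\<forall>\<^sub>F y in at x. y \<in> K" using assms(1) x by (rule eventually_at_in_open')
  then have ev: "\<forall>\<^sub>F y in at x. d x + d (- x + y) = d y"
  proof eventually_elim
    case (elim y)
    then show ?case using add[OF x, of "- x + y"] is_subgroupD(2)[OF K is_subgroupD(3)[OF K x] elim] by simp
  qed
  show "(d \<longlongrightarrow> d x) (at x)" by (rule Lim_transform_eventually[OF lim ev])
qed

lemma subgroup_image: "is_subgroup (d ` K)"
  unfolding is_subgroup_def
proof (intro conjI ballI)
  show "0 \<in> d ` K" using zero is_subgroupD(1)[OF K] by (metis imageI)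
  show "x + y \<in> d ` K" if xy: "x \<in> d ` K" "y \<in> d ` K" for x y
  proof -
    obtain a b where "a \<in> K" "x = d a" "b \<in> K" "y = d b" using xy by blast
    then show ?thesis using add is_subgroupD(2)[OF K] by (metis imageI)
  qed
  show "- x \<in> d ` K" if xy: "x \<in> d ` K" for x
  proof -
    obtain a where "a \<in> K" "x = d a" using xy by blast
    then show ?thesis using minus is_subgroupD(3)[OF K] by (metis imageI)
  qed
qed

end

section \<open>Injectivity of open homomorphisms with countable kernel\<close>

text \<open>By Baire's theorem a countable closed set has an isolated point.\<close>

lemma countable_closed_isolated:
  fixes S :: "'g::lcsc_group set"
  assumes "closed S" "countable S" "S \<noteq> {}"
  shows "\<exists>k\<in>S. \<exists>U. open U \<and> U \<inter> S = {k}"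
proof -
  let ?X = "top_of_set S"
  have lc: "locally_compact_space ?X"
    unfolding locally_compact_space_def
  proof
    fix x assume "x \<in> topspace ?X"
    obtain U C :: "'g set" where UC: "open U" "compact C" "x \<in> U" "U \<subseteq> C" using locally_compact by blast
    have "compactin ?X (S \<inter> C)" using UC(2) assms(1) by (auto simp: compactin_subtopology Int_commute intro: compact_Int_closed)
    then show "\<exists>U K. openin ?X U \<and> compactin ?X K \<and> x \<in> U \<and> U \<subseteq> K"
      using UC \<open>x \<in> topspace ?X\<close> by (intro exI[of _ "S \<inter> U"] exI[of _ "S \<inter> C"]) (auto simp: openin_open)
  qed
  moreover have "Hausdorff_space ?X"
    unfolding Hausdorff_space_def
  proof (intro allI impI)
    fix x y assume xy: "x \<in> topspace ?X \<and> y \<in> topspace ?X \<and> x \<noteq> y"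
    then obtain U V where "open U" "open V" "x \<in> U" "y \<in> V" "U \<inter> V = {}" using hausdorff[of x y] by blast
    then show "\<exists>U V. openin ?X U \<and> openin ?X V \<and> x \<in> U \<and> y \<in> V \<and> disjnt U V"
      using xy by (intro exI[of _ "S \<inter> U"] exI[of _ "S \<inter> V"]) (auto simp: openin_open disjnt_def)
  qed
  ultimately have "locally_compact_space ?X \<and> regular_space ?X"
    using locally_compact_Hausdorff_imp_regular_space by blast
  moreover have "closedin ?X T" if "T \<in> (\<lambda>k. {k}) ` S" for T using that by (auto simp: closedin_closed intro: exI[of _ T])
  ultimately have "\<exists>T\<in>(\<lambda>k. {k}) ` S. ?X interior_of T \<noteq> {}"
    using Baire_category_alt[of ?X "(\<lambda>k. {k}) ` S"] assms(2,3) interior_of_topspace[of ?X] by auto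
  then obtain k where k: "k \<in> S" "?X interior_of {k} \<noteq> {}" by blast
  then have "?X interior_of {k} = {k}" using interior_of_subset[of ?X "{k}"] by blast
  then have "openin ?X {k}" using openin_interior_of[of ?X "{k}"] by simp
  then show ?thesis using k(1) by (auto simp: openin_open Int_commute)
qed

text \<open>A local section of an open homomorphism with discrete kernel extends to a left inverse,
  because the target is simply connected.\<close>

lemma (in haar_open) open_homomorphism_injective:
  fixes K :: "'k::lcsc_group set" and L :: "'g set" and d :: "'k \<Rightarrow> 'g"
  assumes K: "open K" "is_subgroup K" "connected K" and L: "open L" "is_subgroup L" "simply_connected L"
    and hom: "\<And>x y. x \<in> K \<Longrightarrow> y \<in> K \<Longrightarrow> d (x + y) = d x + d y" and cont: "continuous_on K d"
    and KL: "d ` K \<subseteq> L"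
    and opn: "\<And>V. open V \<Longrightarrow> 0 \<in> V \<Longrightarrow> V \<subseteq> K \<Longrightarrow> \<exists>U. open U \<and> 0 \<in> U \<and> U \<subseteq> d ` V"
    and ker: "countable {k\<in>K. d k = 0}"
  shows "inj_on d K"
proof -
  interpret d: homomorphism_on K d by unfold_locales (fact K hom)+
  let ?N = "{k\<in>K. d k = 0}"
  have K0: "0 \<in> K" by (rule is_subgroupD(1)[OF K(2)])
  have clK: "closed K" by (rule open_subgroup(2)[OF K(2,1) K0 subset_refl])
  have "closed ?N"
  proof -
    have "closedin (top_of_set K) (K \<inter> d -` {0})" using continuous_closedin_preimage[OF cont closed_singleton] .
    then have "closed (K \<inter> d -` {0})" using clK closedin_closed_trans by blast
    moreover have "K \<inter> d -` {0} = ?N" by blast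
    ultimately show ?thesis by simp
  qed
  moreover have "0 \<in> ?N" using K0 d.zero by simp
  ultimately obtain k U0 where k: "k \<in> ?N" "open U0" "U0 \<inter> ?N = {k}"
    using countable_closed_isolated[of ?N] ker by blast
  \<comment> \<open>Translating the isolated point \<open>k\<close> to 0 makes 0 isolated in the
    kernel.\<close>
  define U where "U = {x. k + x \<in> U0} \<inter> K"
  have U: "open U" "0 \<in> U" "U \<subseteq> K" unfolding U_def
    using k K(1) K0 by (auto intro!: open_Int open_vimage_cont continuous_intros)
  have UN: "x = 0" if x: "x \<in> U" "d x = 0" for x
  proof -
    have "x \<in> K" using x U(3) by blast
    then have "k + x \<in> ?N" using k(1) x(2) hom is_subgroupD(2)[OF K(2)] by simp
    then have "k + x \<in> U0 \<inter> ?N" using x(1) by (simp add: U_def)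
    then have "k + x = k" using k(3) by blast
    then show ?thesis using add_left_cancel[of k x 0] by simp
  qed
  \<comment> \<open>Two halvings, because the additivity of the section compares three elements of
    \<open>U2\<close>, whose combination must lie in \<open>U\<close>.\<close>
  obtain U1 where U1: "open U1" "0 \<in> U1" "U1 \<subseteq> U" "\<forall>x\<in>U1. \<forall>y\<in>U1. x + y \<in> U"
    using zero_nbhd_symmetric[OF U(1,2)] by blast
  obtain U2 where U2: "open U2" "0 \<in> U2" "U2 \<subseteq> U1" "\<forall>x\<in>U2. - x \<in> U2" "\<forall>x\<in>U2. \<forall>y\<in>U2. x + y \<in> U1"
    using zero_nbhd_symmetric[OF U1(1,2)] by blast
  have U2K: "x \<in> K" if "x \<in> U2" for x using that U2(3) U1(3) U(3) by blast
  have inj: "x = y" if xy: "x \<in> U2" "y \<in> U2" "d x = d y" for x y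
  proof -
    have "- x + y \<in> U" using xy U2 U1(3) by blast
    moreover have "d (- x + y) = 0"
      using hom[of "- x" y] d.minus[of x] U2K[OF xy(1)] U2K[OF xy(2)] is_subgroupD(3)[OF K(2)] xy(3) by simp
    ultimately have "- x + y = 0" by (rule UN)
    then have "x + (- x + y) = x + 0" by (rule arg_cong)
    then show ?thesis by simp
  qed
  have "U2 \<subseteq> K" using U2K by blast
  then obtain W where W: "open W" "0 \<in> W" "W \<subseteq> d ` U2" using opn[OF U2(1,2)] by blast
  define s where "s h = (SOME k. k \<in> U2 \<and> d k = h)" for h
  have s: "s h \<in> U2 \<and> d (s h) = h" if h: "h \<in> W" for h
  proof -
    obtain k where "k \<in> U2" "d k = h" using h W(3) by blast
    then show ?thesis unfolding s_def by (rule someI[of "\<lambda>k. k \<in> U2 \<and> d k = h" k, OF conjI])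
  qed
  have s_add: "s (g + h) = s g + s h" if gh: "g \<in> W" "h \<in> W" "g + h \<in> W" for g h
  proof -
    note sU = conjunct1[OF s[OF gh(1)]] conjunct1[OF s[OF gh(2)]] conjunct1[OF s[OF gh(3)]]
    note sK = sU[THEN U2K]
    have "(s g + s h) + - s (g + h) \<in> U" using sU U2 U1(4) by blast
    moreover have "d ((s g + s h) + - s (g + h)) = 0"
      using hom[OF is_subgroupD(2)[OF K(2) sK(1,2)] is_subgroupD(3)[OF K(2) sK(3)]] hom[OF sK(1,2)]
        d.minus[OF sK(3)] s[OF gh(1)] s[OF gh(2)] s[OF gh(3)] by simp
    ultimately have "(s g + s h) + - s (g + h) = 0" by (rule UN)
    then show ?thesis using right_minus_eq[of "s g + s h" "s (g + h)"] by (simp add: diff_conv_add_uminus)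
  qed
  have L': "0 \<in> L" by (rule is_subgroupD(1)[OF L(2)])
  obtain s' N2 where s': "open N2" "0 \<in> N2" "N2 \<subseteq> L" "\<forall>g\<in>N2. s' g = s g" "\<forall>g\<in>L. \<forall>h\<in>L. s' (g + h) = s' g + s' h"
    using local_homomorphism_extends[OF L W(1,2), of s] s_add by blast
  interpret s': homomorphism_on L s' by unfold_locales (use L s' in auto)
  \<comment> \<open>Near 0 the extended section is a left inverse of \<open>d\<close>; the subgroup
    \<open>T\<close> is therefore open and contains the connected group \<open>K\<close>.\<close>
  define T where "T = {k\<in>K. s' (d k) = k}"
  have dL: "d x \<in> L" if "x \<in> K" for x using KL that by blast
  have "is_subgroup T"
    unfolding is_subgroup_def
  proof (intro conjI ballI)
    show "0 \<in> T" using K0 d.zero s'.zero by (simp add: T_def)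
    show "x + y \<in> T" if xy: "x \<in> T" "y \<in> T" for x y
    proof -
      have k: "x \<in> K" "y \<in> K" "s' (d x) = x" "s' (d y) = y" using xy by (simp_all add: T_def)
      have "s' (d (x + y)) = x + y" using hom[OF k(1,2)] s'.add[OF dL[OF k(1)] dL[OF k(2)]] k(3,4) by simp
      then show ?thesis using is_subgroupD(2)[OF K(2) k(1,2)] by (simp add: T_def)
    qed
    show "- x \<in> T" if x: "x \<in> T" for x
    proof -
      have k: "x \<in> K" "s' (d x) = x" using x by (simp_all add: T_def)
      have "s' (d (- x)) = - x" using d.minus[OF k(1)] s'.minus[OF dL[OF k(1)]] k(2) by simp
      then show ?thesis using is_subgroupD(3)[OF K(2) k(1)] by (simp add: T_def)
    qed
  qed
  moreover have "\<exists>O'. open O' \<and> K \<inter> d -` (N2 \<inter> W) = K \<inter> O'"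
    using continuous_openin_preimage_gen[OF cont, of "N2 \<inter> W"] s'(1) W(1) by (auto simp: openin_open)
  then obtain O' where O': "open O'" "K \<inter> d -` (N2 \<inter> W) = K \<inter> O'" by blast
  have "open (U2 \<inter> O')" using O' U2 by blast
  moreover have "0 \<in> K \<inter> O'" unfolding O'(2)[symmetric] using K0 d.zero s' W by simp
  then have "0 \<in> U2 \<inter> O'" using U2 by blast
  moreover have "U2 \<inter> O' \<subseteq> T"
  proof
    fix x assume x: "x \<in> U2 \<inter> O'"
    then have "x \<in> K \<inter> O'" using U2K by blast
    then have dx: "x \<in> K" "d x \<in> N2" "d x \<in> W" unfolding O'(2)[symmetric] by auto
    have "s (d x) = x" using s[OF dx(3)] x inj[of "s (d x)" x] by blast
    then show "x \<in> T" using dx s'(4) by (simp add: T_def)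
  qed
  ultimately have "K \<subseteq> T" by (intro connected_subset_subgroup[OF K(3) K0])
  then show ?thesis by (intro inj_on_inverseI[of _ s']) (auto simp: T_def)
qed

text \<open>Openness at 0 spreads to every point by translation.\<close>

lemma homeomorphic_map_open_homomorphism:
  fixes K :: "'g::topological_group_add set" and d :: "'g \<Rightarrow> 'h::topological_group_add"
  assumes K: "open K" "is_subgroup K"
    and hom: "\<And>x y. x \<in> K \<Longrightarrow> y \<in> K \<Longrightarrow> d (x + y) = d x + d y" and cont: "continuous_on K d"
    and opn: "\<And>V. open V \<Longrightarrow> 0 \<in> V \<Longrightarrow> V \<subseteq> K \<Longrightarrow> \<exists>U. open U \<and> 0 \<in> U \<and> U \<subseteq> d ` V"
    and bij: "inj_on d K" "d ` K = L"
  shows "homeomorphic_map (top_of_set K) (top_of_set L) d"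
proof (rule bijective_open_imp_homeomorphic_map)
  show "continuous_map (top_of_set K) (top_of_set L) d" using cont bij(2) by auto
  show "open_map (top_of_set K) (top_of_set L) d"
    unfolding open_map_def
  proof (intro allI impI)
    fix U assume "openin (top_of_set K) U"
    then have U: "open U" "U \<subseteq> K" using K(1) by (auto simp: openin_open)
    have "open (d ` U)"
    proof (subst open_subopen, intro ballI)
      fix y assume "y \<in> d ` U"
      then obtain u where u: "u \<in> U" "y = d u" by blast
      have "open ({v. u + v \<in> U} \<inter> K)" "0 \<in> {v. u + v \<in> U} \<inter> K"
        using U(1) K u is_subgroupD(1)[OF K(2)] by (auto intro!: open_Int open_vimage_cont continuous_intros)
      then obtain W where W: "open W" "0 \<in> W" "W \<subseteq> d ` ({v. u + v \<in> U} \<inter> K)" using opn[of "{v. u + v \<in> U} \<inter> K"] by blast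
      have "{z. - y + z \<in> W} \<subseteq> d ` U"
      proof
        fix z assume "z \<in> {z. - y + z \<in> W}"
        then obtain v where v: "- y + z = d v" "u + v \<in> U" "v \<in> K" using W(3) by blast
        have "z = y + (- y + z)" by simp
        also have "\<dots> = d (u + v)" using v u hom U(2) by auto
        finally show "z \<in> d ` U" using v(2) by blast
      qed
      moreover have "open {z. - y + z \<in> W}" by (intro open_vimage_cont W continuous_intros)
      moreover have "y \<in> {z. - y + z \<in> W}" using W(2) by simp
      ultimately show "\<exists>T. open T \<and> y \<in> T \<and> T \<subseteq> d ` U" by blast
    qed
    then show "openin (top_of_set L) (d ` U)" using U(2) bij(2) by (auto simp: openin_open intro!: exI[of _ "d ` U"])
  qed
qed (use bij in auto)

subsection \<open>The isomorphism of the unimodular parts\<close>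

context haar
begin

lemma AE_left:
  assumes "AE x in M. P x"
  shows "AE x in M. P (s + x)"
proof -
  obtain N where N: "{x \<in> space M. \<not> P x} \<subseteq> N" "emeasure M N = 0" "N \<in> sets M"
    using assms by (rule AE_E)
  have "{x. s + x \<in> N} \<in> null_sets M"
    using N by (intro haar_left_null_sets null_setsI)
  then show ?thesis by (rule AE_I') (use N(1) in auto)
qed

end

context orbit_map
begin

lemma homomorphism_exists:
  assumes "simply_connected (unimodular_part :: 'g set)"
  shows "\<exists>d. (\<forall>x\<in>unimodular_part. \<forall>y\<in>unimodular_part. d (x + y) = d x + d y) \<and> (d \<longlongrightarrow> 0) (nhds 0) \<and>
    (\<forall>g\<in>unimodular_part. orbitwise g (d g))"
proof -
  let ?K = "unimodular_part :: 'g set"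
  obtain W where W: "open W" "0 \<in> W" "\<forall>s\<in>W. orbitwise s (local_hom s)"
    "\<forall>s\<in>W. \<forall>t\<in>W. s + t \<in> W \<longrightarrow> local_hom (s + t) = local_hom s + local_hom t"
    using local_hom(1) by (elim exE conjE)
  have "local_hom (s + t) = local_hom s + local_hom t" if "s \<in> W" "t \<in> W" "s + t \<in> W" for s t
    using W(4) that by blast
  then have "\<exists>d N. open N \<and> 0 \<in> N \<and> N \<subseteq> ?K \<and> (\<forall>g\<in>N. d g = local_hom g) \<and> (\<forall>g\<in>?K. \<forall>h\<in>?K. d (g + h) = d g + d h)"
    by (rule local_homomorphism_extends[OF open_unimodular_part subgroup_unimodular_part assms W(1,2)])
  then obtain d N where d: "open N" "0 \<in> N" "N \<subseteq> ?K" "\<forall>g\<in>N. d g = local_hom g" "\<forall>g\<in>?K. \<forall>h\<in>?K. d (g + h) = d g + d h"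
    by (elim exE conjE)
  interpret d: homomorphism_on ?K d by unfold_locales (use subgroup_unimodular_part d(5) in auto)
  have "\<forall>\<^sub>F g in nhds 0. local_hom g = d g"
    using eventually_nhds_in_open[OF d(1,2)] by eventually_elim (use d(4) in auto)
  from Lim_transform_eventually[OF local_hom(2) this] have lim: "(d \<longlongrightarrow> 0) (nhds 0)" .
  \<comment> \<open>So far \<open>orbitwise\<close> is known near 0 only; an open subgroup contains
    the connected kernel.\<close>
  define T where "T = {g\<in>?K. orbitwise g (d g)}"
  have zero: "orbitwise 0 (d 0)" unfolding orbitwise_def d.zero using is_subgroupD(1)[OF \<Lambda>(1)]
    by (auto intro!: bexI[of _ 0] AE_I2)
  have "is_subgroup T" unfolding is_subgroup_def T_def
    using zero is_subgroupD[OF subgroup_unimodular_part] by (auto simp: d.add d.minus intro: orbitwise_add orbitwise_minus)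
  moreover have "open (N \<inter> W)" "0 \<in> N \<inter> W" "N \<inter> W \<subseteq> T" using d W by (auto simp: T_def)
  ultimately have "?K \<subseteq> T"
    by (intro connected_subset_subgroup[OF simply_connected_imp_connected_group[OF assms] is_subgroupD(1)[OF subgroup_unimodular_part]])
  then show ?thesis using d(5) lim by (intro exI[of _ d]) (auto simp: T_def)
qed

lemma unimodular_part_nonnull: "emeasure M (unimodular_part :: 'g set) \<noteq> 0"
  using haar_open_pos[OF open_unimodular_part] is_subgroupD(1)[OF subgroup_unimodular_part] by blast

text \<open>Fubini trades a null set of \<open>x\<close> for each \<open>g\<close> against a single
  \<open>x\<close> with one null set of \<open>g\<close>.\<close>

lemma base_point:
  assumes d: "continuous_on unimodular_part d" and orb: "\<And>g. g \<in> unimodular_part \<Longrightarrow> orbitwise g (d g)"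
  shows "\<exists>x\<in>unimodular_part. AE g in M. g \<in> unimodular_part \<longrightarrow> x + g \<in> G0 \<and> (\<exists>l\<in>\<Lambda>. \<theta> (x + g) = l + (\<theta> x + d g))"
proof -
  let ?K = "unimodular_part :: 'g set"
  interpret pair_sigma_finite M M ..
  have K [measurable]: "?K \<in> sets borel" using open_unimodular_part by simp
  \<comment> \<open>Only the restriction of \<open>d\<close> to \<open>?K\<close> is continuous;
    extended by 0 it is Borel on the whole group, as Fubini requires.\<close>
  define D where "D g = (if g \<in> ?K then d g else 0)" for g
  have D [measurable]: "D \<in> borel_measurable borel" unfolding D_def
    by (rule borel_measurable_continuous_on_if[OF K d]) auto
  define E where "E l = {p \<in> space (M \<Otimes>\<^sub>M M). \<theta> (snd p + fst p) = l + (\<theta> (snd p) + D (fst p))}" for l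
  have E: "E l \<in> sets (M \<Otimes>\<^sub>M M)" for l unfolding E_def
    by (rule measurable_equality_set) measurable
  define P where "P g x \<longleftrightarrow> (g \<in> ?K \<longrightarrow> x + g \<in> G0 \<and> (\<exists>l\<in>\<Lambda>. \<theta> (x + g) = l + (\<theta> x + D g)))" for g x
  have G: "AE x in M. x \<in> G0" using G0_conull by (intro AE_I[of _ _ "- G0"]) auto
  have "AE x in M. P g x" for g
  proof (cases "g \<in> ?K")
    case True
    from orb[OF True, unfolded orbitwise_def] AE_right[OF G, of g] show ?thesis
      by eventually_elim (simp add: P_def D_def)
  qed (simp add: P_def)
  then have AE1: "AE g in M. AE x in M. P g x" by simp
  have "{p \<in> space (M \<Otimes>\<^sub>M M). fst p \<notin> ?K} \<in> sets (M \<Otimes>\<^sub>M M)"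
       "{p \<in> space (M \<Otimes>\<^sub>M M). snd p + fst p \<in> G0} \<in> sets (M \<Otimes>\<^sub>M M)" by measurable
  then have "{p \<in> space (M \<Otimes>\<^sub>M M). fst p \<notin> ?K} \<union> {p \<in> space (M \<Otimes>\<^sub>M M). snd p + fst p \<in> G0} \<inter> (\<Union>l\<in>\<Lambda>. E l) \<in> sets (M \<Otimes>\<^sub>M M)"
    by (intro sets.Un sets.Int sets.countable_UN''[OF \<Lambda>(2)] E)
  also have "{p \<in> space (M \<Otimes>\<^sub>M M). fst p \<notin> ?K} \<union> {p \<in> space (M \<Otimes>\<^sub>M M). snd p + fst p \<in> G0} \<inter> (\<Union>l\<in>\<Lambda>. E l)
    = {p \<in> space (M \<Otimes>\<^sub>M M). P (fst p) (snd p)}" unfolding P_def E_def by blast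
  finally have "AE x in M. AE g in M. P g x"
    using AE1 AE_commute[of P] by (simp add: split_beta')
  from AE_ex_in[OF this unimodular_part_nonnull] obtain x where x: "x \<in> ?K" "AE g in M. P g x" by blast
  from x(2) have "AE g in M. g \<in> ?K \<longrightarrow> x + g \<in> G0 \<and> (\<exists>l\<in>\<Lambda>. \<theta> (x + g) = l + (\<theta> x + d g))"
    by eventually_elim (auto simp: P_def D_def)
  then show ?thesis using x(1) by blast
qed

text \<open>\<open>nonsing\<close> is the link between the measure classes of the two groups; it is
  what makes the homomorphism open.\<close>

lemma isomorphism:
  fixes N :: "'h measure"
  assumes sc: "simply_connected (unimodular_part :: 'g set)" and "haar_open N"
    and scH: "simply_connected (unimodular_part :: 'h set)"
    and nonsing: "\<And>Z. Z \<in> sets borel \<Longrightarrow> emeasure N Z = 0 \<Longrightarrow> emeasure M {x\<in>G0. \<theta> x \<in> Z} = 0"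
  shows "\<exists>\<delta>. topological_group_isomorphism (unimodular_part :: 'g set) (unimodular_part :: 'h set) \<delta> \<and>
         \<delta> ` (\<Gamma> \<inter> unimodular_part) = \<Lambda> \<inter> unimodular_part"
proof -
  interpret N: haar_open N by fact
  define K where "K = (unimodular_part :: 'g set)"
  define L where "L = (unimodular_part :: 'h set)"
  have K: "open K" "is_subgroup K" "connected K" "0 \<in> K"
    using open_unimodular_part subgroup_unimodular_part simply_connected_imp_connected_group[OF sc]
      is_subgroupD(1)[OF subgroup_unimodular_part] by (auto simp: K_def)
  have L: "open L" "is_subgroup L" "connected L" "simply_connected L" "0 \<in> L"
    using N.open_unimodular_part N.subgroup_unimodular_part simply_connected_imp_connected_group[OF scH] scH
      is_subgroupD(1)[OF N.subgroup_unimodular_part] by (auto simp: L_def)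
  note Kc = is_subgroupD(2,3)[OF K(2)]
  obtain d0 where d0: "\<And>x y. x \<in> K \<Longrightarrow> y \<in> K \<Longrightarrow> d0 (x + y) = d0 x + d0 y" "(d0 \<longlongrightarrow> 0) (nhds 0)" "\<And>g. g \<in> K \<Longrightarrow> orbitwise g (d0 g)"
    using homomorphism_exists[OF sc] unfolding K_def by blast
  interpret d0: homomorphism_on K d0 by unfold_locales (fact K d0)+
  obtain x0 where x0: "x0 \<in> K" and gen0: "AE g in M. g \<in> K \<longrightarrow> x0 + g \<in> G0 \<and> (\<exists>l\<in>\<Lambda>. \<theta> (x0 + g) = l + (\<theta> x0 + d0 g))"
    using base_point[OF d0.continuous[OF K(1) d0(2), unfolded K_def] d0(3)[unfolded K_def]] unfolding K_def by blast
  define h0 where "h0 = \<theta> x0"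
  define good where "good g \<longleftrightarrow> x0 + g \<in> G0 \<and> (\<exists>l\<in>\<Lambda>. \<theta> (x0 + g) = l + (h0 + d0 g))" for g
  have gen: "AE g in M. g \<in> K \<longrightarrow> good g" using gen0 by (simp add: good_def h0_def)
  \<comment> \<open>Left translation of \<open>x0 + g\<close> by \<open>k\<close> is left
    translation of \<open>g\<close> by \<open>- x0 + k + x0\<close>. With this \<open>d\<close> it
    corresponds to left translation of \<open>h0 + d0 g\<close> by \<open>d k\<close>.\<close>
  define d where "d k = h0 + d0 (- x0 + k + x0) + - h0" for k
  have conj: "- x0 + k + x0 \<in> K" if "k \<in> K" for k using x0 Kc that by blast
  have d_hom: "d (x + y) = d x + d y" if "x \<in> K" "y \<in> K" for x y
  proof -
    have "- x0 + (x + y) + x0 = (- x0 + x + x0) + (- x0 + y + x0)" by (simp add: grp)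
    then have "d0 (- x0 + (x + y) + x0) = d0 (- x0 + x + x0) + d0 (- x0 + y + x0)"
      using d0(1)[OF conj[OF that(1)] conj[OF that(2)]] by simp
    then show ?thesis by (simp add: d_def grp)
  qed
  interpret d: homomorphism_on K d by unfold_locales (fact K d_hom)+
  have "filterlim (\<lambda>k. - x0 + k + x0) (nhds (- x0 + 0 + x0)) (nhds 0)" by (intro tendsto_intros filterlim_ident)
  then have "filterlim (\<lambda>k. - x0 + k + x0) (nhds 0) (nhds 0)" by simp
  from filterlim_compose[OF d0(2) this] have "((\<lambda>k. d0 (- x0 + k + x0)) \<longlongrightarrow> 0) (nhds 0)" .
  then have "((\<lambda>k. h0 + d0 (- x0 + k + x0) + - h0) \<longlongrightarrow> h0 + 0 + - h0) (nhds 0)" by (intro tendsto_intros)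
  then have "(d \<longlongrightarrow> 0) (nhds 0)" by (simp add: d_def[abs_def])
  from d.continuous[OF K(1) this] have cont: "continuous_on K d" .
  have nonnullK: "emeasure M K \<noteq> 0" using unimodular_part_nonnull by (simp add: K_def)

  have iff: "k \<in> \<Gamma> \<longleftrightarrow> d k \<in> \<Lambda>" if k: "k \<in> K" for k
  proof -
    let ?k = "- x0 + k + x0"
    \<comment> \<open>Both \<open>x0 + g\<close> and its translate by \<open>k\<close> have to be
      typical points, so that \<open>orbits\<close> can compare them.\<close>
    have "AE g in M. (g \<in> K \<longrightarrow> good g) \<and> (?k + g \<in> K \<longrightarrow> good (?k + g))"
      using gen AE_left[OF gen, of ?k] by eventually_elim blast
    from AE_ex_in[OF this nonnullK] obtain g where g: "g \<in> K" "good g" "good (?k + g)" using Kc(1)[OF conj[OF k]] by blast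
    obtain l1 where l1: "l1 \<in> \<Lambda>" "\<theta> (x0 + g) = l1 + (h0 + d0 g)" using g(2) by (auto simp: good_def)
    obtain l2 where l2: "l2 \<in> \<Lambda>" "\<theta> (x0 + (?k + g)) = l2 + (h0 + d0 (?k + g))" using g(3) by (auto simp: good_def)
    have xk: "x0 + (?k + g) = k + (x0 + g)" by (simp add: grp)
    have "h0 + d0 (?k + g) = d k + (h0 + d0 g)" using d0(1)[OF conj[OF k] g(1)] by (simp add: d_def grp)
    then have \<theta>k: "\<theta> (k + (x0 + g)) = l2 + (d k + (h0 + d0 g))" using l2(2) xk by simp
    have "k \<in> \<Gamma> \<longleftrightarrow> (\<exists>\<gamma>\<in>\<Gamma>. k + (x0 + g) = \<gamma> + (x0 + g))" by auto
    also have "\<dots> \<longleftrightarrow> (\<exists>l\<in>\<Lambda>. \<theta> (k + (x0 + g)) = l + \<theta> (x0 + g))"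
      using g(2,3) xk by (intro orbits) (auto simp: good_def)
    also have "\<dots> \<longleftrightarrow> (\<exists>l\<in>\<Lambda>. d k + (h0 + d0 g) = l + (h0 + d0 g))"
      unfolding \<theta>k l1(2) by (rule subgroup_orbit_shift[OF \<Lambda>(1) l1(1) l2(1)])
    also have "\<dots> \<longleftrightarrow> d k \<in> \<Lambda>" by auto
    finally show ?thesis .
  qed

  have opn: "\<exists>U. open U \<and> 0 \<in> U \<and> U \<subseteq> d ` V" if V: "open V" "0 \<in> V" "V \<subseteq> K" for V
  proof -
    obtain V1 where V1: "open V1" "0 \<in> V1" "V1 \<subseteq> V" "\<forall>x\<in>V1. - x \<in> V1" "\<forall>x\<in>V1. \<forall>y\<in>V1. x + y \<in> V"
      using zero_nbhd_symmetric[OF V(1,2)] by blast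
    obtain V0 where V0: "open V0" "0 \<in> V0" "compact (closure V0)" "closure V0 \<subseteq> V1"
      using zero_nbhd_compact[OF V1(1,2)] by blast
    have V0K: "closure V0 \<subseteq> K" using V0(4) V1(3) V(3) by blast
    define Q where "Q = d ` closure V0"
    have Q: "compact Q" unfolding Q_def
      by (intro compact_continuous_image V0(3) continuous_on_subset[OF cont V0K])
    have Qm: "Q \<in> sets borel" using Q by (rule borel_compact)
    have "emeasure N Q \<noteq> 0"
    proof
      assume Q0: "emeasure N Q = 0"
      obtain c :: "nat \<Rightarrow> 'g" where c: "\<And>x. \<exists>i. - c i + x \<in> V0" using countable_translates[OF V0(1,2)] by blast
      define Z1 where "Z1 = {y. y + - h0 \<in> Q}"
      have Z1: "Z1 \<in> sets borel" "emeasure N Z1 = 0"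
        unfolding Z1_def using Qm N.haar_right_null[OF Qm Q0] by (auto intro: N.haar_left_measurable(2))
      \<comment> \<open>Countably many left translates of \<open>Q + h0\<close>, indexed by
        \<open>\<Lambda>\<close> and by the translates of \<open>V0\<close> that cover the group.
        They capture \<open>\<theta> (x0 + g)\<close> for almost every \<open>g\<close> in
        \<open>K\<close>, so \<open>Z\<close> cannot be null.\<close>
      define Z where "Z = (\<Union>l\<in>\<Lambda>. \<Union>i. {y. - (l + d (c i)) + y \<in> Z1})"
      have "{y. - (l + d (c i)) + y \<in> Z1} \<in> null_sets N" for l i
        using Z1 by (intro N.haar_left_null_sets null_setsI) simp_all
      then have "Z \<in> null_sets N" unfolding Z_def using \<Lambda>(2) by (intro null_sets_UN') auto
      then have "Z \<in> sets borel" "emeasure N Z = 0" using null_setsD1[of Z N] null_setsD2[of Z N] by simp_all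
      note Zm = this(1)
      have Zn: "emeasure M {x\<in>G0. \<theta> x \<in> Z} = 0" by (rule nonsing) fact+
      have "{x\<in>G0. \<theta> x \<in> Z} = G0 \<inter> \<theta> -` Z" by blast
      then have m: "{x\<in>G0. \<theta> x \<in> Z} \<in> sets borel" using measurable_sets[OF \<theta> Zm] by simp
      have "{g. x0 + g \<in> {x\<in>G0. \<theta> x \<in> Z}} \<in> null_sets M"
        using Zn m by (intro haar_left_null_sets null_setsI) simp_all
      then have "AE g in M. g \<notin> {g. x0 + g \<in> {x\<in>G0. \<theta> x \<in> Z}}" by (rule AE_not_in)
      with gen have "AE g in M. (g \<in> K \<longrightarrow> good g) \<and> g \<notin> {g. x0 + g \<in> {x\<in>G0. \<theta> x \<in> Z}}"
        by eventually_elim blast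
      from AE_ex_in[OF this nonnullK] obtain g where g: "g \<in> K" "good g" "x0 + g \<notin> {x\<in>G0. \<theta> x \<in> Z}" by blast
      obtain l where l: "l \<in> \<Lambda>" "\<theta> (x0 + g) = l + (h0 + d0 g)" "x0 + g \<in> G0" using g(2) by (auto simp: good_def)
      let ?x = "x0 + g + - x0"
      have xK: "?x \<in> K" using x0 g(1) Kc by blast
      obtain i where i: "- c i + ?x \<in> V0" using c by blast
      then have iK: "- c i + ?x \<in> K" "- c i + ?x \<in> closure V0" using closure_subset[of V0] V0K by blast+
      have "?x + - (- c i + ?x) \<in> K" using xK iK(1) Kc by blast
      then have cK: "c i \<in> K" by (simp add: grp)
      have dx: "d ?x = h0 + d0 g + - h0" by (simp add: d_def grp)
      have "d ?x = d (c i) + d (- c i + ?x)" using d_hom[OF cK iK(1)] by simp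
      then have "d (- c i + ?x) = - d (c i) + (h0 + d0 g + - h0)" unfolding dx by simp
      then have "- (l + d (c i)) + \<theta> (x0 + g) + - h0 = d (- c i + ?x)"
        unfolding l(2) by (simp add: grp)
      then have "- (l + d (c i)) + \<theta> (x0 + g) \<in> Z1" using iK(2) unfolding Z1_def Q_def by (simp del: minus_add)
      then have "\<theta> (x0 + g) \<in> Z" unfolding Z_def using l(1) by blast
      then show False using g(3) l(3) by blast
    qed
    from N.steinhaus[OF Q this] obtain U where U: "open U" "0 \<in> U" "\<forall>s\<in>U. \<exists>x\<in>Q. x + s \<in> Q"
      unfolding eventually_nhds by blast
    have "U \<subseteq> d ` V"
    proof
      fix s assume "s \<in> U"
      then obtain q where "q \<in> Q" "q + s \<in> Q" using U(3) by blast
      then obtain u v where uv: "u \<in> closure V0" "v \<in> closure V0" "q = d u" "q + s = d v" unfolding Q_def by blast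
      have "s = - q + (q + s)" by simp
      also have "\<dots> = d (- u + v)"
        using uv d.minus d_hom Kc(2) V0K by (simp add: subset_iff)
      finally show "s \<in> d ` V" using uv V0(4) V1(4,5) by blast
    qed
    then show ?thesis using U by blast
  qed

  \<comment> \<open>An open subgroup contains every connected set through 0. This is used for
    \<open>L\<close> and the image of \<open>K\<close>, and then with their roles exchanged.\<close>
  have "connected (d ` K)" by (rule connected_continuous_image[OF cont K(3)])
  moreover have "0 \<in> d ` K" by (rule is_subgroupD(1)[OF d.subgroup_image])
  ultimately have KL: "d ` K \<subseteq> L" by (rule connected_subset_subgroup[OF _ _ L(2,1,5) subset_refl])
  obtain U where U: "open U" "0 \<in> U" "U \<subseteq> d ` K" using opn[OF K(1,4) subset_refl] by blast
  have LK: "L \<subseteq> d ` K" by (rule connected_subset_subgroup[OF L(3,5) d.subgroup_image U])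
  \<comment> \<open>As 0 belongs to \<open>\<Lambda>\<close>, \<open>iff\<close> puts the kernel
    into \<open>\<Gamma>\<close>, and countability of \<open>\<Gamma>\<close> passes to it.\<close>
  have "{k\<in>K. d k = 0} \<subseteq> \<Gamma>" using iff is_subgroupD(1)[OF \<Lambda>(1)] by auto
  then have ker: "countable {k\<in>K. d k = 0}" using \<Gamma>(2) by (rule countable_subset)
  have inj: "inj_on d K"
    by (rule N.open_homomorphism_injective[OF K(1,2,3) L(1,2,4) d_hom cont KL opn ker])
  have "topological_group_isomorphism K L d"
    unfolding topological_group_isomorphism_def
    using homeomorphic_map_open_homomorphism[OF K(1,2) d_hom cont opn inj] KL LK d_hom by blast
  moreover have "d ` (\<Gamma> \<inter> K) = \<Lambda> \<inter> L"
  proof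
    show "d ` (\<Gamma> \<inter> K) \<subseteq> \<Lambda> \<inter> L" using iff KL by blast
    show "\<Lambda> \<inter> L \<subseteq> d ` (\<Gamma> \<inter> K)"
    proof
      fix y assume y: "y \<in> \<Lambda> \<inter> L"
      then obtain k where "k \<in> K" "y = d k" using LK by blast
      then show "y \<in> d ` (\<Gamma> \<inter> K)" using iff y by blast
    qed
  qed
  ultimately show ?thesis unfolding K_def L_def by blast
qed

end

subsection \<open>Stable orbit equivalence\<close>

text \<open>The given equivalence lives on \<open>E\<close> only. A point of the saturation
  \<open>G0\<close> is moved into \<open>E'\<close> by the first suitable element in an enumeration
  of \<open>\<Gamma>\<close>, a measurable choice, and then mapped; by ergodicity the saturation is
  conull.\<close>

lemma stably_orbit_equivalent_imp_orbit_map: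
  fixes \<Gamma> :: "'g::lcsc_group set" and \<Lambda> :: "'h::lcsc_group set"
  assumes M: "haar_open M" and \<mu>: "prob_space \<mu>" "sets \<mu> = sets borel"
    and ac: "absolutely_continuous M \<mu>" "absolutely_continuous \<mu> M"
    and N: "sets \<nu> = sets borel" "absolutely_continuous N \<nu>" "sets N = sets borel"
    and \<Gamma>: "is_subgroup \<Gamma>" "countable \<Gamma>" and \<Lambda>: "is_subgroup \<Lambda>" "countable \<Lambda>"
    and se: "strongly_ergodic_action \<Gamma> (+) \<mu>"
    and soe: "stably_orbit_equivalent \<Gamma> (+) \<mu> \<Lambda> (+) \<nu>"
  shows "\<exists>\<theta> G0. orbit_map M \<mu> \<Gamma> \<Lambda> \<theta> G0 \<and>
    (\<forall>Z\<in>sets borel. emeasure N Z = 0 \<longrightarrow> emeasure M {x\<in>G0. \<theta> x \<in> Z} = 0)"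
proof -
  interpret M: haar_open M by fact
  have sp: "space \<mu> = UNIV" "space \<nu> = UNIV" using \<mu>(2) N(1) by (auto dest: sets_eq_imp_space_eq)
  have null_iff: "emeasure \<mu> A = 0 \<longleftrightarrow> emeasure M A = 0" if "A \<in> sets borel" for A
    using ac that \<mu>(2) unfolding absolutely_continuous_def null_sets_def by auto
  obtain E F \<theta>0 where EF: "E \<in> sets borel" "F \<in> sets borel" and E0: "emeasure \<mu> E \<noteq> 0"
    and iso: "nonsingular_isomorphism (restrict_space \<mu> E) (restrict_space \<nu> F) \<theta>0"
    and orb: "AE x in \<mu>. x \<in> E \<longrightarrow> \<theta>0 ` (action_orbit \<Gamma> (+) x \<inter> E) = action_orbit \<Lambda> (+) (\<theta>0 x) \<inter> F"
    using soe unfolding stably_orbit_equivalent_def \<mu>(2) N(1) by blast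
  note [measurable] = EF
  have bij: "bij_betw \<theta>0 E F" and m0: "\<theta>0 \<in> measurable (restrict_space \<mu> E) (restrict_space \<nu> F)"
    and ns0: "\<And>A. A \<in> sets (restrict_space \<nu> F) \<Longrightarrow> \<theta>0 -` A \<inter> E \<in> null_sets (restrict_space \<mu> E) \<longleftrightarrow> A \<in> null_sets (restrict_space \<nu> F)"
    using iso sp unfolding nonsingular_isomorphism_def by (auto simp: space_restrict_space)
  \<comment> \<open>The value 0 outside \<open>E\<close> only secures a Borel map on the whole
    group.\<close>
  define \<theta>1 where "\<theta>1 x = (if x \<in> E then \<theta>0 x else 0)" for x
  have "\<theta>0 \<in> measurable (restrict_space \<mu> E) \<nu>"
    using m0 by (simp add: measurable_restrict_space2_iff)
  then have "\<theta>1 \<in> measurable \<mu> \<nu>" unfolding \<theta>1_def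
    using measurable_restrict_space_iff[of E \<mu> 0 \<nu> \<theta>0] EF \<mu>(2) sp by simp
  then have \<theta>1 [measurable]: "\<theta>1 \<in> borel_measurable borel"
    by (simp add: measurable_cong_sets[OF \<mu>(2) N(1)])
  obtain B where B: "{x \<in> space \<mu>. \<not> (x \<in> E \<longrightarrow> \<theta>0 ` (action_orbit \<Gamma> (+) x \<inter> E) = action_orbit \<Lambda> (+) (\<theta>0 x) \<inter> F)} \<subseteq> B"
    "emeasure \<mu> B = 0" "B \<in> sets \<mu>" using orb by (rule AE_E)
  define E' where "E' = E - B"
  have Bm: "B \<in> sets borel" using B(3) \<mu>(2) by simp
  have E'm [measurable]: "E' \<in> sets borel" unfolding E'_def by (rule sets.Diff[OF EF(1) Bm])
  have E'orb: "\<theta>0 ` (action_orbit \<Gamma> (+) x \<inter> E) = action_orbit \<Lambda> (+) (\<theta>0 x) \<inter> F" if "x \<in> E'" for x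
    using that B(1) sp by (auto simp: E'_def)
  have E'E: "E' \<subseteq> E" by (auto simp: E'_def)
  have orb_iff: "(\<exists>\<gamma>\<in>\<Gamma>. y = \<gamma> + x) \<longleftrightarrow> (\<exists>l\<in>\<Lambda>. \<theta>0 y = l + \<theta>0 x)" if xy: "x \<in> E'" "y \<in> E'" for x y
  proof
    assume "\<exists>\<gamma>\<in>\<Gamma>. y = \<gamma> + x"
    then have "y \<in> action_orbit \<Gamma> (+) x \<inter> E" using xy E'E by (auto simp: action_orbit_def)
    then have "\<theta>0 y \<in> \<theta>0 ` (action_orbit \<Gamma> (+) x \<inter> E)" by (rule imageI)
    then have "\<theta>0 y \<in> action_orbit \<Lambda> (+) (\<theta>0 x)" unfolding E'orb[OF xy(1)] by simp
    then show "\<exists>l\<in>\<Lambda>. \<theta>0 y = l + \<theta>0 x" by (auto simp: action_orbit_def)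
  next
    assume "\<exists>l\<in>\<Lambda>. \<theta>0 y = l + \<theta>0 x"
    then have "\<theta>0 y \<in> action_orbit \<Lambda> (+) (\<theta>0 x) \<inter> F"
      using bij_betw_apply[OF bij, of y] xy E'E by (auto simp: action_orbit_def)
    then obtain y' where y': "y' \<in> action_orbit \<Gamma> (+) x \<inter> E" "\<theta>0 y = \<theta>0 y'" unfolding E'orb[OF xy(1), symmetric] by blast
    then have "y = y'" using bij_betw_imp_inj_on[OF bij] xy E'E by (meson IntD2 inj_onD subsetD)
    then show "\<exists>\<gamma>\<in>\<Gamma>. y = \<gamma> + x" using y'(1) by (auto simp: action_orbit_def)
  qed
  have "emeasure \<mu> E \<le> emeasure \<mu> E' + emeasure \<mu> B"
  proof -
    have "emeasure \<mu> E \<le> emeasure \<mu> (E' \<union> B)" using \<mu>(2) E'm Bm by (intro emeasure_mono) (auto simp: E'_def)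
    also have "\<dots> \<le> emeasure \<mu> E' + emeasure \<mu> B" using \<mu>(2) E'm Bm by (intro emeasure_subadditive) auto
    finally show ?thesis .
  qed
  then have E'0: "emeasure \<mu> E' \<noteq> 0" using E0 B(2) by auto
  define g where "g = from_nat_into \<Gamma>"
  have "\<Gamma> \<noteq> {}" using is_subgroupD(1)[OF \<Gamma>(1)] by auto
  then have g: "g n \<in> \<Gamma>" for n unfolding g_def by (rule from_nat_into)
  have g_surj: "\<exists>n. g n = \<gamma>" if "\<gamma> \<in> \<Gamma>" for \<gamma> unfolding g_def using from_nat_into_surj[OF \<Gamma>(2) that] .
  define G0 where "G0 = (\<Union>n. {x. g n + x \<in> E'})"
  have G0 [measurable]: "G0 \<in> sets borel" unfolding G0_def
    by (intro sets.countable_UN' M.haar_left_measurable(1)[OF E'm]) auto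
  have G0_inv: "\<gamma> + x \<in> G0" if \<gamma>: "\<gamma> \<in> \<Gamma>" and x: "x \<in> G0" for \<gamma> x
  proof -
    obtain n where n: "g n + x \<in> E'" using x by (auto simp: G0_def)
    have "g n + - \<gamma> \<in> \<Gamma>" using is_subgroupD(2,3)[OF \<Gamma>(1)] g \<gamma> by blast
    then obtain m where "g m = g n + - \<gamma>" using g_surj by blast
    then have "g m + (\<gamma> + x) = g n + x" by (simp add: grp)
    then show ?thesis using n unfolding G0_def by (intro UN_I[of m]) auto
  qed
  define idx where "idx x = (LEAST n. g n + x \<in> E')" for x
  have idx: "g (idx x) + x \<in> E'" if "x \<in> G0" for x
    using that unfolding idx_def G0_def by (auto intro: LeastI)
  have idx_m [measurable]: "idx \<in> measurable borel (count_space UNIV)" unfolding idx_def by measurable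
  define \<theta> where "\<theta> x = \<theta>1 (g (idx x) + x)" for x
  have \<theta>_eq: "\<theta> x = \<theta>0 (g (idx x) + x)" if "x \<in> G0" for x
    using idx[OF that] E'E by (auto simp: \<theta>_def \<theta>1_def)
  have \<theta> [measurable]: "\<theta> \<in> borel_measurable borel" unfolding \<theta>_def
    by (rule measurable_compose_countable[OF _ idx_m]) measurable
  have orbits: "(\<exists>\<gamma>\<in>\<Gamma>. y = \<gamma> + x) \<longleftrightarrow> (\<exists>l\<in>\<Lambda>. \<theta> y = l + \<theta> x)" if xy: "x \<in> G0" "y \<in> G0" for x y
  proof -
    show ?thesis
      using orb_iff[OF idx[OF xy(1)] idx[OF xy(2)]] subgroup_orbit_shift[OF \<Gamma>(1) g g, of "idx y" y "idx x" x]
      by (simp only: \<theta>_eq[OF xy(1)] \<theta>_eq[OF xy(2)])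
  qed
  obtain n0 where n0: "g n0 = 0" using g_surj[OF is_subgroupD(1)[OF \<Gamma>(1)]] by blast
  have "E' \<subseteq> {x. g n0 + x \<in> E'}" using n0 by auto
  then have "E' \<subseteq> G0" unfolding G0_def by blast
  from emeasure_mono[OF this, of \<mu>] have "emeasure \<mu> G0 \<noteq> 0" using E'0 \<mu>(2) by auto
  then have "emeasure \<mu> (- G0) = 0"
    by (intro strongly_ergodic_conull[OF \<mu> \<Gamma> se G0]) (simp_all add: G0_inv)
  then have G0c: "emeasure M (- G0) = 0" using null_iff[of "- G0"] by simp
  have "orbit_map M \<mu> \<Gamma> \<Lambda> \<theta> G0"
    by (intro orbit_map.intro orbit_map_axioms.intro)
      (use M \<mu> ac \<Gamma> \<Lambda> se G0c G0_inv orbits in simp_all)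
  moreover have "emeasure M {x\<in>G0. \<theta> x \<in> Z} = 0" if Z [measurable]: "Z \<in> sets borel" and "emeasure N Z = 0" for Z
  proof -
    have "Z \<in> null_sets N" using Z that(2) N(3) by (intro null_setsI) auto
    then have Z\<nu>: "Z \<in> null_sets \<nu>" using N(2) unfolding absolutely_continuous_def by blast
    have ZF: "Z \<inter> F \<in> null_sets \<nu>" by (rule null_sets_subset[OF Z\<nu>]) (use Z EF N(1) in auto)
    have "Z \<inter> F \<in> null_sets (restrict_space \<nu> F)"
      using ZF EF N(1) by (simp add: null_sets_restrict_space)
    then have "\<theta>0 -` (Z \<inter> F) \<inter> E \<in> null_sets (restrict_space \<mu> E)"
      using ns0[OF null_setsD2] by blast
    then have "\<theta>0 -` (Z \<inter> F) \<inter> E \<in> null_sets \<mu>"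
      using EF \<mu>(2) by (simp add: null_sets_restrict_space)
    then have D: "\<theta>0 -` (Z \<inter> F) \<inter> E \<in> sets borel" "emeasure M (\<theta>0 -` (Z \<inter> F) \<inter> E) = 0"
      using null_iff null_setsD1 null_setsD2 \<mu>(2) by blast+
    have "{x. g n + x \<in> \<theta>0 -` (Z \<inter> F) \<inter> E} \<in> null_sets M" for n
      using D by (intro M.haar_left_null_sets null_setsI) simp_all
    then have U: "(\<Union>n. {x. g n + x \<in> \<theta>0 -` (Z \<inter> F) \<inter> E}) \<in> null_sets M" by (intro null_sets_UN)
    \<comment> \<open>The index of the translating element varies with \<open>x\<close>, so the
      preimage is spread over countably many translates of one null set.\<close>
    have "{x\<in>G0. \<theta> x \<in> Z} \<subseteq> (\<Union>n. {x. g n + x \<in> \<theta>0 -` (Z \<inter> F) \<inter> E})"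
    proof
      fix x assume x: "x \<in> {x\<in>G0. \<theta> x \<in> Z}"
      then have "g (idx x) + x \<in> E" using idx E'E by blast
      moreover from this have "\<theta>0 (g (idx x) + x) \<in> F" by (rule bij_betw_apply[OF bij])
      moreover have "\<theta>0 (g (idx x) + x) \<in> Z" using x \<theta>_eq[of x] by auto
      ultimately show "x \<in> (\<Union>n. {x. g n + x \<in> \<theta>0 -` (Z \<inter> F) \<inter> E})" by blast
    qed
    from emeasure_mono[OF this null_setsD2[OF U]] show ?thesis using null_setsD1[OF U] by simp
  qed
  ultimately show ?thesis by blast
qed

text \<open>The image of Haar measure under \<open>\<delta>\<close> is left invariant on
  \<open>L\<close> and charges \<open>L\<close>, as does \<open>N\<close>; two such measures share
  their null sets.\<close>

lemma isomorphism_nonsingular: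
  fixes M :: "'g::lcsc_group measure" and N :: "'h::lcsc_group measure"
  assumes "haar M" "haar N" and K: "open K" "is_subgroup K" and L: "open L" "is_subgroup L"
    and maps: "continuous_on K \<delta>" "bij_betw \<delta> K L"
    and hom: "\<And>x y. x \<in> K \<Longrightarrow> y \<in> K \<Longrightarrow> \<delta> (x + y) = \<delta> x + \<delta> y"
    and A: "A \<in> sets borel" "A \<subseteq> L"
  shows "emeasure M (\<delta> -` A \<inter> K) = 0 \<longleftrightarrow> emeasure N A = 0"
proof -
  interpret M: haar M by fact
  interpret N: haar N by fact
  interpret \<delta>: homomorphism_on K \<delta> by unfold_locales (fact K hom)+
  have Km: "K \<in> sets borel" using K(1) by simp
  have img: "\<delta> ` K = L" using maps(2) by (rule bij_betw_imp_surj_on)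
  have clK: "closed K" by (rule open_subgroup(2)[OF K(2,1) is_subgroupD(1)[OF K(2)] subset_refl])
  define P where "P = distr (restrict_space M K) borel \<delta>"
  have "\<delta> \<in> measurable (restrict_space borel K) borel"
    by (rule borel_measurable_continuous_on_restrict[OF maps(1)])
  then have m: "\<delta> \<in> measurable (restrict_space M K) borel"
    by (simp add: measurable_cong_sets[OF sets_restrict_space_cong[OF M.sets_haar] refl])
  have P: "emeasure P X = emeasure M (\<delta> -` X \<inter> K)" if "X \<in> sets borel" for X
  proof -
    have "emeasure P X = emeasure (restrict_space M K) (\<delta> -` X \<inter> K)"
      unfolding P_def using emeasure_distr[OF m that] by (simp add: space_restrict_space)
    also have "\<dots> = emeasure M (\<delta> -` X \<inter> K)" using Km by (intro emeasure_restrict_space) auto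
    finally show ?thesis .
  qed
  have "emeasure P A = 0 \<longleftrightarrow> emeasure N A = 0"
  proof (rule left_invariant_null_iff[where S = L])
    show "sigma_finite_measure P"
    proof
      obtain \<C> :: "'g set set" where \<C>: "countable \<C>" "\<forall>C\<in>\<C>. compact C" "\<Union>\<C> = UNIV"
        using lcsc_group_cover_compact by blast
      \<comment> \<open>The compact images cover \<open>L\<close>; the set \<open>- L\<close>, of
        \<open>P\<close>-mass 0, completes the cover of the space.\<close>
      let ?B = "insert (- L) ((\<lambda>C. \<delta> ` (C \<inter> K)) ` \<C>)"
      have comp: "compact (C \<inter> K)" "compact (\<delta> ` (C \<inter> K))" if "C \<in> \<C>" for C
      proof -
        show c: "compact (C \<inter> K)" using \<C>(2) that clK by (intro compact_Int_closed) auto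
        show "compact (\<delta> ` (C \<inter> K))" by (intro compact_continuous_image c continuous_on_subset[OF maps(1)]) auto
      qed
      show "\<exists>A. countable A \<and> A \<subseteq> sets P \<and> \<Union>A = space P \<and> (\<forall>a\<in>A. emeasure P a \<noteq> \<infinity>)"
      proof (intro exI[of _ ?B] conjI ballI)
        show "countable ?B" using \<C>(1) by simp
        show "?B \<subseteq> sets P" using comp(2) L(1) by (auto simp: P_def intro: borel_compact)
        have "L \<subseteq> \<Union>?B"
        proof
          fix y assume "y \<in> L"
          then obtain k where k: "k \<in> K" "y = \<delta> k" using img by blast
          obtain C where "C \<in> \<C>" "k \<in> C" using \<C>(3) by blast
          then show "y \<in> \<Union>?B" using k by blast
        qed
        then show "\<Union>?B = space P" by (auto simp: P_def)
        fix a assume a: "a \<in> ?B"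
        show "emeasure P a \<noteq> \<infinity>"
        proof (cases "a = - L")
          case True
          have "\<delta> -` (- L) \<inter> K = {}" using img by blast
          then show ?thesis using P[of "- L"] L(1) True by (simp only: emeasure_empty) auto
        next
          case False
          then obtain C where C: "C \<in> \<C>" "a = \<delta> ` (C \<inter> K)" using a by blast
          have "\<delta> -` a \<inter> K = C \<inter> K" using bij_betw_imp_inj_on[OF maps(2)] by (auto simp: C(2) inj_on_def)
          then show ?thesis using P[of a] comp[OF C(1)] M.haar_compact[of "C \<inter> K"] C(2) by (simp add: borel_compact)
        qed
      qed
    qed
    show "left_invariant_on L P" unfolding left_invariant_on_def
    proof (intro ballI impI)
      fix l X assume l: "l \<in> L" and X: "X \<in> sets borel" "X \<subseteq> L"
      obtain k where k: "k \<in> K" "l = \<delta> k" using l img by blast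
      have lX: "{x. l + x \<in> X} \<in> sets borel" by (rule N.haar_left_measurable(1)[OF X(1)])
      have DX: "\<delta> -` X \<inter> K \<in> sets borel"
        using measurable_sets[OF m X(1)] Km by (simp add: space_restrict_space sets_restrict_space_iff)
      have "\<delta> -` {x. l + x \<in> X} \<inter> K = {x. k + x \<in> \<delta> -` X \<inter> K}"
      proof (intro set_eqI iffI)
        fix x assume "x \<in> \<delta> -` {x. l + x \<in> X} \<inter> K"
        then show "x \<in> {x. k + x \<in> \<delta> -` X \<inter> K}" using k hom is_subgroupD(2)[OF K(2)] by auto
      next
        fix x assume x: "x \<in> {x. k + x \<in> \<delta> -` X \<inter> K}"
        then have "- k + (k + x) \<in> K" using is_subgroupD(2,3)[OF K(2)] k(1) by blast
        then have "x \<in> K" by simp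
        then show "x \<in> \<delta> -` {x. l + x \<in> X} \<inter> K" using x k hom by auto
      qed
      then show "emeasure P {x. l + x \<in> X} = emeasure P X"
        using P[OF lX] P[OF X(1)] M.haar_left[OF DX] by simp
    qed
    have "\<delta> -` L \<inter> K = K" using img by blast
    then show "emeasure P L \<noteq> 0"
      using P[of L] L(1) M.haar_open_pos[OF K(1)] is_subgroupD(1)[OF K(2)] by auto
    show "emeasure N L \<noteq> 0" using N.haar_open_pos[OF L(1)] is_subgroupD(1)[OF L(2)] by auto
  qed (use A L N.haar_left_invariant N.sigma_finite_measure_axioms in \<open>auto simp: P_def\<close>)
  then show ?thesis using P[OF A(1)] by simp
qed

text \<open>\<open>\<delta>\<close> itself is the equivalence, from \<open>K\<close> to
  \<open>L\<close>. For \<open>x\<close> in \<open>K\<close> the orbit of \<open>x\<close> meets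
  \<open>K\<close> exactly in its orbit under \<open>\<Gamma> \<inter> K\<close>, because
  \<open>\<gamma> + x \<in> K\<close> forces \<open>\<gamma> \<in> K\<close>; likewise in
  \<open>L\<close>.\<close>

lemma isomorphism_imp_stably_orbit_equivalent:
  fixes \<Gamma> :: "'g::lcsc_group set" and \<Lambda> :: "'h::lcsc_group set"
  assumes M: "haar M" "haar N" and K: "open K" "is_subgroup K" and L: "open L" "is_subgroup L"
    and \<mu>: "sets \<mu> = sets borel" "absolutely_continuous M \<mu>" "absolutely_continuous \<mu> M"
    and \<nu>: "sets \<nu> = sets borel" "absolutely_continuous N \<nu>" "absolutely_continuous \<nu> N"
    and iso: "topological_group_isomorphism K L \<delta>" "\<delta> ` (\<Gamma> \<inter> K) = \<Lambda> \<inter> L"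
  shows "stably_orbit_equivalent \<Gamma> (+) \<mu> \<Lambda> (+) \<nu>"
proof -
  interpret M: haar M by fact
  interpret N: haar N by fact
  have sp: "space \<mu> = UNIV" "space \<nu> = UNIV" using \<mu>(1) \<nu>(1) by (auto dest: sets_eq_imp_space_eq)
  have null_\<mu>: "emeasure \<mu> A = 0 \<longleftrightarrow> emeasure M A = 0" if "A \<in> sets borel" for A
    using \<mu> that unfolding absolutely_continuous_def null_sets_def by auto
  have null_\<nu>: "emeasure \<nu> A = 0 \<longleftrightarrow> emeasure N A = 0" if "A \<in> sets borel" for A
    using \<nu> that unfolding absolutely_continuous_def null_sets_def by auto
  have hom: "\<delta> (x + y) = \<delta> x + \<delta> y" if "x \<in> K" "y \<in> K" for x y
    using iso(1) that by (simp add: topological_group_isomorphism_def)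
  have "homeomorphic_map (top_of_set K) (top_of_set L) \<delta>"
    using iso(1) by (simp add: topological_group_isomorphism_def)
  then obtain \<eta> where "homeomorphic_maps (top_of_set K) (top_of_set L) \<delta> \<eta>"
    unfolding homeomorphic_map_maps by blast
  then have cont: "continuous_on K \<delta>" "continuous_on L \<eta>" "\<delta> ` K \<subseteq> L" "\<eta> ` L \<subseteq> K"
    and inv: "\<And>x. x \<in> K \<Longrightarrow> \<eta> (\<delta> x) = x" "\<And>y. y \<in> L \<Longrightarrow> \<delta> (\<eta> y) = y"
    unfolding homeomorphic_maps_def by (auto simp: image_subset_iff_funcset)
  have bij: "bij_betw \<delta> K L"
    by (rule bij_betw_byWitness[of K \<eta> \<delta> L]) (use cont inv in auto)
  have Km: "K \<in> sets borel" and Lm: "L \<in> sets borel" using K L by auto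
  have m1: "\<delta> \<in> measurable (restrict_space \<mu> K) (restrict_space \<nu> L)"
  proof (rule measurable_restrict_space2)
    show "\<delta> \<in> space (restrict_space \<mu> K) \<rightarrow> L" using cont(3) by (auto simp: space_restrict_space sp)
    show "\<delta> \<in> measurable (restrict_space \<mu> K) \<nu>"
      using borel_measurable_continuous_on_restrict[OF cont(1)]
      by (simp add: measurable_cong_sets[OF sets_restrict_space_cong[OF \<mu>(1)] \<nu>(1)])
  qed
  have "\<eta> \<in> measurable (restrict_space \<nu> L) (restrict_space \<mu> K)"
  proof (rule measurable_restrict_space2)
    show "\<eta> \<in> space (restrict_space \<nu> L) \<rightarrow> K" using cont(4) by (auto simp: space_restrict_space sp)
    show "\<eta> \<in> measurable (restrict_space \<nu> L) \<mu>"
      using borel_measurable_continuous_on_restrict[OF cont(2)]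
      by (simp add: measurable_cong_sets[OF sets_restrict_space_cong[OF \<nu>(1)] \<mu>(1)])
  qed
  moreover have "inv_into K \<delta> y = \<eta> y" if "y \<in> space (restrict_space \<nu> L)" for y
  proof -
    have "y \<in> L" using that by (simp add: space_restrict_space sp)
    then show ?thesis using inv cont(4) bij_betw_imp_inj_on[OF bij] by (intro inv_into_f_eq) auto
  qed
  ultimately have m2: "inv_into K \<delta> \<in> measurable (restrict_space \<nu> L) (restrict_space \<mu> K)"
    by (subst measurable_cong)
  have null: "\<delta> -` A \<inter> K \<in> null_sets (restrict_space \<mu> K) \<longleftrightarrow> A \<in> null_sets (restrict_space \<nu> L)"
    if "A \<in> sets (restrict_space \<nu> L)" for A
  proof -
    have A: "A \<in> sets borel" "A \<subseteq> L" using that Lm \<nu>(1) sp by (auto simp: sets_restrict_space_iff)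
    have "\<delta> -` A \<inter> K \<in> sets (restrict_space \<mu> K)"
      using measurable_sets[OF m1 that] by (simp add: space_restrict_space sp)
    then have DA: "\<delta> -` A \<inter> K \<in> sets borel" using Km \<mu>(1) by (auto simp: sets_restrict_space_iff)
    have "\<delta> -` A \<inter> K \<in> null_sets (restrict_space \<mu> K) \<longleftrightarrow> \<delta> -` A \<inter> K \<in> null_sets \<mu>"
      using Km \<mu>(1) by (subst null_sets_restrict_space) auto
    also have "\<dots> \<longleftrightarrow> emeasure M (\<delta> -` A \<inter> K) = 0"
      unfolding null_sets_def using null_\<mu>[OF DA] DA \<mu>(1) by simp
    also have "\<dots> \<longleftrightarrow> emeasure N A = 0" by (rule isomorphism_nonsingular[OF M K L cont(1) bij hom A])
    also have "\<dots> \<longleftrightarrow> A \<in> null_sets \<nu>"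
      unfolding null_sets_def using null_\<nu>[OF A(1)] A(1) \<nu>(1) by simp
    also have "\<dots> \<longleftrightarrow> A \<in> null_sets (restrict_space \<nu> L)"
      using Lm \<nu>(1) A(2) by (subst null_sets_restrict_space) auto
    finally show ?thesis .
  qed
  have "nonsingular_isomorphism (restrict_space \<mu> K) (restrict_space \<nu> L) \<delta>"
    unfolding nonsingular_isomorphism_def using bij m1 m2 null by (simp add: space_restrict_space sp)
  moreover have "\<delta> ` (action_orbit \<Gamma> (+) x \<inter> K) = action_orbit \<Lambda> (+) (\<delta> x) \<inter> L" if x: "x \<in> K" for x
  proof (intro set_eqI iffI)
    fix y assume "y \<in> \<delta> ` (action_orbit \<Gamma> (+) x \<inter> K)"
    then obtain \<gamma> where \<gamma>: "\<gamma> \<in> \<Gamma>" "\<gamma> + x \<in> K" "y = \<delta> (\<gamma> + x)" by (auto simp: action_orbit_def)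
    have "\<gamma> + x + - x \<in> K" using \<gamma>(2) x is_subgroupD(2,3)[OF K(2)] by blast
    then have \<gamma>K: "\<gamma> \<in> K" by (simp add: grp)
    then have "\<delta> \<gamma> \<in> \<Lambda>" using \<gamma>(1) iso(2) by blast
    moreover have "y = \<delta> \<gamma> + \<delta> x" using hom[OF \<gamma>K x] \<gamma>(3) by simp
    moreover have "y \<in> L" using \<gamma>(2,3) cont(3) by blast
    ultimately show "y \<in> action_orbit \<Lambda> (+) (\<delta> x) \<inter> L" by (auto simp: action_orbit_def)
  next
    fix y assume "y \<in> action_orbit \<Lambda> (+) (\<delta> x) \<inter> L"
    then obtain l where l: "l \<in> \<Lambda>" "y = l + \<delta> x" "l + \<delta> x \<in> L" by (auto simp: action_orbit_def)
    have "\<delta> x \<in> L" using x cont(3) by blast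
    then have "l + \<delta> x + - \<delta> x \<in> L" using l(3) is_subgroupD(2,3)[OF L(2)] by blast
    then have "l \<in> \<Lambda> \<inter> L" using l(1) by (simp add: grp)
    then obtain \<gamma> where \<gamma>: "\<gamma> \<in> \<Gamma>" "\<gamma> \<in> K" "l = \<delta> \<gamma>" unfolding iso(2)[symmetric] by blast
    have "y = \<delta> (\<gamma> + x)" using hom[OF \<gamma>(2) x] \<gamma>(3) l(2) by simp
    moreover have "\<gamma> + x \<in> action_orbit \<Gamma> (+) x \<inter> K"
      using \<gamma> x is_subgroupD(2)[OF K(2)] by (auto simp: action_orbit_def)
    ultimately show "y \<in> \<delta> ` (action_orbit \<Gamma> (+) x \<inter> K)" by blast
  qed
  then have "AE x in \<mu>. x \<in> K \<longrightarrow> \<delta> ` (action_orbit \<Gamma> (+) x \<inter> K) = action_orbit \<Lambda> (+) (\<delta> x) \<inter> L"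
    by (intro AE_I2 impI)
  moreover have "emeasure \<mu> K \<noteq> 0"
    using null_\<mu>[OF Km] M.haar_open_pos[OF K(1)] is_subgroupD(1)[OF K(2)] by auto
  moreover have "emeasure \<nu> L \<noteq> 0"
    using null_\<nu>[OF Lm] N.haar_open_pos[OF L(1)] is_subgroupD(1)[OF L(2)] by auto
  moreover have "K \<in> sets \<mu>" "L \<in> sets \<nu>" using Km Lm \<mu>(1) \<nu>(1) by auto
  ultimately show ?thesis unfolding stably_orbit_equivalent_def by blast
qed

theorem theorem2p3:
  fixes \<Gamma> :: "'g::lcsc_group set" and \<Lambda> :: "'h::lcsc_group set"
    and \<mu>G :: "'g measure" and \<mu>H :: "'h measure"
  assumes "\<not> unimodular TYPE('g)"
    and "almost_unimodular TYPE('g)"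
    and "simply_connected (unimodular_part :: 'g set)"
    and "haar_class_probability \<mu>G"
    and "is_subgroup \<Gamma>" and "countable \<Gamma>" and "closure \<Gamma> = UNIV"
    and "strongly_ergodic_action \<Gamma> (+) \<mu>G"
    and "almost_unimodular TYPE('h)"
    and "simply_connected (unimodular_part :: 'h set)"
    and "haar_class_probability \<mu>H"
    and "is_subgroup \<Lambda>" and "countable \<Lambda>"
  shows "stably_orbit_equivalent \<Gamma> (+) \<mu>G \<Lambda> (+) \<mu>H \<longleftrightarrow>
    (\<exists>\<delta>. topological_group_isomorphism (unimodular_part :: 'g set) (unimodular_part :: 'h set) \<delta> \<and>
         \<delta> ` (\<Gamma> \<inter> unimodular_part) = \<Lambda> \<inter> unimodular_part)"
proof -
  obtain M :: "'g measure" where M: "left_haar_measure M" "absolutely_continuous M \<mu>G" "absolutely_continuous \<mu>G M"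
    using assms(4) unfolding haar_class_probability_def by blast
  obtain N :: "'h measure" where N: "left_haar_measure N" "absolutely_continuous N \<mu>H" "absolutely_continuous \<mu>H N"
    using assms(11) unfolding haar_class_probability_def by blast
  have \<mu>: "prob_space \<mu>G" "sets \<mu>G = sets borel" "sets \<mu>H = sets borel"
    using assms(4,11) by (auto simp: haar_class_probability_def)
  interpret M: haar_open M
    by unfold_locales (use M(1) assms(2) in \<open>auto simp: almost_unimodular_def\<close>)
  interpret N: haar_open N
    by unfold_locales (use N(1) assms(9) in \<open>auto simp: almost_unimodular_def\<close>)
  show ?thesis
  proof
    assume soe: "stably_orbit_equivalent \<Gamma> (+) \<mu>G \<Lambda> (+) \<mu>H"
    obtain \<theta> G0 where om: "orbit_map M \<mu>G \<Gamma> \<Lambda> \<theta> G0"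
      and Z: "\<forall>Z\<in>sets borel. emeasure N Z = 0 \<longrightarrow> emeasure M {x\<in>G0. \<theta> x \<in> Z} = 0"
      using stably_orbit_equivalent_imp_orbit_map[OF M.haar_open_axioms \<mu>(1,2) M(2,3) \<mu>(3) N(2) N.sets_haar
          assms(5,6,12,13,8) soe] by blast
    interpret orbit_map M \<mu>G \<Gamma> \<Lambda> \<theta> G0 by (rule om)
    show "\<exists>\<delta>. topological_group_isomorphism (unimodular_part :: 'g set) (unimodular_part :: 'h set) \<delta> \<and>
         \<delta> ` (\<Gamma> \<inter> unimodular_part) = \<Lambda> \<inter> unimodular_part"
      by (rule isomorphism[OF assms(3) N.haar_open_axioms assms(10)]) (use Z in blast)
  next
    assume "\<exists>\<delta>. topological_group_isomorphism (unimodular_part :: 'g set) (unimodular_part :: 'h set) \<delta> \<and>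
         \<delta> ` (\<Gamma> \<inter> unimodular_part) = \<Lambda> \<inter> unimodular_part"
    then obtain \<delta> where "topological_group_isomorphism (unimodular_part :: 'g set) (unimodular_part :: 'h set) \<delta>"
      "\<delta> ` (\<Gamma> \<inter> unimodular_part) = \<Lambda> \<inter> unimodular_part" by blast
    from isomorphism_imp_stably_orbit_equivalent[OF M.haar_axioms N.haar_axioms M.open_unimodular_part
        M.subgroup_unimodular_part N.open_unimodular_part N.subgroup_unimodular_part \<mu>(2) M(2,3) \<mu>(3) N(2,3) this]
    show "stably_orbit_equivalent \<Gamma> (+) \<mu>G \<Lambda> (+) \<mu>H" .
  qed
qed

end
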